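(* Let $l\ge0$. For $f\in\mathcal H_l^{\mathbb C}$ let $F_f=\Psi_l(f)=f\circ v\in\mathrm{Sym}^{2l}$, where $v(z_0,z_1)=(z_0^2-z_1^2,\,i(z_0^2+z_1^2),\,2z_0z_1)$. The following are true. (i) (Algebra) The substitution $P\mapsto P\circ v$ induces an isomorphism of graded algebras $\mathbb C[x_1,x_2,x_3]/(q)\cong\bigoplus_{l\ge0}\mathrm{Sym}^{2l}$, which maps $P_l(\mathbb C^3)$ onto $\mathrm{Sym}^{2l}$ with kernel $q\,P_{l-2}(\mathbb C^3)$. Its restriction $\Psi_l:\mathcal H_l^{\mathbb C}\to\mathrm{Sym}^{2l}$ is a linear isomorphism. If $P\in P_l(\mathbb C^3)$ and $P\circ v=F$, then $\Psi_l^{-1}(F)=\pi(P)$, where $$\pi(P)=\sum_{j=0}^{\lfloor l/2\rfloor}\frac{(-1)^j\,q^j\,\Delta^jP}{2^j\,j!\,\prod_{i=1}^{j}(2l-2i+1)}.$$ For $f\in\mathcal H_l^{\mathbb C}$ and $g\in\mathcal H_m^{\mathbb C}$ one has $\Psi_{l+m}(\pi(fg))=\Psi_l(f)\,\Psi_m(g)$. (ii) (Equivariance) The map $\rho$ is a surjective homomorphism $\mathrm{SL}_2(\mathbb C)\to\mathrm{SO}_3(\mathbb C)$ with kernel $\{\pm1\}$. It restricts to a surjective homomorphism $\mathrm{SU}(2)\to\mathrm{SO}(3)$ with kernel $\{\pm1\}$. For $g\in\mathrm{SL}_2(\mathbb C)$ and $f\in\mathcal H_l^{\mathbb C}$ one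 has $\Psi_l(\rho(g)\cdot f)=g\cdot\Psi_l(f)$. Every $\mathrm{SL}_2(\mathbb C)$-equivariant linear map $\mathcal H_l^{\mathbb C}\to\mathrm{Sym}^{2l}$ is a scalar multiple of $\Psi_l$. (iii) (Coefficients) For $|m|\le l$, $$\Psi_l(\mathcal Y_{lm})=K_{lm}\,z_0^{l-m}z_1^{l+m},\qquad K_{lm}=\frac{(2l)!}{l!}\sqrt{\frac{2l+1}{(l-m)!\,(l+m)!}}.$$ For $f=\sum_{|m|\le l}\eta_m\mathcal Y_{lm}\in\mathcal H_l^{\mathbb C}$ and $F_f=\sum_k\binom{2l}ka_kz_0^{2l-k}z_1^k$ one has $\eta_m=\dfrac{l!\,a_{l+m}}{\sqrt{(2l+1)(l-m)!(l+m)!}}$. Let $f=\sum_{|m|\le l}c_{lm}Y_{lm}\in\mathcal H_l$ be real, $F_f=\sum_k\binom{2l}ka_kz_0^{2l-k}z_1^k$, and $\nu_{lp}=\sqrt{(2l+1)(l-p)!(l+p)!/2}\,/\,l!$ for $1\le p\le l$. Then $$a_l=\sqrt{2l+1}\,c_{l0},\quad a_{l-p}=\nu_{lp}(c_{lp}+i\,c_{l,-p}),\quad a_{l+p}=(-1)^p\nu_{lp}(c_{lp}-i\,c_{l,-p}).$$ Conversely, $c_{l0}=a_l/\sqrt{2l+1}$, $c_{lp}=\Re(a_{l-p})/\nu_{lp}$ and $c_{l,-p}=\Im(a_{l-p})/\nu_{lp}$. (iv) (Norm) For every $f\in\mathcal H_l^{\mathbb C}$, $\|\Psi_l(f)\|_{\rm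 BW}^2=(2l+1)\binom{2l}l\|f\|_{L^2(d\omega)}^2$. Hence $\widehat\Psi_l=\bigl((2l+1)\binom{2l}l\bigr)^{-1/2}\Psi_l$ is unitary from $\mathcal H_l^{\mathbb C}$ with the $L^2(\mathbb S^2,d\omega)$ norm to $\mathrm{Sym}^{2l}$ with the Bombieri--Weyl norm. For real $f\in\mathcal H_l$ one has $\|F_f\|_{\rm BW}^2=(-1)^l(F_f,F_f)_{2l}$, where $(F,F)_{2l}=\sum_k(-1)^k\binom{2l}ka_ka_{2l-k}$ is the $2l$-th transvectant of $F$ with itself. (v) (Real form) For $f\in\mathcal H_l^{\mathbb C}$ one has $\Psi_l(\bar f)=\sigma_l(\Psi_lf)$. Hence $\Psi_l(\mathcal H_l)=\operatorname{Fix}(\sigma_l)$, the set of forms with $a_{2l-k}=(-1)^{l+k}\bar a_k$ for all $k$.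
   Context: $P_l(\mathbb C^3)$ is the space of complex homogeneous polynomials of degree $l$ in $x=(x_1,x_2,x_3)$ (zero for $l<0$); $q=x_1^2+x_2^2+x_3^2$; $\Delta$ is the Laplacian; $\mathcal H_l^{\mathbb C}=\ker\Delta\cap P_l(\mathbb C^3)$, and $\mathcal H_l$ is its subspace of polynomials with real coefficients (identified with their restrictions to the unit sphere $\mathbb S^2$). $\bar f(x)=\overline{f(\bar x)}$. $\pi(P)$ denotes the harmonic part of $P\in P_l(\mathbb C^3)$: the unique element of $\mathcal H_l^{\mathbb C}$ with $P-\pi(P)\in q\,P_{l-2}(\mathbb C^3)$. $\mathrm{SO}_3(\mathbb C)$ is the group of complex $3\times3$ matrices of determinant one preserving $q$, acting by $(A\cdot f)(x)=f(A^{-1}x)$. $\mathrm{Sym}^n$ is the space of complex binary forms of degree $n$ in $z_0,z_1$ with $\mathrm{SL}_2(\mathbb C)$ acting by $(g\cdot F)(z)=F(g^{-1}z)$. $\rho(g)\in\mathrm{GL}_3(\mathbb C)$ is the unique matrix with $v(gz)=\rho(g)v(z)$ for all $z\in\mathbb C^2$; $\mathrm{SL}_2(\mathbb C)$ acts on $\mathcal H_l^{\mathbb C}$ through $\rho$. $d\omega$ is the rotation-invariant probability measure on $\mathbb S^2$. With $u=(\sin\theta\cos\phi,\sin\theta\sin\phi,\cos\theta)$, $P_l$ the Legendre polynomial and $P_l^m(t)=(1-t^2)^{m/2}P_l^{(m)}(t)$ (where $P_l^{(m)}$ is the $m$-th derivative), the real basis of $\mathcal H_l$ is $Y_{l0}=\sqrt{2l+1}\,P_l(\cos\theta)$,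 $Y_{lm}=N_{lm}P_l^m(\cos\theta)\cos m\phi$, $Y_{l,-m}=N_{lm}P_l^m(\cos\theta)\sin m\phi$ for $1\le m\le l$, $N_{lm}=\sqrt{2(2l+1)(l-m)!/(l+m)!}$; it is orthonormal in $L^2(d\omega)$. Put $\mathcal Y_{l0}=Y_{l0}$ and $\mathcal Y_{l,\pm p}=\frac{(\mp1)^p}{\sqrt2}(Y_{lp}\pm iY_{l,-p})$ for $1\le p\le l$. The Bombieri--Weyl norm of $F=\sum_{k=0}^{2l}\binom{2l}ka_kz_0^{2l-k}z_1^k$ is $\|F\|_{\rm BW}^2=\sum_k\binom{2l}k|a_k|^2$. With $j(z_0,z_1)=(-\bar z_1,\bar z_0)$, $\sigma_l(F)(z)=(-1)^l\overline{F(jz)}$, and $\operatorname{Fix}(\sigma_l)$ is its fixed set. The $k$-th transvectant of $F\in\mathrm{Sym}^m$, $G\in\mathrm{Sym}^n$ is $(F,G)_k=\frac{(m-k)!(n-k)!}{m!\,n!}\sum_{i=0}^k(-1)^i\binom ki\frac{\partial^kF}{\partial z_0^{k-i}\partial z_1^i}\frac{\partial^kG}{\partial z_0^i\partial z_1^{k-i}}$. *)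

theory Defs
  imports
    "HOL-Probability.Probability"
    "HOL-Computational_Algebra.Polynomial"
    "HOL-Library.Function_Algebras"
    "HOL-Algebra.Algebraic_Closure_Type"
    "HOL-Algebra.QuotRing"
    "HOL-Algebra.Module"
begin

section \<open>Polynomials and forms\<close>

text \<open>
  Since the complex numbers are infinite, a polynomial is identified with the polynomial function
  on \<open>complex ^ 'n\<close> that it defines; sums, products, \<open>0\<close> and \<open>1\<close> are the pointwise ones of
  \<^theory>\<open>HOL-Library.Function_Algebras\<close>. The coordinates \<open>x\<^sub>1, x\<^sub>2, x\<^sub>3\<close> are \<open>x $ 1, x $ 2, x $ 3\<close>,
  and \<open>z\<^sub>0, z\<^sub>1\<close> are \<open>z $ 1, z $ 2\<close>.
\<close>

definition cscale :: "complex \<Rightarrow> ('a \<Rightarrow> complex) \<Rightarrow> 'a \<Rightarrow> complex" where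
  "cscale c f = (\<lambda>x. c * f x)"

definition monomial_fun :: "('n::finite \<Rightarrow> nat) \<Rightarrow> complex ^ 'n \<Rightarrow> complex" where
  "monomial_fun \<alpha> = (\<lambda>x. \<Prod>i\<in>UNIV. (x $ i) ^ \<alpha> i)"

definition polys :: "(complex ^ 'n::finite \<Rightarrow> complex) set" where
  "polys = {\<Sum>\<alpha>\<in>S. cscale (c \<alpha>) (monomial_fun \<alpha>) | S c. finite S}"

definition real_polys :: "(complex ^ 'n::finite \<Rightarrow> complex) set" where
  "real_polys = {\<Sum>\<alpha>\<in>S. cscale (of_real (c \<alpha>)) (monomial_fun \<alpha>) | S c. finite S}"

text \<open>The degree is an integer so that the space is zero in negative degrees.\<close>

definition homog :: "int \<Rightarrow> (complex ^ 'n::finite \<Rightarrow> complex) set" where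
  "homog d = {\<Sum>\<alpha> | int (\<Sum>i\<in>UNIV. \<alpha> i) = d. cscale (c \<alpha>) (monomial_fun \<alpha>) | c. True}"

definition partial :: "'n::finite \<Rightarrow> (complex ^ 'n \<Rightarrow> complex) \<Rightarrow> complex ^ 'n \<Rightarrow> complex" where
  "partial i f = (\<lambda>x. deriv (\<lambda>t. f (\<chi> j. if j = i then t else x $ j)) (x $ i))"

definition laplacian :: "(complex ^ 3 \<Rightarrow> complex) \<Rightarrow> complex ^ 3 \<Rightarrow> complex" where
  "laplacian f = (\<Sum>i\<in>UNIV. partial i (partial i f))"

definition qf :: "complex ^ 3 \<Rightarrow> complex" where
  "qf = (\<lambda>x. (x $ 1)\<^sup>2 + (x $ 2)\<^sup>2 + (x $ 3)\<^sup>2)"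

definition harmC :: "nat \<Rightarrow> (complex ^ 3 \<Rightarrow> complex) set" where
  "harmC l = {f \<in> homog (int l). laplacian f = 0}"

definition harmR :: "nat \<Rightarrow> (complex ^ 3 \<Rightarrow> complex) set" where
  "harmR l = harmC l \<inter> real_polys"

definition poly_conj :: "(complex ^ 3 \<Rightarrow> complex) \<Rightarrow> complex ^ 3 \<Rightarrow> complex" where
  "poly_conj f = (\<lambda>x. cnj (f (\<chi> i. cnj (x $ i))))"

definition is_harm_part :: "nat \<Rightarrow> (complex ^ 3 \<Rightarrow> complex) \<Rightarrow> (complex ^ 3 \<Rightarrow> complex) \<Rightarrow> bool" where
  "is_harm_part l P h \<longleftrightarrow> h \<in> harmC l \<and> P - h \<in> (\<lambda>p. qf * p) ` homog (int l - 2)"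

definition harm_part :: "nat \<Rightarrow> (complex ^ 3 \<Rightarrow> complex) \<Rightarrow> complex ^ 3 \<Rightarrow> complex" where
  "harm_part l P = (THE h. is_harm_part l P h)"

abbreviation Sym :: "nat \<Rightarrow> (complex ^ 2 \<Rightarrow> complex) set" where
  "Sym n \<equiv> homog (int n)"

text \<open>The binary form of degree \<open>n\<close> with coefficients \<open>a k\<close> relative to binomial weights.\<close>

definition bform :: "nat \<Rightarrow> (nat \<Rightarrow> complex) \<Rightarrow> complex ^ 2 \<Rightarrow> complex" where
  "bform n a = (\<lambda>z. \<Sum>k\<le>n. of_nat (n choose k) * a k * (z $ 1) ^ (n - k) * (z $ 2) ^ k)"

definition bcoeff :: "nat \<Rightarrow> (complex ^ 2 \<Rightarrow> complex) \<Rightarrow> nat \<Rightarrow> complex" where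
  "bcoeff n F = (THE a. F = bform n a \<and> (\<forall>k>n. a k = 0))"

definition vmap :: "complex ^ 2 \<Rightarrow> complex ^ 3" where
  "vmap z = vector [(z $ 1)\<^sup>2 - (z $ 2)\<^sup>2, \<i> * ((z $ 1)\<^sup>2 + (z $ 2)\<^sup>2), 2 * z $ 1 * z $ 2]"

definition Psi :: "nat \<Rightarrow> (complex ^ 3 \<Rightarrow> complex) \<Rightarrow> complex ^ 2 \<Rightarrow> complex" where
  "Psi l = (\<lambda>f\<in>harmC l. f \<circ> vmap)"

definition clinear_on ::
  "('a \<Rightarrow> complex) set \<Rightarrow> ('b \<Rightarrow> complex) set \<Rightarrow> (('a \<Rightarrow> complex) \<Rightarrow> 'b \<Rightarrow> complex) \<Rightarrow> bool" where
  "clinear_on V W T \<longleftrightarrow> T \<in> V \<rightarrow> W \<and>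
     (\<forall>f\<in>V. \<forall>g\<in>V. T (f + g) = T f + T g) \<and> (\<forall>c. \<forall>f\<in>V. T (cscale c f) = cscale c (T f))"

definition clinear_iso ::
  "('a \<Rightarrow> complex) set \<Rightarrow> ('b \<Rightarrow> complex) set \<Rightarrow> (('a \<Rightarrow> complex) \<Rightarrow> 'b \<Rightarrow> complex) \<Rightarrow> bool" where
  "clinear_iso V W T \<longleftrightarrow> clinear_on V W T \<and> bij_betw T V W"


section \<open>Graded algebras over the complex numbers\<close>

abbreviation complex_ring :: "complex ring" where
  "complex_ring \<equiv> ring_of_type_algebra"

definition fun_alg :: "('a \<Rightarrow> complex) set \<Rightarrow> (complex, 'a \<Rightarrow> complex) module" where
  "fun_alg S = \<lparr>carrier = S, mult = (*), one = 1, zero = 0, add = (+), smult = cscale\<rparr>"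

abbreviation poly_alg :: "(complex, complex ^ 3 \<Rightarrow> complex) module" where
  "poly_alg \<equiv> fun_alg polys"

text \<open>The sum of the spaces of forms of even degree, inside the polynomials in \<open>z\<^sub>0, z\<^sub>1\<close>; that this sum
  is direct is part of \<open>graded_algebra even_alg (\<lambda>l. Sym (2 * l))\<close>, see below.\<close>

definition even_alg :: "(complex, complex ^ 2 \<Rightarrow> complex) module" where
  "even_alg = fun_alg {\<Sum>l\<in>S. G l | S G. finite S \<and> (\<forall>l\<in>S. G l \<in> Sym (2 * l))}"

text \<open>The quotient algebra: the library's quotient ring with the induced scalar multiplication.\<close>

definition quot_alg :: "('c, 'a) module \<Rightarrow> 'a set \<Rightarrow> ('c, 'a set) module" where
  "quot_alg A I =
     \<lparr>carrier = carrier (A Quot I), mult = mult (A Quot I), one = one (A Quot I),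
      zero = zero (A Quot I), add = add (A Quot I),
      smult = (\<lambda>c U. \<Union>x\<in>U. I +>\<^bsub>A\<^esub> (c \<odot>\<^bsub>A\<^esub> x))\<rparr>"

definition graded_algebra :: "(complex, 'a) module \<Rightarrow> (nat \<Rightarrow> 'a set) \<Rightarrow> bool" where
  "graded_algebra A \<A> \<longleftrightarrow>
     Module.algebra complex_ring A \<and>
     (\<forall>i. submodule (\<A> i) complex_ring A) \<and>
     \<one>\<^bsub>A\<^esub> \<in> \<A> 0 \<and>
     (\<forall>i j. \<forall>a\<in>\<A> i. \<forall>b\<in>\<A> j. a \<otimes>\<^bsub>A\<^esub> b \<in> \<A> (i + j)) \<and>
     (\<forall>a\<in>carrier A. \<exists>!c. (\<forall>i. c i \<in> \<A> i) \<and> finite {i. c i \<noteq> \<zero>\<^bsub>A\<^esub>} \<and>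
        a = finsum A c {i. c i \<noteq> \<zero>\<^bsub>A\<^esub>})"

definition graded_algebra_iso ::
  "(complex, 'a) module \<Rightarrow> (nat \<Rightarrow> 'a set) \<Rightarrow> (complex, 'b) module \<Rightarrow> (nat \<Rightarrow> 'b set) \<Rightarrow> ('a \<Rightarrow> 'b) \<Rightarrow> bool"
  where
  "graded_algebra_iso A \<A> B \<B> h \<longleftrightarrow>
     graded_algebra A \<A> \<and> graded_algebra B \<B> \<and>
     h \<in> ring_iso A B \<and>
     (\<forall>c. \<forall>x\<in>carrier A. h (c \<odot>\<^bsub>A\<^esub> x) = c \<odot>\<^bsub>B\<^esub> h x) \<and>
     (\<forall>i. h ` \<A> i = \<B> i)"


section \<open>Groups and actions\<close>

definition matrix_group :: "(complex ^ 'n ^ 'n) set \<Rightarrow> (complex ^ 'n::finite ^ 'n) monoid" where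
  "matrix_group S = \<lparr>carrier = S, mult = (**), one = mat 1\<rparr>"

definition SL2 :: "(complex ^ 2 ^ 2) set" where
  "SL2 = {g. det g = 1}"

definition SU2 :: "(complex ^ 2 ^ 2) set" where
  "SU2 = {g \<in> SL2. g ** (\<chi> i j. cnj (g $ j $ i)) = mat 1}"

definition SO3C :: "(complex ^ 3 ^ 3) set" where
  "SO3C = {A. det A = 1 \<and> (\<forall>x. qf (A *v x) = qf x)}"

text \<open>The real rotations, viewed as complex matrices.\<close>

definition SO3R :: "(complex ^ 3 ^ 3) set" where
  "SO3R = (\<lambda>A. \<chi> i j. complex_of_real (A $ i $ j)) ` {A :: real ^ 3 ^ 3. rotation_matrix A}"

definition act :: "complex ^ 'n ^ 'n \<Rightarrow> (complex ^ 'n::finite \<Rightarrow> complex) \<Rightarrow> complex ^ 'n \<Rightarrow> complex" where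
  "act A f = (\<lambda>x. f (matrix_inv A *v x))"

definition is_rho :: "complex ^ 2 ^ 2 \<Rightarrow> complex ^ 3 ^ 3 \<Rightarrow> bool" where
  "is_rho g A \<longleftrightarrow> (\<forall>z. vmap (g *v z) = A *v vmap z)"

definition rho :: "complex ^ 2 ^ 2 \<Rightarrow> complex ^ 3 ^ 3" where
  "rho g = (THE A. is_rho g A)"


section \<open>Spherical harmonics\<close>

definition cvec :: "real ^ 3 \<Rightarrow> complex ^ 3" where
  "cvec x = (\<chi> i. complex_of_real (x $ i))"

definition sph :: "real \<Rightarrow> real \<Rightarrow> real ^ 3" where
  "sph \<theta> \<phi> = vector [sin \<theta> * cos \<phi>, sin \<theta> * sin \<phi>, cos \<theta>]"

text \<open>Legendre polynomials by Rodrigues' formula.\<close>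

definition legendre :: "nat \<Rightarrow> real poly" where
  "legendre l = Polynomial.smult (1 / (2 ^ l * fact l)) ((pderiv ^^ l) ([:-1, 0, 1:] ^ l))"

definition assoc_legendre :: "nat \<Rightarrow> nat \<Rightarrow> real \<Rightarrow> real" where
  "assoc_legendre l m t = sqrt (1 - t\<^sup>2) ^ m * poly ((pderiv ^^ m) (legendre l)) t"

definition Ynorm :: "nat \<Rightarrow> nat \<Rightarrow> real" where
  "Ynorm l m = sqrt (2 * (2 * real l + 1) * fact (l - m) / fact (l + m))"

definition Yang :: "nat \<Rightarrow> int \<Rightarrow> real \<Rightarrow> real \<Rightarrow> real" where
  "Yang l m \<theta> \<phi> =
     (if m = 0 then sqrt (2 * real l + 1) * poly (legendre l) (cos \<theta>)
      else if m > 0 then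
        Ynorm l (nat m) * assoc_legendre l (nat m) (cos \<theta>) * cos (of_int m * \<phi>)
      else
        Ynorm l (nat (- m)) * assoc_legendre l (nat (- m)) (cos \<theta>) * sin (of_int (- m) * \<phi>))"

text \<open>The real harmonic polynomial whose restriction to the sphere is \<^const>\<open>Yang\<close>. The polar angle
  has to stay in \<open>[0, \<pi>]\<close>, where \<open>sqrt (1 - (cos \<theta>)\<^sup>2) = sin \<theta>\<close>.\<close>

definition is_Y :: "nat \<Rightarrow> int \<Rightarrow> (complex ^ 3 \<Rightarrow> complex) \<Rightarrow> bool" where
  "is_Y l m f \<longleftrightarrow> f \<in> harmR l \<and>
     (\<forall>\<theta>\<in>{0..pi}. \<forall>\<phi>. f (cvec (sph \<theta> \<phi>)) = complex_of_real (Yang l m \<theta> \<phi>))"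

definition Y :: "nat \<Rightarrow> int \<Rightarrow> complex ^ 3 \<Rightarrow> complex" where
  "Y l m = (THE f. is_Y l m f)"

definition calY :: "nat \<Rightarrow> int \<Rightarrow> complex ^ 3 \<Rightarrow> complex" where
  "calY l m =
     (if m = 0 then Y l 0
      else if m > 0 then cscale ((- 1) ^ nat m / sqrt 2) (Y l m + cscale \<i> (Y l (- m)))
      else cscale (1 ^ nat (- m) / sqrt 2) (Y l (- m) - cscale \<i> (Y l m)))"

definition Kconst :: "nat \<Rightarrow> int \<Rightarrow> real" where
  "Kconst l m = fact (2 * l) / fact l *
     sqrt ((2 * real l + 1) / (fact (nat (int l - m)) * fact (nat (int l + m))))"

definition nuconst :: "nat \<Rightarrow> nat \<Rightarrow> real" where
  "nuconst l p = sqrt ((2 * real l + 1) * fact (l - p) * fact (l + p) / 2) / fact l"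


section \<open>Norms, transvectants and the real structure\<close>

definition rotation_invariant_prob :: "(real ^ 3) measure \<Rightarrow> bool" where
  "rotation_invariant_prob \<omega> \<longleftrightarrow> prob_space \<omega> \<and>
     sets \<omega> = sets (restrict_space borel (sphere 0 1)) \<and>
     (\<forall>A :: real ^ 3 ^ 3. rotation_matrix A \<longrightarrow> distr \<omega> \<omega> (\<lambda>x. A *v x) = \<omega>)"

definition L2_inner ::
  "(real ^ 3) measure \<Rightarrow> (complex ^ 3 \<Rightarrow> complex) \<Rightarrow> (complex ^ 3 \<Rightarrow> complex) \<Rightarrow> complex" where
  "L2_inner \<omega> f g = (LINT x|\<omega>. f (cvec x) * cnj (g (cvec x)))"

definition L2_norm :: "(real ^ 3) measure \<Rightarrow> (complex ^ 3 \<Rightarrow> complex) \<Rightarrow> real" where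
  "L2_norm \<omega> f = sqrt (LINT x|\<omega>. (cmod (f (cvec x)))\<^sup>2)"

definition BW_inner :: "nat \<Rightarrow> (complex ^ 2 \<Rightarrow> complex) \<Rightarrow> (complex ^ 2 \<Rightarrow> complex) \<Rightarrow> complex" where
  "BW_inner n F G = (\<Sum>k\<le>n. of_nat (n choose k) * bcoeff n F k * cnj (bcoeff n G k))"

definition BW_norm :: "nat \<Rightarrow> (complex ^ 2 \<Rightarrow> complex) \<Rightarrow> real" where
  "BW_norm n F = sqrt (\<Sum>k\<le>n. real (n choose k) * (cmod (bcoeff n F k))\<^sup>2)"

definition unitary_on ::
  "('a \<Rightarrow> complex) set \<Rightarrow> (('a \<Rightarrow> complex) \<Rightarrow> ('a \<Rightarrow> complex) \<Rightarrow> complex) \<Rightarrow>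
   ('b \<Rightarrow> complex) set \<Rightarrow> (('b \<Rightarrow> complex) \<Rightarrow> ('b \<Rightarrow> complex) \<Rightarrow> complex) \<Rightarrow>
   (('a \<Rightarrow> complex) \<Rightarrow> 'b \<Rightarrow> complex) \<Rightarrow> bool" where
  "unitary_on V ip W ip' T \<longleftrightarrow> clinear_iso V W T \<and> (\<forall>f\<in>V. \<forall>g\<in>V. ip' (T f) (T g) = ip f g)"

text \<open>\<open>transvectant k m n F G\<close> is the \<open>k\<close>-th transvectant of \<open>F \<in> Sym m\<close> and \<open>G \<in> Sym n\<close>, for \<open>k \<le> m, n\<close>.\<close>

definition transvectant ::
  "nat \<Rightarrow> nat \<Rightarrow> nat \<Rightarrow> (complex ^ 2 \<Rightarrow> complex) \<Rightarrow> (complex ^ 2 \<Rightarrow> complex) \<Rightarrow> complex ^ 2 \<Rightarrow> complex" where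
  "transvectant k m n F G = (\<lambda>z. fact (m - k) * fact (n - k) / (fact m * fact n) *
     (\<Sum>i\<le>k. (- 1) ^ i * of_nat (k choose i) *
        (partial 1 ^^ (k - i)) ((partial 2 ^^ i) F) z *
        (partial 1 ^^ i) ((partial 2 ^^ (k - i)) G) z))"

definition jmap :: "complex ^ 2 \<Rightarrow> complex ^ 2" where
  "jmap z = vector [- cnj (z $ 2), cnj (z $ 1)]"

definition sigma_form :: "nat \<Rightarrow> (complex ^ 2 \<Rightarrow> complex) \<Rightarrow> complex ^ 2 \<Rightarrow> complex" where
  "sigma_form l F = (\<lambda>z. (- 1) ^ l * cnj (F (jmap z)))"

definition Fix_sigma :: "nat \<Rightarrow> (complex ^ 2 \<Rightarrow> complex) set" where
  "Fix_sigma l = {F \<in> Sym (2 * l). sigma_form l F = F}"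

end

theory Submission
  imports Defs
begin

text \<open>
  The coefficients in \<open>t\<close> of \<open>(v(1, t) \<bullet> x) ^ l\<close> are harmonic because \<open>v(1, t)\<close> is a null vector, and
  \<open>v(w) \<bullet> v(z)\<close> is a multiple of the square of the symplectic form of \<open>w\<close> and \<open>z\<close>, so composition with \<open>v\<close>
  turns them into multiples of all the monomials of degree \<open>2 l\<close>. This gives surjectivity; injectivity holds
  because a polynomial vanishing on the null cone is a multiple of \<open>q\<close>, and a harmonic multiple of
  \<open>q\<close> is zero. On the sphere these coefficients are, up to constants, the functions
  \<open>P\<^sub>l\<^sup>m(cos \<theta>) e\<^sup>i\<^sup>m\<^sup>\<phi>\<close>, by Rodrigues' formula, which yields the explicit coefficients.

  For the norm, invariance under rotations about the third axis makes the coefficients orthogonal, and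
  invariance about the second axis makes the norm of \<open>(v(1, t) \<bullet> x) ^ l\<close> proportional to
  \<open>(1 + t\<^sup>2) ^ l\<close>, which fixes the ratios of their norms. The remaining constant comes from a weighted sum of
  squares of the coefficients, which is constant on the sphere.
\<close>

no_notation fps_nth (infixl "$" 75)

section \<open>Homogeneous polynomials\<close>

text \<open>Polynomials are functions here, so a coefficient cannot simply be looked up. Whenever
  coefficients must be compared, the identity is turned into one between polynomials in a single
  variable t, by evaluating a form at (1, t), a graded sum at t x, or a generating function in t.
  The generating function (v(1, t) . x)^l also carries the harmonic analysis: what is known about
  powers of null linear forms passes to its coefficients, in particular that they stay harmonic
  under complex rotations. The index k of a coefficient encodes its weight under rotations about the
  third axis and also the exponents of the corresponding monomial in two variables; this is why one
  family serves the isomorphism, the explicit basis and the norm. The measure on the sphere is known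
  only through its invariance and total mass, so the Gram matrix of this family has to come from
  symmetry and not from an integral in angles.\<close>

definition coord :: "'n::finite \<Rightarrow> complex ^ 'n \<Rightarrow> complex" where
  "coord i = (\<lambda>x. x $ i)"

definition const_fun :: "complex \<Rightarrow> 'a \<Rightarrow> complex" where
  "const_fun c = (\<lambda>x. c)"

lemma sum_fun_apply: "(\<Sum>a\<in>A. f a) x = (\<Sum>a\<in>A. f a x)"
  by (induction A rule: infinite_finite_induct) auto

lemma cscale_apply: "cscale c f x = c * f x"
  by (simp add: cscale_def)

lemma const_fun_apply: "const_fun c x = c"
  by (simp add: const_fun_def)

lemma coord_apply: "coord i x = x $ i"
  by (simp add: coord_def)

text \<open>Ring laws are applied to functions as wholes; evaluation at a point happens only on
  request, through \<open>fun_simps\<close>.\<close>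

declare plus_fun_apply [simp del] times_fun_apply [simp del] zero_fun_apply [simp del]
  one_fun_apply [simp del] minus_apply [simp del] uminus_apply [simp del]

lemmas fun_simps = plus_fun_apply times_fun_apply zero_fun_apply one_fun_apply minus_apply
  uminus_apply cscale_apply const_fun_apply coord_apply sum_fun_apply

lemma cscale_add: "cscale c (f + g) = cscale c f + cscale c g"
  by (auto simp: fun_eq_iff fun_simps algebra_simps)

lemma cscale_add_left: "cscale (a + b) f = cscale a f + cscale b f"
  by (auto simp: fun_eq_iff fun_simps algebra_simps)

lemma cscale_cscale: "cscale a (cscale b f) = cscale (a * b) f"
  by (auto simp: fun_eq_iff fun_simps)

lemma cscale_one [simp]: "cscale 1 f = f"
  by (auto simp: fun_eq_iff fun_simps)

lemma cscale_zero [simp]: "cscale c 0 = 0" "cscale 0 f = 0"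
  by (auto simp: fun_eq_iff fun_simps)

lemma cscale_sum: "cscale c (\<Sum>a\<in>A. f a) = (\<Sum>a\<in>A. cscale c (f a))"
  by (auto simp: fun_eq_iff fun_simps sum_distrib_left)

lemma cscale_mult_left: "cscale c f * g = cscale c (f * g)"
  by (auto simp: fun_eq_iff fun_simps)

lemma cscale_mult_right: "f * cscale c g = cscale c (f * g)"
  by (auto simp: fun_eq_iff fun_simps)

lemma diff_eq_cscale: "f - g = f + cscale (-1) g"
  by (auto simp: fun_eq_iff fun_simps)

lemma const_fun_mult: "const_fun c * f = cscale c f"
  by (auto simp: fun_eq_iff fun_simps)

text \<open>Each exponent is bounded by the total degree. Finiteness matters because a sum over an
  infinite set is 0 by convention, which would make \<open>homog\<close> trivial.\<close>

lemma finite_exponents: "finite {\<alpha> :: 'n::finite \<Rightarrow> nat. int (\<Sum>i\<in>UNIV. \<alpha> i) = d}"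
proof (rule finite_subset)
  show "{\<alpha> :: 'n \<Rightarrow> nat. int (\<Sum>i\<in>UNIV. \<alpha> i) = d} \<subseteq>
      {\<alpha>. \<forall>i. (i \<in> UNIV \<longrightarrow> \<alpha> i \<in> {..nat d}) \<and> (i \<notin> UNIV \<longrightarrow> \<alpha> i = 0)}"
  proof
    fix \<alpha> :: "'n \<Rightarrow> nat" assume "\<alpha> \<in> {\<alpha>. int (\<Sum>i\<in>UNIV. \<alpha> i) = d}"
    moreover have "\<alpha> i \<le> (\<Sum>i\<in>UNIV. \<alpha> i)" for i
      by (rule member_le_sum) auto
    ultimately show "\<alpha> \<in> {\<alpha>. \<forall>i. (i \<in> UNIV \<longrightarrow> \<alpha> i \<in> {..nat d}) \<and> (i \<notin> UNIV \<longrightarrow> \<alpha> i = 0)}"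
      by (auto simp del: of_nat_sum)
  qed
  show "finite {\<alpha> :: 'n \<Rightarrow> nat. \<forall>i. (i \<in> UNIV \<longrightarrow> \<alpha> i \<in> {..nat d}) \<and> (i \<notin> UNIV \<longrightarrow> \<alpha> i = 0)}"
    by (rule finite_set_of_finite_funs) auto
qed

lemma monomial_fun_add: "monomial_fun \<alpha> * monomial_fun \<beta> = monomial_fun (\<lambda>i. \<alpha> i + \<beta> i)"
  by (auto simp: fun_eq_iff fun_simps monomial_fun_def power_add prod.distrib)

lemma monomial_fun_zero: "monomial_fun (\<lambda>i. 0) = const_fun 1"
  by (auto simp: fun_eq_iff fun_simps monomial_fun_def)

lemma homogI: "P = (\<Sum>\<alpha> | int (\<Sum>i\<in>UNIV. \<alpha> i) = d. cscale (c \<alpha>) (monomial_fun \<alpha>)) \<Longrightarrow> P \<in> homog d"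
  unfolding homog_def by blast

lemma homog_0 [simp]: "0 \<in> homog d"
  by (rule homogI[where c = "\<lambda>_. 0"]) simp

lemma homog_add: "f \<in> homog d \<Longrightarrow> g \<in> homog d \<Longrightarrow> f + g \<in> homog d"
proof -
  assume "f \<in> homog d" "g \<in> homog d"
  then obtain c e where
    "f = (\<Sum>\<alpha> | int (\<Sum>i\<in>UNIV. \<alpha> i) = d. cscale (c \<alpha>) (monomial_fun \<alpha>))"
    "g = (\<Sum>\<alpha> | int (\<Sum>i\<in>UNIV. \<alpha> i) = d. cscale (e \<alpha>) (monomial_fun \<alpha>))"
    unfolding homog_def by blast
  then show ?thesis
    by (intro homogI[where c = "\<lambda>\<alpha>. c \<alpha> + e \<alpha>"]) (simp add: cscale_add_left sum.distrib)
qed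

lemma homog_cscale: "f \<in> homog d \<Longrightarrow> cscale a f \<in> homog d"
proof -
  assume "f \<in> homog d"
  then obtain c where
    "f = (\<Sum>\<alpha> | int (\<Sum>i\<in>UNIV. \<alpha> i) = d. cscale (c \<alpha>) (monomial_fun \<alpha>))"
    unfolding homog_def by blast
  then show ?thesis
    by (intro homogI[where c = "\<lambda>\<alpha>. a * c \<alpha>"]) (simp add: cscale_sum cscale_cscale)
qed

lemma homog_diff: "f \<in> homog d \<Longrightarrow> g \<in> homog d \<Longrightarrow> f - g \<in> homog d"
  by (simp add: diff_eq_cscale homog_add homog_cscale)

lemma homog_sum: "(\<And>a. a \<in> A \<Longrightarrow> f a \<in> homog d) \<Longrightarrow> (\<Sum>a\<in>A. f a) \<in> homog d"
  by (induction A rule: infinite_finite_induct) (auto intro: homog_add)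

lemma monomial_homog: "int (\<Sum>i\<in>UNIV. \<alpha> i) = d \<Longrightarrow> monomial_fun \<alpha> \<in> homog d"
proof (rule homogI[where c = "\<lambda>\<beta>. if \<beta> = \<alpha> then 1 else 0"])
  assume d: "int (\<Sum>i\<in>UNIV. \<alpha> i) = d"
  have "(\<Sum>\<beta> | int (\<Sum>i\<in>UNIV. \<beta> i) = d. cscale (if \<beta> = \<alpha> then 1 else 0) (monomial_fun \<beta>)) =
      (\<Sum>\<beta> | int (\<Sum>i\<in>UNIV. \<beta> i) = d. if \<beta> = \<alpha> then monomial_fun \<beta> else 0)"
    by (rule sum.cong) auto
  also have "\<dots> = monomial_fun \<alpha>"
    by (subst sum.delta) (use d finite_exponents[of d] in auto)
  finally show "monomial_fun \<alpha> =
      (\<Sum>\<beta> | int (\<Sum>i\<in>UNIV. \<beta> i) = d. cscale (if \<beta> = \<alpha> then 1 else 0) (monomial_fun \<beta>))" ..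
qed

lemma sum_induct:
  assumes "Q 0" "\<And>f g. Q f \<Longrightarrow> Q g \<Longrightarrow> Q (f + g)" "\<And>a. a \<in> A \<Longrightarrow> Q (f a)"
  shows "Q (\<Sum>a\<in>A. f a)"
  using assms(3) by (induction A rule: infinite_finite_induct) (auto intro: assms)

lemma homog_induct [consumes 1, case_names zero add monomial]:
  assumes "f \<in> homog d" "Q 0" "\<And>f g. Q f \<Longrightarrow> Q g \<Longrightarrow> Q (f + g)"
    "\<And>c \<alpha>. int (\<Sum>i\<in>UNIV. \<alpha> i) = d \<Longrightarrow> Q (cscale c (monomial_fun \<alpha>))"
  shows "Q f"
proof -
  obtain c where "f = (\<Sum>\<alpha> | int (\<Sum>i\<in>UNIV. \<alpha> i) = d. cscale (c \<alpha>) (monomial_fun \<alpha>))"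
    using assms(1) unfolding homog_def by blast
  then show ?thesis
    using sum_induct[where Q = Q and f = "\<lambda>\<alpha>. cscale (c \<alpha>) (monomial_fun \<alpha>)"
        and A = "{\<alpha>. int (\<Sum>i\<in>UNIV. \<alpha> i) = d}"] assms(2-) by simp
qed

lemma homog_mult:
  assumes "f \<in> homog d" "g \<in> homog e"
  shows "f * g \<in> homog (d + e)"
  using assms(1)
proof (induction rule: homog_induct)
  case (monomial c \<alpha>)
  note \<alpha> = this
  show ?case
    using assms(2)
  proof (induction rule: homog_induct)
    case (monomial b \<beta>)
    have "cscale c (cscale b (monomial_fun (\<lambda>i. \<alpha> i + \<beta> i))) \<in> homog (d + e)"
      by (intro homog_cscale monomial_homog) (use \<alpha> monomial in \<open>simp add: sum.distrib\<close>)
    then show "cscale c (monomial_fun \<alpha>) * cscale b (monomial_fun \<beta>) \<in> homog (d + e)"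
      by (simp only: cscale_mult_left cscale_mult_right monomial_fun_add cscale_cscale mult.commute)
  next
    case (add g h)
    then show "cscale c (monomial_fun \<alpha>) * (g + h) \<in> homog (d + e)"
      by (simp add: distrib_left homog_add)
  next
    case zero
    show "cscale c (monomial_fun \<alpha>) * 0 \<in> homog (d + e)"
      by simp
  qed
next
  case (add f h)
  then show "(f + h) * g \<in> homog (d + e)"
    by (simp add: distrib_right homog_add)
next
  case zero
  show "0 * g \<in> homog (d + e)"
    by simp
qed

text \<open>Lets every argument that lowers degrees end by itself: once the degree is negative, the
  polynomial is gone.\<close>

lemma homog_neg: "f \<in> homog d \<Longrightarrow> d < 0 \<Longrightarrow> f = 0"
proof (induction rule: homog_induct)
  case (monomial c \<alpha>)
  have "0 \<le> int (\<Sum>i\<in>UNIV. \<alpha> i)"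
    by (rule of_nat_0_le_iff)
  then show ?case
    using monomial by linarith
qed auto

lemma coord_eq_monomial: "coord i = monomial_fun (\<lambda>j. if j = i then 1 else 0)"
proof
  fix x :: "complex ^ 'a"
  have "(\<Prod>j\<in>UNIV. (x $ j) ^ (if j = i then 1 else 0)) = (\<Prod>j\<in>UNIV. if j = i then x $ j else 1)"
    by (rule prod.cong) auto
  then show "coord i x = monomial_fun (\<lambda>j. if j = i then 1 else 0) x"
    by (simp add: monomial_fun_def coord_apply)
qed

lemma coord_homog: "coord i \<in> homog 1"
  unfolding coord_eq_monomial by (rule monomial_homog) simp

lemma const_homog: "const_fun c \<in> homog 0"
  using homog_cscale[OF monomial_homog[of "\<lambda>_. 0" 0], of c]
  by (simp add: monomial_fun_zero flip: const_fun_mult) (simp add: const_fun_def times_fun_def)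

lemma one_homog: "1 \<in> homog 0"
  using const_homog[of 1] by (simp add: const_fun_def one_fun_def)

lemma coord_mult_homog: "f \<in> homog (int d) \<Longrightarrow> coord i * f \<in> homog (int (Suc d))"
  using homog_mult[OF coord_homog[of i], of f "int d"] by (simp add: add.commute)

lemma homog_power: "f \<in> homog d \<Longrightarrow> f ^ n \<in> homog (int n * d)"
proof (induction n)
  case (Suc n)
  show "f ^ Suc n \<in> homog (int (Suc n) * d)"
    using homog_mult[OF Suc.prems Suc.IH[OF Suc.prems]] by (simp add: algebra_simps)
next
  case 0
  show "f ^ 0 \<in> homog (int 0 * d)"
    by (simp add: one_homog)
qed

text \<open>Monomials are built by multiplying with one coordinate at a time, which reduces later
  facts to the case of a single linear factor.\<close>

lemma monomial_induct [case_names one step]: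
  assumes "Q 0 (const_fun 1)"
    "\<And>d i f. f \<in> homog (int d) \<Longrightarrow> Q d f \<Longrightarrow> Q (Suc d) (coord i * f)"
  shows "Q (\<Sum>i\<in>UNIV. \<alpha> i) (monomial_fun \<alpha>)"
proof (induction "\<Sum>i\<in>UNIV. \<alpha> i" arbitrary: \<alpha>)
  case 0
  then have "\<alpha> = (\<lambda>i. 0)"
    by (auto simp: fun_eq_iff fun_simps)
  then show "Q (\<Sum>i\<in>UNIV. \<alpha> i) (monomial_fun \<alpha>)"
    by (simp add: monomial_fun_zero assms(1))
next
  case (Suc n)
  then have "\<exists>i. \<alpha> i \<noteq> 0"
    by (metis Zero_not_Suc sum.neutral)
  then obtain i where i: "\<alpha> i > 0"
    by auto
  define \<beta> where "\<beta> = (\<lambda>j. if j = i then \<alpha> j - 1 else \<alpha> j)"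
  have \<alpha>: "\<alpha> = (\<lambda>j. (if j = i then 1 else 0) + \<beta> j)"
    using i by (auto simp: \<beta>_def)
  have s: "(\<Sum>i\<in>UNIV. \<alpha> i) = Suc (\<Sum>i\<in>UNIV. \<beta> i)"
    by (subst \<alpha>) (simp add: sum.distrib)
  then have "Q (\<Sum>i\<in>UNIV. \<beta> i) (monomial_fun \<beta>)"
    using Suc.hyps by simp
  then have "Q (Suc (\<Sum>i\<in>UNIV. \<beta> i)) (coord i * monomial_fun \<beta>)"
    by (intro assms(2) monomial_homog) auto
  moreover have "monomial_fun \<alpha> = coord i * monomial_fun \<beta>"
    unfolding coord_eq_monomial monomial_fun_add by (subst \<alpha>) simp
  ultimately show "Q (\<Sum>i\<in>UNIV. \<alpha> i) (monomial_fun \<alpha>)"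
    using s by simp
qed

text \<open>The predicate depends on the degree because claims such as Euler's identity mention the
  degree, which grows with every factor.\<close>

lemma homog_gen_induct [consumes 1, case_names one add cscale step]:
  assumes "f \<in> homog (int d)"
    "Q 0 (const_fun 1)"
    "\<And>d f g. f \<in> homog (int d) \<Longrightarrow> g \<in> homog (int d) \<Longrightarrow> Q d f \<Longrightarrow> Q d g \<Longrightarrow> Q d (f + g)"
    "\<And>d c f. f \<in> homog (int d) \<Longrightarrow> Q d f \<Longrightarrow> Q d (cscale c f)"
    "\<And>d i f. f \<in> homog (int d) \<Longrightarrow> Q d f \<Longrightarrow> Q (Suc d) (coord i * f)"
  shows "Q d f"
proof -
  have mono: "Q (\<Sum>i\<in>UNIV. \<alpha> i) (monomial_fun \<alpha>)" for \<alpha>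
    by (rule monomial_induct) (auto intro: assms)
  \<comment> \<open>No premise covers 0 directly: it arises as 0 times a monomial, so one monomial
    must be exhibited in each degree. The whole degree is put on an arbitrarily chosen
    index.\<close>
  obtain \<alpha>0 :: "'a \<Rightarrow> nat" where a0: "(\<Sum>i\<in>UNIV. \<alpha>0 i) = d"
  proof
    show "(\<Sum>i\<in>UNIV. if i = (SOME i :: 'a. True) then d else 0) = d"
      by simp
  qed
  have "f \<in> homog (int d) \<and> Q d f"
    using assms(1)
  proof (induction rule: homog_induct)
    case zero
    show "0 \<in> homog (int d) \<and> Q d 0"
      using assms(4)[OF monomial_homog mono[of \<alpha>0], of 0] a0 by simp
  next
    case (monomial c \<alpha>)
    then have "(\<Sum>i\<in>UNIV. \<alpha> i) = d"
      by linarith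
    then show "cscale c (monomial_fun \<alpha>) \<in> homog (int d) \<and> Q d (cscale c (monomial_fun \<alpha>))"
      using mono[of \<alpha>] assms(4)[OF monomial_homog, of \<alpha> d c] by (auto intro!: homog_cscale monomial_homog)
  qed (auto intro: homog_add assms(3))
  then show ?thesis ..
qed

section \<open>The algebra of all polynomials\<close>

lemma polysI: "finite S \<Longrightarrow> f = (\<Sum>\<alpha>\<in>S. cscale (c \<alpha>) (monomial_fun \<alpha>)) \<Longrightarrow> f \<in> polys"
  unfolding polys_def by blast

lemma polys_add:
  assumes "f \<in> polys" "g \<in> polys"
  shows "f + g \<in> polys"
proof -
  obtain S c T e where f: "f = (\<Sum>\<alpha>\<in>S. cscale (c \<alpha>) (monomial_fun \<alpha>))" "finite S"
    and g: "g = (\<Sum>\<alpha>\<in>T. cscale (e \<alpha>) (monomial_fun \<alpha>))" "finite T"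
    using assms unfolding polys_def by blast
  \<comment> \<open>The two supports may differ; coefficients are padded with 0 on the union before
    they are added.\<close>
  have "f = (\<Sum>\<alpha>\<in>S \<union> T. cscale (if \<alpha> \<in> S then c \<alpha> else 0) (monomial_fun \<alpha>))"
    unfolding f by (rule sum.mono_neutral_cong_left) (use f g in auto)
  moreover have "g = (\<Sum>\<alpha>\<in>S \<union> T. cscale (if \<alpha> \<in> T then e \<alpha> else 0) (monomial_fun \<alpha>))"
    unfolding g by (rule sum.mono_neutral_cong_left) (use f g in auto)
  ultimately have "f + g = (\<Sum>\<alpha>\<in>S \<union> T. cscale ((if \<alpha> \<in> S then c \<alpha> else 0) +
      (if \<alpha> \<in> T then e \<alpha> else 0)) (monomial_fun \<alpha>))"
    unfolding cscale_add_left sum.distrib by simp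
  then show ?thesis
    using f g by (intro polysI[of "S \<union> T"]) auto
qed

lemma homog_subset_polys: "homog d \<subseteq> polys"
  unfolding homog_def by (auto intro: polysI finite_exponents)

lemma polys_0 [simp]: "0 \<in> polys"
  using homog_0 homog_subset_polys by blast

lemma polys_cscale:
  assumes "f \<in> polys"
  shows "cscale a f \<in> polys"
proof -
  obtain S c where f: "f = (\<Sum>\<alpha>\<in>S. cscale (c \<alpha>) (monomial_fun \<alpha>))" "finite S"
    using assms unfolding polys_def by blast
  show ?thesis
    by (rule polysI[of S _ "\<lambda>\<alpha>. a * c \<alpha>"]) (simp_all add: f cscale_sum cscale_cscale)
qed

lemma polys_diff: "f \<in> polys \<Longrightarrow> g \<in> polys \<Longrightarrow> f - g \<in> polys"
  by (simp add: diff_eq_cscale polys_add polys_cscale)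

lemma polys_sum: "(\<And>a. a \<in> A \<Longrightarrow> f a \<in> polys) \<Longrightarrow> (\<Sum>a\<in>A. f a) \<in> polys"
  by (induction A rule: infinite_finite_induct) (auto intro: polys_add)

lemma polys_homog_induct [consumes 1, case_names add homog]:
  assumes "f \<in> polys"
    "\<And>f g. f \<in> polys \<Longrightarrow> g \<in> polys \<Longrightarrow> Q f \<Longrightarrow> Q g \<Longrightarrow> Q (f + g)"
    "\<And>d f. f \<in> homog (int d) \<Longrightarrow> Q f"
  shows "Q f"
proof -
  obtain S c where f: "f = (\<Sum>\<alpha>\<in>S. cscale (c \<alpha>) (monomial_fun \<alpha>))" "finite S"
    using assms unfolding polys_def by blast
  have m: "cscale (c \<alpha>) (monomial_fun \<alpha>) \<in> polys \<and> Q (cscale (c \<alpha>) (monomial_fun \<alpha>))" for \<alpha>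
    using assms(3)[OF homog_cscale[OF monomial_homog[OF refl]]]
      homog_cscale[OF monomial_homog[OF refl]] homog_subset_polys by blast
  have z: "0 \<in> polys \<and> Q 0"
    using assms(3)[of 0 0] by simp
  have "f \<in> polys \<and> Q f"
    unfolding f
    by (rule sum_induct[where Q = "\<lambda>f. f \<in> polys \<and> Q f"]) (use z m in \<open>auto intro: polys_add assms(2)\<close>)
  then show ?thesis ..
qed

lemma polys_mult:
  assumes "f \<in> polys" "g \<in> polys"
  shows "f * g \<in> polys"
  using assms(1)
proof (induction rule: polys_homog_induct)
  case (homog d f)
  show "f * g \<in> polys"
    using assms(2)
  proof (induction rule: polys_homog_induct)
    case (homog e g)
    then show "f * g \<in> polys"
      using homog_mult[OF \<open>f \<in> homog (int d)\<close> homog] homog_subset_polys by blast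
  next
    case (add g h)
    then show "f * (g + h) \<in> polys"
      by (simp add: distrib_left polys_add)
  qed
next
  case (add f h)
  then show "(f + h) * g \<in> polys"
    by (simp add: distrib_right polys_add)
qed

lemma polys_gen_induct [consumes 1, case_names one add cscale step]:
  assumes "f \<in> polys"
    "Q (const_fun 1)"
    "\<And>f g. f \<in> polys \<Longrightarrow> g \<in> polys \<Longrightarrow> Q f \<Longrightarrow> Q g \<Longrightarrow> Q (f + g)"
    "\<And>c f. f \<in> polys \<Longrightarrow> Q f \<Longrightarrow> Q (cscale c f)"
    "\<And>i f. f \<in> polys \<Longrightarrow> Q f \<Longrightarrow> Q (coord i * f)"
  shows "Q f"
  using assms(1)
proof (induction rule: polys_homog_induct)
  case (homog d f)
  have sub: "g \<in> polys" if "g \<in> homog e" for g :: "complex ^ 'a \<Rightarrow> complex" and e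
    using that homog_subset_polys by blast
  from homog show ?case
  proof (induction rule: homog_gen_induct)
    case one
    show ?case by (rule assms(2))
  next
    case (add d f g)
    then show ?case by (intro assms(3)) (auto intro: sub)
  next
    case (cscale d c f)
    then show ?case by (intro assms(4)) (auto intro: sub)
  next
    case (step d i f)
    then show ?case by (intro assms(5)) (auto intro: sub)
  qed
next
  case (add f g)
  then show ?case by (rule assms(3))
qed

lemma coord_polys: "coord i \<in> polys" and const_polys: "const_fun c \<in> polys"
  and one_polys: "1 \<in> polys"
  using coord_homog const_homog one_homog homog_subset_polys by blast+

lemma polys_power: "f \<in> polys \<Longrightarrow> f ^ n \<in> polys"
proof (induction n)
  case (Suc n)
  then show "f ^ Suc n \<in> polys"
    by (simp add: polys_mult)
next
  case 0
  show "f ^ 0 \<in> polys"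
    by (simp add: one_polys)
qed

lemma homog_scale:
  assumes "f \<in> homog (int d)"
  shows "f (c *s x) = c ^ d * f x"
  using assms by (induction rule: homog_gen_induct) (simp_all add: algebra_simps fun_simps)

section \<open>Partial derivatives and Euler's identity\<close>

definition upd :: "complex ^ 'n::finite \<Rightarrow> 'n \<Rightarrow> complex \<Rightarrow> complex ^ 'n" where
  "upd x i t = (\<chi> j. if j = i then t else x $ j)"

lemma upd_nth: "upd x i t $ j = (if j = i then t else x $ j)"
  by (simp add: upd_def)

lemma upd_same [simp]: "upd x i (x $ i) = x"
  by (simp add: upd_def vec_eq_iff)

lemma partial_upd: "partial i f x = deriv (\<lambda>t. f (upd x i t)) (x $ i)"
  by (simp add: partial_def upd_def)

text \<open>\<open>deriv\<close> is informative only where a derivative exists, so the sum, scalar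
  and product rules for \<open>partial\<close> are stated for polynomials and rest on this.\<close>

lemma polys_field_differentiable:
  assumes "f \<in> polys"
  shows "(\<lambda>t. f (upd x i t)) field_differentiable at t"
  using assms
proof (induction arbitrary: rule: polys_gen_induct)
  case (add f g)
  then show ?case
    using field_differentiable_add[OF add(3,4)] by (simp add: fun_simps)
next
  case (cscale c f)
  then show ?case
    using field_differentiable_mult[OF field_differentiable_const cscale(2), of c] by (simp add: fun_simps)
next
  case (step k f)
  have "(\<lambda>t. upd x i t $ k) field_differentiable at t"
    by (cases "k = i") (simp_all add: upd_nth)
  from field_differentiable_mult[OF this step(2)] show ?case
    by (simp add: fun_simps)
qed (simp add: fun_simps)

lemma partial_has_derivative:
  assumes "f \<in> polys"
  shows "((\<lambda>t. f (upd x i t)) has_field_derivative partial i f x) (at (x $ i))"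
  using polys_field_differentiable[OF assms] field_differentiable_derivI partial_upd by metis

lemma partial_unique:
  "((\<lambda>t. f (upd x i t)) has_field_derivative D) (at (x $ i)) \<Longrightarrow> partial i f x = D"
  by (simp add: partial_upd DERIV_imp_deriv)

lemma partial_add: "f \<in> polys \<Longrightarrow> g \<in> polys \<Longrightarrow> partial i (f + g) = partial i f + partial i g"
proof
  fix x assume "f \<in> polys" "g \<in> polys"
  from DERIV_add[OF this[THEN partial_has_derivative[of _ x i]]]
  show "partial i (f + g) x = (partial i f + partial i g) x"
    by (intro partial_unique) (simp add: fun_simps)
qed

lemma partial_cscale: "f \<in> polys \<Longrightarrow> partial i (cscale c f) = cscale c (partial i f)"
proof
  fix x assume "f \<in> polys"
  from DERIV_cmult[OF partial_has_derivative[of _ x i, OF this], of c]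
  show "partial i (cscale c f) x = cscale c (partial i f) x"
    by (intro partial_unique) (simp add: fun_simps)
qed

lemma partial_mult:
  "f \<in> polys \<Longrightarrow> g \<in> polys \<Longrightarrow> partial i (f * g) = partial i f * g + f * partial i g"
proof
  fix x assume "f \<in> polys" "g \<in> polys"
  from DERIV_mult[OF this[THEN partial_has_derivative[of _ x i]]]
  show "partial i (f * g) x = (partial i f * g + f * partial i g) x"
    by (intro partial_unique) (simp add: fun_simps algebra_simps)
qed

lemma partial_const: "partial i (const_fun c) = 0"
  by (auto simp: fun_eq_iff fun_simps partial_upd)

lemma partial_0 [simp]: "partial i 0 = 0"
  by (auto simp: fun_eq_iff fun_simps partial_upd)

lemma partial_coord: "partial i (coord k) = const_fun (if k = i then 1 else 0)"
  by (auto simp: fun_eq_iff fun_simps partial_upd upd_nth)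

text \<open>The case d = 0 is included: degree -1 contains only 0, which is the derivative of a
  constant.\<close>

lemma partial_homog_nat:
  assumes "f \<in> homog (int d)"
  shows "partial i f \<in> homog (int d - 1)"
  using assms
proof (induction rule: homog_gen_induct)
  case (step d k f)
  have "f \<in> polys"
    using step homog_subset_polys by blast
  then have "partial i (coord k * f) = const_fun (if k = i then 1 else 0) * f + coord k * partial i f"
    by (simp add: partial_mult coord_polys partial_coord)
  moreover have "coord k * partial i f \<in> homog (int d)"
    using homog_mult[OF coord_homog step(2), of k] by simp
  moreover have "const_fun (if k = i then 1 else 0) * f \<in> homog (int d)"
    using step(1) by (simp add: const_fun_mult homog_cscale)
  ultimately show ?case
    by (auto intro: homog_add)
next
  case (add d f g)
  then show ?case
    using homog_subset_polys[of "int d"] by (subst partial_add) (auto intro: homog_add)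
next
  case (cscale d c f)
  then show ?case
    using homog_subset_polys[of "int d"] by (subst partial_cscale) (auto intro: homog_cscale)
qed (simp add: partial_const)

lemma partial_homog: "f \<in> homog d \<Longrightarrow> partial i f \<in> homog (d - 1)"
  using partial_homog_nat[of f "nat d"] homog_neg[of f d] by (cases "d < 0") auto

lemma partial_polys: "f \<in> polys \<Longrightarrow> partial i f \<in> polys"
proof (induction rule: polys_homog_induct)
  case (homog d f)
  then show ?case
    using partial_homog homog_subset_polys by blast
qed (auto simp: partial_add intro: polys_add)

lemma partial_sum:
  "(\<And>a. a \<in> A \<Longrightarrow> f a \<in> polys) \<Longrightarrow> partial i (\<Sum>a\<in>A. f a) = (\<Sum>a\<in>A. partial i (f a))"
  by (induction A rule: infinite_finite_induct) (auto simp: partial_add polys_sum)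

lemma euler_homog_nat:
  assumes "f \<in> homog (int d)"
  shows "(\<Sum>i\<in>UNIV. coord i * partial i f) = cscale (of_nat d) f"
  using assms
proof (induction rule: homog_gen_induct)
  case one
  then show ?case
    by (simp add: partial_const)
next
  case (add d f g)
  then have "f \<in> polys" "g \<in> polys"
    using homog_subset_polys by blast+
  then show ?case
    using add by (simp add: partial_add distrib_left sum.distrib cscale_add)
next
  case (cscale d c f)
  then have "f \<in> polys"
    using homog_subset_polys by blast+
  then show ?case
    using cscale by (simp add: partial_cscale cscale_mult_right cscale_cscale mult.commute flip: cscale_sum)
next
  case (step d k f)
  then have "f \<in> polys"
    using homog_subset_polys by blast+
  then have "(\<Sum>i\<in>UNIV. coord i * partial i (coord k * f)) =
      (\<Sum>i\<in>UNIV. (if k = i then coord k * f else 0) + coord k * (coord i * partial i f))"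
    by (intro sum.cong) (auto simp: partial_mult coord_polys partial_coord fun_eq_iff fun_simps algebra_simps)
  also have "\<dots> = coord k * f + coord k * (\<Sum>i\<in>UNIV. coord i * partial i f)"
    by (simp add: sum.distrib sum_distrib_left)
  also have "\<dots> = cscale (of_nat (Suc d)) (coord k * f)"
    unfolding step by (auto simp: fun_eq_iff fun_simps algebra_simps)
  finally show ?case .
qed

text \<open>Euler's identity in all integer degrees; it evaluates the mixed term in the Laplacian of
  q g.\<close>

lemma euler_homog: "f \<in> homog d \<Longrightarrow> (\<Sum>i\<in>UNIV. coord i * partial i f) = cscale (of_int d) f"
  using euler_homog_nat[of f "nat d"] homog_neg[of f d] by (cases "d < 0") auto

section \<open>The harmonic part\<close>

lemma homog_polys: "f \<in> homog d \<Longrightarrow> f \<in> polys"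
  using homog_subset_polys by blast

lemma qf_eq: "qf = (\<Sum>i\<in>UNIV. coord i * coord i)"
  by (auto simp: fun_eq_iff fun_simps qf_def sum_3 power2_eq_square)

lemma qf_homog: "qf \<in> homog 2"
  unfolding qf_eq using homog_mult[OF coord_homog coord_homog] by (intro homog_sum) simp

lemma qf_polys: "qf \<in> polys"
  by (rule homog_polys[OF qf_homog])

lemma qf_power_homog: "qf ^ j \<in> homog (2 * int j)"
  using homog_power[OF qf_homog, of j] by (simp add: mult.commute)

lemma partial_qf: "partial i qf = cscale 2 (coord i)"
proof -
  have "partial i (coord k * coord k) = (if k = i then cscale 2 (coord i) else 0)" for k
    by (auto simp: partial_mult coord_polys partial_coord fun_eq_iff fun_simps)
  then show ?thesis
    unfolding qf_eq by (subst partial_sum) (auto intro: polys_mult coord_polys)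
qed

section \<open>The Laplacian and multiplication by q\<close>

lemma laplacian_add:
  "f \<in> polys \<Longrightarrow> g \<in> polys \<Longrightarrow> laplacian (f + g) = laplacian f + laplacian g"
  by (simp add: laplacian_def partial_add partial_polys sum.distrib)

lemma laplacian_cscale: "f \<in> polys \<Longrightarrow> laplacian (cscale c f) = cscale c (laplacian f)"
  by (simp add: laplacian_def partial_cscale partial_polys cscale_sum)

lemma laplacian_0 [simp]: "laplacian 0 = 0"
  by (simp add: laplacian_def)

lemma laplacian_homog: "f \<in> homog d \<Longrightarrow> laplacian f \<in> homog (d - 2)"
  unfolding laplacian_def using partial_homog[OF partial_homog, of f d] by (intro homog_sum) simp

lemma laplacian_sum:
  "(\<And>a. a \<in> A \<Longrightarrow> f a \<in> polys) \<Longrightarrow> laplacian (\<Sum>a\<in>A. f a) = (\<Sum>a\<in>A. laplacian (f a))"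
  by (induction A rule: infinite_finite_induct) (auto simp: laplacian_add polys_sum)

lemma laplacian_mult:
  assumes "f \<in> polys" "g \<in> polys"
  shows "laplacian (f * g) =
    laplacian f * g + cscale 2 (\<Sum>i\<in>UNIV. partial i f * partial i g) + f * laplacian g"
proof -
  have "partial i (partial i (f * g)) = partial i (partial i f) * g +
      cscale 2 (partial i f * partial i g) + f * partial i (partial i g)" for i
    using assms
    by (simp add: partial_mult partial_add partial_polys polys_mult)
      (auto simp: fun_eq_iff fun_simps algebra_simps)
  then show ?thesis
    by (simp add: laplacian_def sum.distrib sum_distrib_left sum_distrib_right cscale_sum)
qed

lemma laplacian_qf: "laplacian qf = const_fun 6"
  by (simp add: laplacian_def partial_qf partial_cscale coord_polys partial_coord)
    (auto simp: fun_eq_iff fun_simps)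

text \<open>The 6 is the Laplacian of q in three variables. The 4 d is twice the mixed term: the
  gradient of q is 2 x, and Euler's identity applies.\<close>

lemma laplacian_qf_mult:
  assumes "g \<in> homog d"
  shows "laplacian (qf * g) = qf * laplacian g + cscale (of_int (4 * d + 6)) g"
proof -
  have "(\<Sum>i\<in>UNIV. partial i qf * partial i g) = cscale 2 (\<Sum>i\<in>UNIV. coord i * partial i g)"
    by (simp add: partial_qf cscale_mult_left cscale_sum)
  also have "\<dots> = cscale (of_int (2 * d)) g"
    by (simp add: euler_homog[OF assms] cscale_cscale)
  finally show ?thesis
    using laplacian_mult[OF qf_polys homog_polys[OF assms]]
    by (auto simp: laplacian_qf fun_eq_iff fun_simps algebra_simps)
qed

text \<open>The constant is the sum of 4 (2 i + d) + 6 over i = 0, ..., j, one summand for each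
  factor q moved past the Laplacian.\<close>

lemma laplacian_qf_power:
  assumes "g \<in> homog d"
  shows "laplacian (qf ^ Suc j * g) =
    qf ^ Suc j * laplacian g + cscale (of_int (2 * (int j + 1) * (2 * d + 2 * int j + 3))) (qf ^ j * g)"
proof (induction j)
  case 0
  show "laplacian (qf ^ Suc 0 * g) =
    qf ^ Suc 0 * laplacian g + cscale (of_int (2 * (int 0 + 1) * (2 * d + 2 * int 0 + 3))) (qf ^ 0 * g)"
    using laplacian_qf_mult[OF assms] by simp
next
  case (Suc j)
  have h: "qf ^ Suc j * g \<in> homog (2 * int (Suc j) + d)"
    by (intro homog_mult qf_power_homog assms)
  have "laplacian (qf ^ Suc (Suc j) * g) = laplacian (qf * (qf ^ Suc j * g))"
    by (simp add: mult.assoc)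
  also have "\<dots> = qf * laplacian (qf ^ Suc j * g) +
      cscale (of_int (4 * (2 * int (Suc j) + d) + 6)) (qf ^ Suc j * g)"
    by (rule laplacian_qf_mult[OF h])
  also have "\<dots> = qf ^ Suc (Suc j) * laplacian g +
      cscale (of_int (2 * (int (Suc j) + 1) * (2 * d + 2 * int (Suc j) + 3))) (qf ^ Suc j * g)"
    unfolding Suc by (auto simp: fun_eq_iff fun_simps algebra_simps)
  finally show "laplacian (qf ^ Suc (Suc j) * g) = qf ^ Suc (Suc j) * laplacian g +
      cscale (of_int (2 * (int (Suc j) + 1) * (2 * d + 2 * int (Suc j) + 3))) (qf ^ Suc j * g)" .
qed

text \<open>A harmonic polynomial divisible by \<open>q\<close> is divisible by every power of \<open>q\<close>, hence zero.\<close>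

lemma harmonic_qf_multiple_zero:
  assumes "p \<in> homog d" "laplacian (qf ^ Suc k * p) = 0"
  shows "qf ^ Suc k * p = 0"
  using assms
proof (induction "nat d" arbitrary: d p k rule: less_induct)
  case less
  show "qf ^ Suc k * p = 0"
  proof (cases "d < 0")
    case True
    then show ?thesis
      using homog_neg[OF less.prems(1)] by simp
  next
    case False
    define c :: complex where "c = of_int (2 * (int k + 1) * (2 * d + 2 * int k + 3))"
    have "c \<noteq> 0"
      using False unfolding c_def of_int_eq_0_iff by simp
    \<comment> \<open>Harmonicity trades two degrees of the cofactor for one more factor q, and the
      descent on d ends when the cofactor has negative degree. The claim keeps the form
      \<open>qf ^ Suc k * p = 0\<close>, so nothing is ever divided by q.\<close>
    define p' where "p' = cscale (- 1 / c) (laplacian p)"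
    have p': "p' \<in> homog (d - 2)"
      unfolding p'_def by (intro homog_cscale laplacian_homog less.prems)
    have z: "qf ^ Suc k * laplacian p + cscale c (qf ^ k * p) = 0"
      using laplacian_qf_power[OF less.prems(1), of k] less.prems(2) by (simp add: c_def)
    have e: "qf ^ Suc k * p = qf ^ Suc (Suc k) * p'"
    proof
      fix x
      have "c * ((qf ^ k) x * p x) = - ((qf ^ Suc k) x * laplacian p x)"
        using fun_cong[OF z, of x] by (simp add: fun_simps add_eq_0_iff)
      then have "(qf ^ k) x * p x = - ((qf ^ Suc k) x * laplacian p x) / c"
        using \<open>c \<noteq> 0\<close> by (simp add: field_simps)
      moreover have "(qf ^ Suc k * p) x = qf x * ((qf ^ k) x * p x)"
        by (simp add: fun_simps)
      ultimately show "(qf ^ Suc k * p) x = (qf ^ Suc (Suc k) * p') x"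
        by (simp add: fun_simps p'_def)
    qed
    show ?thesis
    proof (cases "d < 2")
      case True
      then show ?thesis
        using homog_neg[OF p'] e by simp
    next
      case False
      then have "nat (d - 2) < nat d"
        by simp
      then show ?thesis
        using less.hyps[OF _ p', of "Suc k"] e less.prems(2) by simp
    qed
  qed
qed

lemma harmonic_qf_zero:
  assumes "h \<in> harmC l" "h = qf * p" "p \<in> homog d"
  shows "h = 0"
  using harmonic_qf_multiple_zero[OF assms(3), of 0] assms by (simp add: harmC_def)

lemma harmC_homog: "f \<in> harmC l \<Longrightarrow> f \<in> homog (int l)"
  and harmC_laplacian: "f \<in> harmC l \<Longrightarrow> laplacian f = 0"
  by (auto simp: harmC_def)

lemma harmC_polys: "f \<in> harmC l \<Longrightarrow> f \<in> polys"
  by (rule homog_polys[OF harmC_homog])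

lemma harmC_0 [simp]: "0 \<in> harmC l"
  by (simp add: harmC_def)

lemma harmC_add: "f \<in> harmC l \<Longrightarrow> g \<in> harmC l \<Longrightarrow> f + g \<in> harmC l"
  using laplacian_add[of f g] harmC_polys by (auto simp: harmC_def homog_add)

lemma harmC_cscale: "f \<in> harmC l \<Longrightarrow> cscale c f \<in> harmC l"
  using laplacian_cscale[of f c] harmC_polys by (auto simp: harmC_def homog_cscale)

lemma harmC_diff: "f \<in> harmC l \<Longrightarrow> g \<in> harmC l \<Longrightarrow> f - g \<in> harmC l"
  by (simp add: diff_eq_cscale harmC_add harmC_cscale)

lemma harmC_sum: "(\<And>a. a \<in> A \<Longrightarrow> f a \<in> harmC l) \<Longrightarrow> (\<Sum>a\<in>A. f a) \<in> harmC l"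
  by (induction A rule: infinite_finite_induct) (auto intro: harmC_add)

section \<open>Uniqueness and explicit formula of the harmonic part\<close>

lemma is_harm_part_unique:
  assumes "is_harm_part l P h" "is_harm_part l P h'"
  shows "h = h'"
proof -
  obtain p p' where p: "p \<in> homog (int l - 2)" "p' \<in> homog (int l - 2)"
      "P - h = qf * p" "P - h' = qf * p'"
    using assms unfolding is_harm_part_def by blast
  have "h - h' = (P - h') - (P - h)"
    by simp
  also have "\<dots> = qf * (p' - p)"
    unfolding p by (simp add: right_diff_distrib)
  finally have "h - h' = qf * (p' - p)" .
  moreover have "h - h' \<in> harmC l"
    using assms unfolding is_harm_part_def by (blast intro: harmC_diff)
  ultimately have "h - h' = 0"
    using harmonic_qf_zero homog_diff[OF p(2,1)] by blast
  then show ?thesis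
    by simp
qed

lemma laplacian_iter_homog: "P \<in> homog d \<Longrightarrow> (laplacian ^^ j) P \<in> homog (d - 2 * int j)"
proof (induction j)
  case (Suc j)
  then have "laplacian ((laplacian ^^ j) P) \<in> homog (d - 2 * int j - 2)"
    by (intro laplacian_homog)
  then show "(laplacian ^^ Suc j) P \<in> homog (d - 2 * int (Suc j))"
    by (simp add: algebra_simps)
qed simp

definition harm_coeff :: "nat \<Rightarrow> nat \<Rightarrow> complex" where
  "harm_coeff l j = (- 1) ^ j / (2 ^ j * fact j * (\<Prod>i = 1..j. 2 * of_nat l - 2 * of_nat i + 1))"

text \<open>The recursion that makes the Laplacian telescope: the lower term produced by the power j
  + 1 of q must cancel the upper term left by the power j. Together with the value 1 at j = 0 it
  forces the coefficients.\<close>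

lemma harm_coeff_Suc:
  "harm_coeff l (Suc j) * of_int (2 * (int j + 1) * (2 * (int l - 2 * int (Suc j)) + 2 * int j + 3)) =
    - harm_coeff l j"
proof -
  let ?e = "2 * of_nat l - 2 * of_nat (Suc j) + 1 :: complex"
  have e: "?e = of_int (2 * int l - 2 * int (Suc j) + 1)"
    by simp
  \<comment> \<open>Parity rather than size excludes zero: j is arbitrary here, and the factor is
    negative once j >= l.\<close>
  have "odd (2 * int l - 2 * int (Suc j) + 1)"
    by simp
  then have "2 * int l - 2 * int (Suc j) + 1 \<noteq> 0"
    by (metis even_zero)
  then have "?e \<noteq> 0"
    unfolding e of_int_eq_0_iff .
  have "of_int (2 * (int j + 1) * (2 * (int l - 2 * int (Suc j)) + 2 * int j + 3)) =
      2 * (of_nat (Suc j) :: complex) * ?e"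
    by (simp add: algebra_simps)
  moreover have "harm_coeff l (Suc j) = - harm_coeff l j / (2 * of_nat (Suc j) * ?e)"
    by (simp add: harm_coeff_def prod.nat_ivl_Suc' mult_ac)
  ultimately show ?thesis
    using \<open>?e \<noteq> 0\<close> by (simp del: of_nat_Suc)
qed

definition harm_proj :: "nat \<Rightarrow> (complex ^ 3 \<Rightarrow> complex) \<Rightarrow> complex ^ 3 \<Rightarrow> complex" where
  "harm_proj l P = (\<Sum>j\<le>l div 2. cscale (harm_coeff l j) (qf ^ j * (laplacian ^^ j) P))"

text \<open>Only the top term survives the telescoping, and it contains one Laplacian more than
  factors of q.\<close>

lemma laplacian_harm_sum:
  assumes "P \<in> homog (int l)"
  shows "laplacian (\<Sum>j\<le>n. cscale (harm_coeff l j) (qf ^ j * (laplacian ^^ j) P)) =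
    cscale (harm_coeff l n) (qf ^ n * (laplacian ^^ Suc n) P)"
proof (induction n)
  case 0
  have "cscale (harm_coeff l 0) (qf ^ 0 * (laplacian ^^ 0) P) = P"
    by (simp add: harm_coeff_def)
  then show "laplacian (\<Sum>j\<le>0. cscale (harm_coeff l j) (qf ^ j * (laplacian ^^ j) P)) =
    cscale (harm_coeff l 0) (qf ^ 0 * (laplacian ^^ Suc 0) P)"
    by (simp add: harm_coeff_def)
next
  case (Suc n)
  let ?t = "\<lambda>j. cscale (harm_coeff l j) (qf ^ j * (laplacian ^^ j) P)"
  note h = laplacian_iter_homog[OF assms, of "Suc n"]
  have t: "?t j \<in> polys" for j
    by (intro polys_cscale polys_mult polys_power qf_polys homog_polys[OF laplacian_iter_homog[OF assms]])
  have "laplacian (?t (Suc n)) = cscale (harm_coeff l (Suc n)) (qf ^ Suc n * (laplacian ^^ Suc (Suc n)) P)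
      + cscale (harm_coeff l (Suc n) *
          of_int (2 * (int n + 1) * (2 * (int l - 2 * int (Suc n)) + 2 * int n + 3)))
        (qf ^ n * (laplacian ^^ Suc n) P)"
    unfolding laplacian_cscale[OF polys_mult[OF polys_power[OF qf_polys] homog_polys[OF h]]]
      laplacian_qf_power[OF h] cscale_add cscale_cscale
    by simp
  then have e: "laplacian (?t (Suc n)) =
      cscale (harm_coeff l (Suc n)) (qf ^ Suc n * (laplacian ^^ Suc (Suc n)) P)
      + cscale (- harm_coeff l n) (qf ^ n * (laplacian ^^ Suc n) P)"
    unfolding harm_coeff_Suc .
  have "laplacian (\<Sum>j\<le>Suc n. ?t j) = laplacian (\<Sum>j\<le>n. ?t j) + laplacian (?t (Suc n))"
    unfolding sum.atMost_Suc by (intro laplacian_add polys_sum t)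
  also have "\<dots> = cscale (harm_coeff l (Suc n)) (qf ^ Suc n * (laplacian ^^ Suc (Suc n)) P)"
    unfolding Suc e by (simp add: fun_eq_iff fun_simps)
  finally show "laplacian (\<Sum>j\<le>Suc n. ?t j) =
      cscale (harm_coeff l (Suc n)) (qf ^ Suc n * (laplacian ^^ Suc (Suc n)) P)" .
qed

lemma harm_proj_is_harm_part:
  assumes "P \<in> homog (int l)"
  shows "is_harm_part l P (harm_proj l P)"
  unfolding is_harm_part_def
proof
  \<comment> \<open>At n = l div 2 the surviving term has exhausted the degree of P and
    vanishes.\<close>
  have "int l - 2 * int (Suc (l div 2)) < 0"
    by presburger
  then have "(laplacian ^^ Suc (l div 2)) P = 0"
    using homog_neg[OF laplacian_iter_homog[OF assms]] by blast
  then have "laplacian (harm_proj l P) = 0"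
    unfolding harm_proj_def laplacian_harm_sum[OF assms] by simp
  moreover have "harm_proj l P \<in> homog (int l)"
    unfolding harm_proj_def
  proof (intro homog_sum homog_cscale)
    fix j
    show "qf ^ j * (laplacian ^^ j) P \<in> homog (int l)"
      using homog_mult[OF qf_power_homog laplacian_iter_homog[OF assms], of j j] by simp
  qed
  ultimately show "harm_proj l P \<in> harmC l"
    by (simp add: harmC_def)
  \<comment> \<open>The summand j = 0 is P itself; all others contain q, and the shifted index takes
    one factor out.\<close>
  let ?p = "\<Sum>j<l div 2. cscale (- harm_coeff l (Suc j)) (qf ^ j * (laplacian ^^ Suc j) P)"
  have "harm_proj l P = P + (\<Sum>j<l div 2. cscale (harm_coeff l (Suc j)) (qf ^ Suc j * (laplacian ^^ Suc j) P))"
    unfolding harm_proj_def by (subst sum.atMost_shift) (simp add: harm_coeff_def)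
  then have "P - harm_proj l P = qf * ?p"
    by (auto simp: fun_eq_iff fun_simps sum_distrib_left sum_negf algebra_simps)
  moreover have "?p \<in> homog (int l - 2)"
  proof (intro homog_sum homog_cscale)
    fix j
    show "qf ^ j * (laplacian ^^ Suc j) P \<in> homog (int l - 2)"
      using homog_mult[OF qf_power_homog laplacian_iter_homog[OF assms], of j "Suc j"] by simp
  qed
  ultimately show "P - harm_proj l P \<in> (\<lambda>p. qf * p) ` homog (int l - 2)"
    by blast
qed

lemma harm_part_eq_harm_proj: "P \<in> homog (int l) \<Longrightarrow> harm_part l P = harm_proj l P"
  unfolding harm_part_def
  by (rule the_equality) (auto intro: harm_proj_is_harm_part is_harm_part_unique)

lemma qf_power_apply: "(qf ^ j) x = qf x ^ j"
  by (induction j) (auto simp: fun_simps)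

lemma harm_part_formula:
  assumes "P \<in> homog (int l)"
  shows "harm_part l P = (\<lambda>x. \<Sum>j = 0..l div 2.
    (- 1) ^ j * qf x ^ j * (laplacian ^^ j) P x /
      (2 ^ j * fact j * (\<Prod>i = 1..j. 2 * of_nat l - 2 * of_nat i + 1)))"
  unfolding harm_part_eq_harm_proj[OF assms] harm_proj_def harm_coeff_def atLeast0AtMost
  by (auto simp: fun_eq_iff fun_simps qf_power_apply intro!: sum.cong)

section \<open>The null cone\<close>

definition lin_form :: "complex ^ 3 \<Rightarrow> complex ^ 3 \<Rightarrow> complex" where
  "lin_form w = (\<Sum>i\<in>UNIV. cscale (w $ i) (coord i))"

lemma lin_form_apply: "lin_form w x = w $ 1 * x $ 1 + w $ 2 * x $ 2 + w $ 3 * x $ 3"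
  by (simp add: lin_form_def fun_simps sum_3)

lemma lin_form_homog: "lin_form w \<in> homog 1"
  unfolding lin_form_def by (intro homog_sum homog_cscale coord_homog)

lemma lin_form_power_homog: "lin_form w ^ n \<in> homog (int n)"
  using homog_power[OF lin_form_homog, of w n] by simp

lemma lin_form_power_polys: "lin_form w ^ n \<in> polys"
  by (rule homog_polys[OF lin_form_power_homog])

lemma partial_lin_form: "partial i (lin_form w) = const_fun (w $ i)"
proof -
  have "partial i (cscale (w $ k) (coord k)) = (if k = i then const_fun (w $ i) else 0)" for k
    by (auto simp: coord_polys partial_cscale partial_coord fun_eq_iff fun_simps)
  then show ?thesis
    unfolding lin_form_def by (subst partial_sum) (auto intro: polys_cscale coord_polys)
qed

lemma power_fun_apply: "((f :: 'a \<Rightarrow> complex) ^ n) x = f x ^ n"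
  by (induction n) (auto simp: fun_simps)

lemma partial_lin_form_power:
  "partial i (lin_form w ^ Suc n) = cscale (of_nat (Suc n) * w $ i) (lin_form w ^ n)"
proof (induction n)
  case 0
  show "partial i (lin_form w ^ Suc 0) = cscale (of_nat (Suc 0) * w $ i) (lin_form w ^ 0)"
    by (auto simp: partial_lin_form fun_eq_iff fun_simps)
next
  case (Suc n)
  have "partial i (lin_form w ^ Suc (Suc n)) = partial i (lin_form w * lin_form w ^ Suc n)"
    by simp
  also have "\<dots> = const_fun (w $ i) * lin_form w ^ Suc n +
      lin_form w * cscale (of_nat (Suc n) * w $ i) (lin_form w ^ n)"
    by (subst partial_mult[OF homog_polys[OF lin_form_homog] lin_form_power_polys])
      (simp only: partial_lin_form Suc)
  also have "\<dots> = cscale (of_nat (Suc (Suc n)) * w $ i) (lin_form w ^ Suc n)"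
    by (auto simp: fun_eq_iff fun_simps algebra_simps)
  finally show "partial i (lin_form w ^ Suc (Suc n)) =
      cscale (of_nat (Suc (Suc n)) * w $ i) (lin_form w ^ Suc n)" .
qed

text \<open>The second derivative in direction i is n (n - 1) w_i^2 times a common power, so the
  Laplacian carries the factor q(w).\<close>

lemma lin_form_power_harmonic:
  assumes "qf w = 0"
  shows "lin_form w ^ n \<in> harmC n"
proof -
  \<comment> \<open>For n < 2 the truncated exponent \<open>n - 2\<close> is harmless since the
    factor n (n - 1) is 0.\<close>
  have "partial i (partial i (lin_form w ^ n)) =
      cscale ((w $ i)\<^sup>2) (cscale (of_nat (n * (n - 1))) (lin_form w ^ (n - 2)))" for i
  proof (cases n)
    case 0
    then show ?thesis
      using partial_const[of i 1] by (simp add: const_fun_def one_fun_def)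
  next
    case (Suc m)
    show ?thesis
    proof (cases m)
      case 0
      then show ?thesis
        using Suc partial_const[of i "w $ i"] by (simp add: partial_lin_form)
    next
      case (Suc k)
      with \<open>n = Suc m\<close> show ?thesis
        by (simp add: partial_lin_form_power partial_cscale lin_form_power_polys cscale_cscale
            del: power_Suc of_nat_Suc)
          (auto simp: fun_eq_iff fun_simps power2_eq_square algebra_simps)
    qed
  qed
  then have "laplacian (lin_form w ^ n) =
      cscale (\<Sum>i\<in>UNIV. (w $ i)\<^sup>2) (cscale (of_nat (n * (n - 1))) (lin_form w ^ (n - 2)))"
    by (auto simp: laplacian_def fun_eq_iff fun_simps sum_distrib_right)
  also have "(\<Sum>i\<in>UNIV. (w $ i)\<^sup>2) = qf w"
    by (simp add: sum_3 qf_def)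
  finally show ?thesis
    using assms lin_form_power_homog by (simp add: harmC_def)
qed

lemma qf_vmap: "qf (vmap z) = 0"
proof -
  have "(\<i> * u)\<^sup>2 = - u\<^sup>2" for u
    by (simp add: power_mult_distrib)
  then show ?thesis
    by (simp add: qf_def vmap_def) (simp add: power2_eq_square algebra_simps)
qed

lemma lin_form_vmap_vmap:
  "lin_form (vmap \<zeta>) (vmap z) = - 2 * (\<zeta> $ 1 * z $ 2 - \<zeta> $ 2 * z $ 1)\<^sup>2"
proof -
  have i: "(\<i> * u) * (\<i> * v) = - (u * v)" for u v
    by (simp add: complex_eq_iff)
  have "lin_form (vmap \<zeta>) (vmap z) = ((\<zeta> $ 1)\<^sup>2 - (\<zeta> $ 2)\<^sup>2) * ((z $ 1)\<^sup>2 - (z $ 2)\<^sup>2) +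
      (\<i> * ((\<zeta> $ 1)\<^sup>2 + (\<zeta> $ 2)\<^sup>2)) * (\<i> * ((z $ 1)\<^sup>2 + (z $ 2)\<^sup>2)) +
      (2 * \<zeta> $ 1 * \<zeta> $ 2) * (2 * z $ 1 * z $ 2)"
    by (simp add: lin_form_apply vmap_def)
  then show ?thesis
    unfolding i by (simp add: power2_eq_square algebra_simps)
qed

text \<open>The coefficients in \<open>t\<close> of the harmonic polynomials \<open>(v(1, t) \<bullet> x) ^ l\<close>.\<close>

definition null_poly :: "complex ^ 3 \<Rightarrow> complex poly" where
  "null_poly x = [:x $ 1 + \<i> * x $ 2, 2 * x $ 3, - (x $ 1 - \<i> * x $ 2):]"

definition harm_basis :: "nat \<Rightarrow> nat \<Rightarrow> complex ^ 3 \<Rightarrow> complex" where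
  "harm_basis l k x = poly.coeff (null_poly x ^ l) k"

lemma poly_null_poly: "poly (null_poly x) t = lin_form (vmap (vector [1, t])) x"
  by (simp add: null_poly_def lin_form_apply vmap_def power2_eq_square algebra_simps)

lemma degree_null_poly_power: "Polynomial.degree (null_poly x ^ l) \<le> 2 * l"
proof -
  have "Polynomial.degree (null_poly x) \<le> 2"
    by (simp add: null_poly_def)
  then show ?thesis
    using degree_power_le[of "null_poly x" l] by (meson le_trans mult_le_mono1)
qed

lemma poly_eq_sum_coeff:
  fixes p :: "'a :: comm_semiring_1 poly"
  assumes "Polynomial.degree p \<le> n"
  shows "poly p t = (\<Sum>k\<le>n. poly.coeff p k * t ^ k)"
  unfolding poly_altdef
  by (rule sum.mono_neutral_left) (use assms in \<open>auto simp: coeff_eq_0\<close>)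

lemma harm_basis_eq_0: "2 * l < k \<Longrightarrow> harm_basis l k = 0"
  using le_less_trans[OF degree_null_poly_power, THEN coeff_eq_0, of l k]
  by (simp add: fun_eq_iff fun_simps harm_basis_def)

text \<open>The generating function from which the properties of the coefficients are read off; the
  bound 2 l provides a range of summation that does not depend on x.\<close>

lemma harm_basis_sum:
  "(\<Sum>k\<le>2 * l. harm_basis l k x * t ^ k) = lin_form (vmap (vector [1, t])) x ^ l"
  using poly_eq_sum_coeff[OF degree_null_poly_power, of x l t]
  by (simp add: harm_basis_def poly_null_poly)

lemma harm_basis_homog: "harm_basis l k \<in> homog (int l)"
proof (induction l arbitrary: k)
  case 0
  have "harm_basis 0 k = const_fun (if k = 0 then 1 else 0)"
    by (auto simp: fun_eq_iff fun_simps harm_basis_def)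
  then show ?case
    by (simp add: const_homog)
next
  case (Suc l)
  let ?A = "coord 1 + cscale \<i> (coord 2) :: complex ^ 3 \<Rightarrow> complex"
  let ?B = "cscale 2 (coord 3) :: complex ^ 3 \<Rightarrow> complex"
  let ?C = "cscale (-1) (coord 1 - cscale \<i> (coord 2)) :: complex ^ 3 \<Rightarrow> complex"
  have *: "?A \<in> homog 1" "?B \<in> homog 1" "?C \<in> homog 1"
    by (intro homog_add homog_diff homog_cscale coord_homog)+
  have **: "f \<in> homog 1 \<Longrightarrow> f * harm_basis l m \<in> homog (1 + int l)" for f m
    using homog_mult[of f 1 "harm_basis l m" "int l"] Suc by simp
  \<comment> \<open>Multiplication by the quadratic \<open>null_poly x\<close> gives a three-term
    recursion with linear factors; terms of negative index drop out.\<close>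
  have "harm_basis (Suc l) k = ?A * harm_basis l k + (case k of 0 \<Rightarrow> 0 | Suc m \<Rightarrow>
      ?B * harm_basis l m + (case m of 0 \<Rightarrow> 0 | Suc n \<Rightarrow> ?C * harm_basis l n))"
    by (auto simp: fun_eq_iff fun_simps harm_basis_def null_poly_def coeff_pCons split: nat.splits)
  also have "\<dots> \<in> homog (1 + int l)"
    by (auto split: nat.splits intro!: homog_add ** *)
  finally show ?case
    by simp
qed

lemma harm_basis_polys: "harm_basis l k \<in> polys"
  by (rule homog_polys[OF harm_basis_homog])

text \<open>At a fixed point x the Laplacians are the coefficients of a polynomial in t that
  vanishes for every t.\<close>

lemma harm_basis_harmonic: "harm_basis l k \<in> harmC l"
proof (cases "k \<le> 2 * l")
  case True
  have "laplacian (harm_basis l k) x = 0" for x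
  proof (rule zero_polynom_imp_zero_coeffs[OF _ True])
    fix t :: complex
    have "lin_form (vmap (vector [1, t])) ^ l = (\<Sum>k\<le>2 * l. cscale (t ^ k) (harm_basis l k))"
      by (auto simp: fun_eq_iff fun_simps power_fun_apply mult.commute simp flip: harm_basis_sum)
    then have "laplacian (lin_form (vmap (vector [1, t])) ^ l) =
        (\<Sum>k\<le>2 * l. cscale (t ^ k) (laplacian (harm_basis l k)))"
      by (simp add: laplacian_sum polys_cscale harm_basis_polys laplacian_cscale)
    moreover have "laplacian (lin_form (vmap (vector [1, t])) ^ l) = 0"
      by (rule harmC_laplacian[OF lin_form_power_harmonic[OF qf_vmap]])
    ultimately have "0 = (\<Sum>k\<le>2 * l. cscale (t ^ k) (laplacian (harm_basis l k))) x"
      by (simp add: fun_simps)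
    then show "(\<Sum>k\<le>2 * l. laplacian (harm_basis l k) x * t ^ k) = 0"
      by (simp add: fun_simps mult.commute)
  qed
  then show ?thesis
    using harm_basis_homog by (auto simp: harmC_def fun_eq_iff fun_simps)
next
  case False
  then show ?thesis
    using harm_basis_eq_0[of l k] by simp
qed

text \<open>Binomial expansion of (-2)^l (z_1 - t z_0)^(2 l), the value of the generating function
  on the null cone.\<close>

lemma harm_basis_vmap:
  assumes "k \<le> 2 * l"
  shows "harm_basis l k (vmap z) =
    (- 2) ^ l * of_nat ((2 * l) choose k) * (- 1) ^ k * (z $ 1) ^ k * (z $ 2) ^ (2 * l - k)"
proof -
  have "(\<Sum>k\<le>2 * l. harm_basis l k (vmap z) * t ^ k) = (\<Sum>k\<le>2 * l.
      (- 2) ^ l * of_nat ((2 * l) choose k) * (- 1) ^ k * (z $ 1) ^ k * (z $ 2) ^ (2 * l - k) * t ^ k)" for t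
  proof -
    have p: "(- t * z $ 1) ^ k = (- 1) ^ k * t ^ k * (z $ 1) ^ k" for k
      by (simp add: power_mult_distrib[symmetric])
    have "(\<Sum>k\<le>2 * l. harm_basis l k (vmap z) * t ^ k) = (- 2) ^ l * (- t * z $ 1 + z $ 2) ^ (2 * l)"
      unfolding harm_basis_sum lin_form_vmap_vmap
      by (simp only: power_mult_distrib power_mult vector_2) (simp add: algebra_simps)
    also have "\<dots> = (\<Sum>k\<le>2 * l. (- 2) ^ l * (of_nat ((2 * l) choose k) * (- t * z $ 1) ^ k * (z $ 2) ^ (2 * l - k)))"
      unfolding binomial_ring sum_distrib_left ..
    also have "\<dots> = (\<Sum>k\<le>2 * l.
      (- 2) ^ l * of_nat ((2 * l) choose k) * (- 1) ^ k * (z $ 1) ^ k * (z $ 2) ^ (2 * l - k) * t ^ k)"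
      unfolding p by (intro sum.cong refl) (simp add: mult_ac)
    finally show ?thesis .
  qed
  then show ?thesis
    using polyfun_eq_coeffs[THEN iffD1, rule_format, OF _ assms, of "\<lambda>k. harm_basis l k (vmap z)"
      "\<lambda>k. (- 2) ^ l * of_nat ((2 * l) choose k) * (- 1) ^ k * (z $ 1) ^ k * (z $ 2) ^ (2 * l - k)"]
    by simp
qed

section \<open>The isomorphism with binary forms\<close>

lemma polyfun_coeffs_eqD:
  fixes c d :: "nat \<Rightarrow> complex"
  assumes "\<And>t. (\<Sum>i\<le>n. c i * t ^ i) = (\<Sum>i\<le>n. d i * t ^ i)" "i \<le> n"
  shows "c i = d i"
  using polyfun_eq_coeffs[THEN iffD1, rule_format, of c n d i] assms by blast

section \<open>Binary forms and their coefficients\<close>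

definition bmono :: "nat \<Rightarrow> nat \<Rightarrow> complex ^ 2 \<Rightarrow> complex" where
  "bmono n k = (\<lambda>z. (z $ 1) ^ (n - k) * (z $ 2) ^ k)"

lemma bmono_eq: "bmono n k = coord 1 ^ (n - k) * coord 2 ^ k"
  by (auto simp: bmono_def fun_eq_iff fun_simps power_fun_apply)

lemma coord_power_homog: "coord i ^ k \<in> homog (int k)"
  using homog_power[OF coord_homog, of i k] by simp

lemma bmono_homog: "k \<le> n \<Longrightarrow> bmono n k \<in> Sym n"
  unfolding bmono_eq
  using homog_mult[OF coord_power_homog coord_power_homog, of 1 "n - k" 2 k] by simp

lemma bform_eq_sum: "bform n a = (\<Sum>k\<le>n. cscale (of_nat (n choose k) * a k) (bmono n k))"
  by (auto simp: bform_def bmono_def fun_eq_iff fun_simps mult_ac)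

lemma sum_bmono_eq_bform:
  "(\<Sum>k\<le>n. cscale (b k) (bmono n k)) = bform n (\<lambda>k. b k / of_nat (n choose k))"
  unfolding bform_eq_sum by (intro sum.cong refl) simp

lemma bform_homog: "bform n a \<in> Sym n"
  unfolding bform_eq_sum by (intro homog_sum homog_cscale bmono_homog) simp

lemma bform_0: "bform n (\<lambda>k. 0) = 0"
  by (auto simp: bform_def fun_eq_iff fun_simps)

lemma bform_add: "bform n a + bform n b = bform n (\<lambda>k. a k + b k)"
  by (auto simp: bform_def fun_eq_iff fun_simps algebra_simps simp flip: sum.distrib)

lemma bform_cscale: "cscale c (bform n a) = bform n (\<lambda>k. c * a k)"
  by (auto simp: bform_def fun_eq_iff fun_simps sum_distrib_left mult_ac)

lemma bform_cong: "(\<And>k. k \<le> n \<Longrightarrow> a k = b k) \<Longrightarrow> bform n a = bform n b"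
  by (simp add: bform_def)

lemma bmono_eq_bform:
  assumes "k \<le> n"
  shows "bmono n k = bform n (\<lambda>j. if j = k then 1 / of_nat (n choose k) else 0)"
proof
  fix z
  have "bform n (\<lambda>j. if j = k then 1 / of_nat (n choose k) else 0) z =
      (\<Sum>j\<le>n. if j = k then bmono n k z else 0)"
    unfolding bform_def bmono_def by (rule sum.cong) auto
  then show "bmono n k z = bform n (\<lambda>j. if j = k then 1 / of_nat (n choose k) else 0) z"
    using assms by simp
qed

lemma Sym_bform:
  assumes "F \<in> Sym n"
  obtains a where "F = bform n a"
proof -
  have "\<exists>a. F = bform n a"
    using assms
  proof (induction rule: homog_induct)
    case zero
    then show "\<exists>a. 0 = bform n a"
      using bform_0 by metis
  next
    case (add f g)
    then show "\<exists>a. f + g = bform n a"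
      using bform_add by metis
  next
    case (monomial c \<alpha>)
    then have n: "\<alpha> 1 = n - \<alpha> 2" "\<alpha> 2 \<le> n"
      by (auto simp: sum_2)
    have "monomial_fun \<alpha> = bmono n (\<alpha> 2)"
      by (auto simp: fun_eq_iff monomial_fun_def bmono_def UNIV_2 n(1))
    then have "cscale c (monomial_fun \<alpha>) = bform n (\<lambda>k. c * (if k = \<alpha> 2 then 1 / of_nat (n choose \<alpha> 2) else 0))"
      using bmono_eq_bform[OF n(2)] by (simp only: bform_cscale)
    then show "\<exists>a. cscale c (monomial_fun \<alpha>) = bform n a"
      by blast
  qed
  then show ?thesis
    using that by blast
qed

lemma bform_apply_1: "bform n a (vector [1, t]) = (\<Sum>k\<le>n. of_nat (n choose k) * a k * t ^ k)"
  by (simp add: bform_def)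

text \<open>Setting z = (1, t) loses nothing for a form of fixed degree and reduces the claim to
  polynomials in t; the binomial weights are nonzero for k <= n.\<close>

lemma bform_eq_iff: "bform n a = bform n b \<longleftrightarrow> (\<forall>k\<le>n. a k = b k)"
proof
  assume "bform n a = bform n b"
  then have *: "(\<Sum>k\<le>n. of_nat (n choose k) * a k * t ^ k) = (\<Sum>k\<le>n. of_nat (n choose k) * b k * t ^ k)" for t
    unfolding bform_apply_1[symmetric] by simp
  show "\<forall>k\<le>n. a k = b k"
  proof safe
    fix k assume "k \<le> n"
    from polyfun_coeffs_eqD[of "\<lambda>k. of_nat (n choose k) * a k" n "\<lambda>k. of_nat (n choose k) * b k", OF * this] this
    show "a k = b k"
      by simp
  qed
qed (auto intro: bform_cong)

text \<open>The clause on k > n in \<open>bcoeff\<close> singles out one sequence among all that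
  define the same form.\<close>

lemma bcoeff_bform: "bcoeff n (bform n a) k = (if k \<le> n then a k else 0)"
proof -
  have "bcoeff n (bform n a) = (\<lambda>k. if k \<le> n then a k else 0)"
    unfolding bcoeff_def
  proof (rule the_equality)
    fix b assume b: "bform n a = bform n b \<and> (\<forall>k>n. b k = 0)"
    show "b = (\<lambda>k. if k \<le> n then a k else 0)"
    proof
      fix k show "b k = (if k \<le> n then a k else 0)"
        using b by (auto simp: bform_eq_iff)
    qed
  qed (auto intro: bform_cong)
  then show ?thesis
    by simp
qed

lemma comp_add: "(f + g) \<circ> h = (f \<circ> h) + (g \<circ> (h :: 'a \<Rightarrow> 'b))" for f g :: "'b \<Rightarrow> complex"
  by (auto simp: fun_simps)

lemma comp_diff: "(f - g) \<circ> h = (f \<circ> h) - (g \<circ> (h :: 'a \<Rightarrow> 'b))" for f g :: "'b \<Rightarrow> complex"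
  by (auto simp: fun_simps)

lemma comp_mult: "(f * g) \<circ> h = (f \<circ> h) * (g \<circ> (h :: 'a \<Rightarrow> 'b))" for f g :: "'b \<Rightarrow> complex"
  by (auto simp: fun_simps)

lemma comp_cscale: "cscale c f \<circ> h = cscale c (f \<circ> h)"
  by (auto simp: fun_simps)

lemma comp_sum: "(\<Sum>a\<in>A. f a) \<circ> h = (\<Sum>a\<in>A. f a \<circ> h)" for f :: "'a \<Rightarrow> 'b \<Rightarrow> complex"
  by (auto simp: fun_eq_iff fun_simps)

lemma comp_0: "(0 :: 'b \<Rightarrow> complex) \<circ> h = 0"
  by (auto simp: fun_eq_iff fun_simps)

lemma homog_comp_vmap: "f \<in> homog (int d) \<Longrightarrow> f \<circ> vmap \<in> Sym (2 * d)"
proof (induction rule: homog_gen_induct)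
  case one
  have "const_fun 1 \<circ> vmap = const_fun 1"
    by (auto simp: fun_simps)
  then show "const_fun 1 \<circ> vmap \<in> Sym (2 * 0)"
    by (simp add: const_homog)
next
  case (add d f g)
  show "(f + g) \<circ> vmap \<in> Sym (2 * d)"
    unfolding comp_add by (rule homog_add[OF add(3,4)])
next
  case (cscale d c f)
  show "cscale c f \<circ> vmap \<in> Sym (2 * d)"
    unfolding comp_cscale by (rule homog_cscale[OF cscale(2)])
next
  case (step d i f)
  have s: "(coord i * f) \<circ> vmap = (coord i \<circ> vmap) * (f \<circ> vmap)"
    by (auto simp: fun_simps)
  have c: "coord 1 \<circ> vmap = coord 1 ^ 2 - coord 2 ^ 2"
    "coord 2 \<circ> vmap = cscale \<i> (coord 1 ^ 2 + coord 2 ^ 2)"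
    "coord 3 \<circ> vmap = cscale 2 (coord 1 * coord 2)"
    by (auto simp: fun_eq_iff fun_simps vmap_def power2_eq_square)
  have "coord i \<circ> vmap \<in> homog 2"
    using exhaust_3[of i] c coord_power_homog[of _ 2] homog_mult[OF coord_homog coord_homog]
    by (auto intro!: homog_add homog_diff homog_cscale)
  then have "(coord i \<circ> vmap) * (f \<circ> vmap) \<in> homog (2 + int (2 * d))"
    by (rule homog_mult[OF _ step(2)])
  then show "(coord i * f) \<circ> vmap \<in> Sym (2 * Suc d)"
    unfolding s by simp
qed

text \<open>The pullbacks of x_1 + i x_2, x_1 - i x_2 and x_3 are -2 z_1^2, 2 z_0^2 and 2 z_0 z_1.
  On the cone the product of the first two is -x_3^2, so the monomials containing at most one of
  them span; they are indexed by the exponent m of z_1 in the pullback.\<close>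

definition cone_mono :: "nat \<Rightarrow> nat \<Rightarrow> complex ^ 3 \<Rightarrow> complex" where
  "cone_mono d m = (\<lambda>x. if d \<le> m then (x $ 1 + \<i> * x $ 2) ^ (m - d) * (x $ 3) ^ (2 * d - m)
     else (x $ 1 - \<i> * x $ 2) ^ (d - m) * (x $ 3) ^ m)"

definition cone_repr :: "nat \<Rightarrow> (complex ^ 3 \<Rightarrow> complex) \<Rightarrow> bool" where
  "cone_repr d P \<longleftrightarrow> (\<exists>p c. p \<in> homog (int d - 2) \<and>
     P = qf * p + (\<Sum>m\<le>2 * d. cscale (c m) (cone_mono d m)))"

lemma cone_repr_add: "cone_repr d P \<Longrightarrow> cone_repr d Q \<Longrightarrow> cone_repr d (P + Q)"
  unfolding cone_repr_def
proof safe
  fix p p' :: "complex ^ 3 \<Rightarrow> complex" and c c' :: "nat \<Rightarrow> complex"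
  assume "p \<in> homog (int d - 2)" "p' \<in> homog (int d - 2)"
  then show "\<exists>r e. r \<in> homog (int d - 2) \<and>
      qf * p + (\<Sum>m\<le>2 * d. cscale (c m) (cone_mono d m)) +
      (qf * p' + (\<Sum>m\<le>2 * d. cscale (c' m) (cone_mono d m))) =
      qf * r + (\<Sum>m\<le>2 * d. cscale (e m) (cone_mono d m))"
    by (intro exI[of _ "p + p'"] exI[of _ "\<lambda>m. c m + c' m"])
      (auto simp: homog_add cscale_add_left sum.distrib algebra_simps)
qed

lemma cone_repr_cscale: "cone_repr d P \<Longrightarrow> cone_repr d (cscale a P)"
  unfolding cone_repr_def
proof safe
  fix p :: "complex ^ 3 \<Rightarrow> complex" and c :: "nat \<Rightarrow> complex"
  assume "p \<in> homog (int d - 2)"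
  then show "\<exists>r e. r \<in> homog (int d - 2) \<and>
      cscale a (qf * p + (\<Sum>m\<le>2 * d. cscale (c m) (cone_mono d m))) =
      qf * r + (\<Sum>m\<le>2 * d. cscale (e m) (cone_mono d m))"
    by (intro exI[of _ "cscale a p"] exI[of _ "\<lambda>m. a * c m"])
      (auto simp: homog_cscale cscale_add cscale_sum cscale_cscale cscale_mult_right)
qed

lemma cone_repr_diff: "cone_repr d P \<Longrightarrow> cone_repr d Q \<Longrightarrow> cone_repr d (P - Q)"
  by (simp add: diff_eq_cscale cone_repr_add cone_repr_cscale)

lemma cone_repr_qf: "p \<in> homog (int d - 2) \<Longrightarrow> cone_repr d (qf * p)"
  unfolding cone_repr_def by (intro exI[of _ p] exI[of _ "\<lambda>m. 0"]) simp

lemma cone_repr_0: "cone_repr d 0"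
  using cone_repr_qf[of 0 d] by simp

lemma cone_repr_mono: "m \<le> 2 * d \<Longrightarrow> cone_repr d (cone_mono d m)"
  unfolding cone_repr_def
proof (intro exI conjI)
  assume "m \<le> 2 * d"
  have "(\<Sum>k\<le>2 * d. cscale (if k = m then 1 else 0) (cone_mono d k)) =
      (\<Sum>k\<le>2 * d. if k = m then cone_mono d m else 0)"
    by (rule sum.cong) auto
  then show "cone_mono d m = qf * 0 + (\<Sum>k\<le>2 * d. cscale (if k = m then 1 else 0) (cone_mono d k))"
    using \<open>m \<le> 2 * d\<close> by simp
qed simp

text \<open>Multiples of q stay multiples of q, so only the effect of a linear form on the 2 d + 1
  normal forms has to be examined.\<close>

lemma cone_repr_mult:
  assumes "cone_repr d P" "g \<in> homog 1" "\<And>m. m \<le> 2 * d \<Longrightarrow> cone_repr (Suc d) (g * cone_mono d m)"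
  shows "cone_repr (Suc d) (g * P)"
proof -
  obtain p c where p: "p \<in> homog (int d - 2)" "P = qf * p + (\<Sum>m\<le>2 * d. cscale (c m) (cone_mono d m))"
    using assms(1) unfolding cone_repr_def by blast
  have e: "g * P = qf * (g * p) + (\<Sum>m\<le>2 * d. cscale (c m) (g * cone_mono d m))"
    unfolding p(2) by (auto simp: fun_eq_iff fun_simps algebra_simps sum_distrib_left)
  have "g * p \<in> homog (int (Suc d) - 2)"
    using homog_mult[OF assms(2) p(1)] by (simp add: algebra_simps)
  moreover have "cone_repr (Suc d) (\<Sum>m\<le>2 * d. cscale (c m) (g * cone_mono d m))"
    by (rule sum_induct[where Q = "cone_repr (Suc d)"])
      (auto intro: cone_repr_add cone_repr_cscale cone_repr_0 assms(3))
  ultimately show ?thesis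
    unfolding e by (blast intro: cone_repr_add cone_repr_qf)
qed

lemma qf_factor: "(x $ 1 + \<i> * x $ 2) * (x $ 1 - \<i> * x $ 2) = qf x - (x $ 3)\<^sup>2"
proof -
  have "(u + \<i> * v) * (u - \<i> * v) = u * u + v * v" for u v
    by (simp add: algebra_simps)
  then show ?thesis
    by (simp add: qf_def power2_eq_square)
qed

text \<open>The factors x_1 + i x_2, x_1 - i x_2 and x_3 raise the index by 2, 0 and 1, the
  exponents of z_1 in their pullbacks. A multiple of q is split off only when both isotropic factors
  meet.\<close>

lemma cone_mono_times_plus:
  assumes "m \<le> 2 * d"
  shows "cone_repr (Suc d) ((coord 1 + cscale \<i> (coord 2)) * cone_mono d m)"
proof (cases "d \<le> m")
  case True
  then have "(coord 1 + cscale \<i> (coord 2)) * cone_mono d m = cone_mono (Suc d) (m + 2)"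
    by (auto simp: fun_eq_iff fun_simps cone_mono_def Suc_diff_le)
  then show ?thesis
    using assms by (simp add: cone_repr_mono)
next
  case False
  define e where "e = d - m - 1"
  have d: "d = m + Suc e"
    using False by (simp add: e_def)
  let ?p = "(coord 1 - cscale \<i> (coord 2)) ^ e * coord 3 ^ m"
  have "(coord 1 + cscale \<i> (coord 2)) * cone_mono d m = qf * ?p - cone_mono (Suc d) (m + 2)"
  proof
    fix x :: "complex ^ 3"
    have "((coord 1 + cscale \<i> (coord 2)) * cone_mono d m) x =
        ((x $ 1 + \<i> * x $ 2) * (x $ 1 - \<i> * x $ 2)) * ((x $ 1 - \<i> * x $ 2) ^ e * (x $ 3) ^ m)"
      by (simp add: fun_simps cone_mono_def d mult_ac)
    also have "\<dots> = (qf * ?p) x - (x $ 1 - \<i> * x $ 2) ^ e * (x $ 3) ^ (m + 2)"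
      unfolding qf_factor by (simp add: fun_simps power_fun_apply power2_eq_square algebra_simps)
    \<comment> \<open>If e = 0, the index m + 2 equals \<open>Suc d\<close> and the other branch of
      \<open>cone_mono\<close> applies; the branches agree there because the first power is
      trivial.\<close>
    also have "(x $ 1 - \<i> * x $ 2) ^ e * (x $ 3) ^ (m + 2) = cone_mono (Suc d) (m + 2) x"
      by (cases e) (auto simp: cone_mono_def d)
    finally show "((coord 1 + cscale \<i> (coord 2)) * cone_mono d m) x =
        (qf * ?p - cone_mono (Suc d) (m + 2)) x"
      unfolding minus_apply[of "qf * ?p"] .
  qed
  moreover have "?p \<in> homog (int (Suc d) - 2)"
    using homog_mult[OF homog_power[OF homog_diff[OF coord_homog homog_cscale[OF coord_homog]]] coord_power_homog,
      of 1 \<i> 2 e 3 m] by (simp add: d add.commute)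
  ultimately show ?thesis
    using False by (auto intro!: cone_repr_diff cone_repr_qf cone_repr_mono)
qed

lemma cone_mono_times_minus:
  assumes "m \<le> 2 * d"
  shows "cone_repr (Suc d) ((coord 1 - cscale \<i> (coord 2)) * cone_mono d m)"
proof (cases "m \<le> d")
  case True
  then have "(coord 1 - cscale \<i> (coord 2)) * cone_mono d m = cone_mono (Suc d) m"
    by (auto simp: fun_eq_iff fun_simps cone_mono_def Suc_diff_le)
  then show ?thesis
    using assms by (simp add: cone_repr_mono)
next
  case False
  define e where "e = m - d - 1"
  define j where "j = 2 * d - m"
  have d: "m = d + Suc e" "2 * d - m = j" "2 * Suc d - m = j + 2" "d = Suc (e + j)"
    using False assms by (auto simp: e_def j_def)
  let ?p = "(coord 1 + cscale \<i> (coord 2)) ^ e * coord 3 ^ j"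
  have "(coord 1 - cscale \<i> (coord 2)) * cone_mono d m = qf * ?p - cone_mono (Suc d) m"
  proof
    fix x :: "complex ^ 3"
    have "((coord 1 - cscale \<i> (coord 2)) * cone_mono d m) x =
        ((x $ 1 + \<i> * x $ 2) * (x $ 1 - \<i> * x $ 2)) * ((x $ 1 + \<i> * x $ 2) ^ e * (x $ 3) ^ j)"
      unfolding cone_mono_def fun_simps d(2) by (simp add: d(1) mult_ac)
    also have "\<dots> = (qf * ?p) x - (x $ 1 + \<i> * x $ 2) ^ e * (x $ 3) ^ (j + 2)"
      unfolding qf_factor by (simp add: fun_simps power_fun_apply power2_eq_square algebra_simps)
    also have "(x $ 1 + \<i> * x $ 2) ^ e * (x $ 3) ^ (j + 2) = cone_mono (Suc d) m x"
      unfolding cone_mono_def d(3) by (simp add: d(1))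
    finally show "((coord 1 - cscale \<i> (coord 2)) * cone_mono d m) x =
        (qf * ?p - cone_mono (Suc d) m) x"
      unfolding minus_apply[of "qf * ?p"] .
  qed
  moreover have "?p \<in> homog (int (Suc d) - 2)"
    using homog_mult[OF homog_power[OF homog_add[OF coord_homog homog_cscale[OF coord_homog]]] coord_power_homog,
      of 1 \<i> 2 e 3 j] by (simp add: d(4))
  ultimately show ?thesis
    using assms by (auto intro!: cone_repr_diff cone_repr_qf cone_repr_mono)
qed

lemma cone_mono_times_third:
  assumes "m \<le> 2 * d"
  shows "cone_repr (Suc d) (coord 3 * cone_mono d m)"
proof -
  have "coord 3 * cone_mono d m = cone_mono (Suc d) (Suc m)"
    using assms by (auto simp: fun_eq_iff fun_simps cone_mono_def Suc_diff_le)
  then show ?thesis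
    using assms by (simp add: cone_repr_mono)
qed

lemma homog_cone_repr:
  assumes "P \<in> homog (int d)"
  shows "cone_repr d P"
  using assms
proof (induction rule: homog_gen_induct)
  case one
  have "const_fun 1 = cone_mono 0 0"
    by (auto simp: fun_eq_iff fun_simps cone_mono_def)
  then show ?case
    using cone_repr_mono[of 0 0] by simp
next
  case (step d i f)
  let ?a = "coord 1 + cscale \<i> (coord 2)" and ?b = "coord 1 - cscale \<i> (coord 2)"
  have a: "cone_repr (Suc d) (?a * f)"
    by (rule cone_repr_mult[OF step(2)]) (auto intro: cone_mono_times_plus homog_add homog_cscale coord_homog)
  have b: "cone_repr (Suc d) (?b * f)"
    by (rule cone_repr_mult[OF step(2)]) (auto intro: cone_mono_times_minus homog_diff homog_cscale coord_homog)
  have 3: "cone_repr (Suc d) (coord 3 * f)"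
    by (rule cone_repr_mult[OF step(2)]) (auto intro: cone_mono_times_third coord_homog)
  \<comment> \<open>Together with x_3 the isotropic coordinates are a basis of the linear forms, so
    x_1 and x_2 are recovered from them.\<close>
  have 1: "coord 1 * f = cscale (1 / 2) (?a * f + ?b * f)"
    by (auto simp: fun_eq_iff fun_simps algebra_simps)
  have 2: "coord 2 * f = cscale (- \<i> / 2) (?a * f - ?b * f)"
    by (auto simp: fun_eq_iff fun_simps algebra_simps)
  show ?case
    using exhaust_3[of i] a b 3 unfolding 1 2
    by (metis 1 2 cone_repr_add cone_repr_diff cone_repr_cscale)
qed (auto intro: cone_repr_add cone_repr_cscale)

lemma cone_mono_vmap:
  assumes "m \<le> 2 * d"
  obtains c where "c \<noteq> 0" "cone_mono d m \<circ> vmap = cscale c (bmono (2 * d) m)"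
proof (cases "d \<le> m")
  case True
  define e where "e = m - d"
  define j where "j = 2 * d - m"
  have d: "m - d = e" "2 * d - m = j" "m = 2 * e + j"
    using True assms by (auto simp: e_def j_def)
  have "cone_mono d m (vmap z) = (- 2) ^ e * 2 ^ j * bmono (2 * d) m z" for z
  proof -
    have "cone_mono d m (vmap z) = (- 2 * (z $ 2)\<^sup>2) ^ e * (2 * z $ 1 * z $ 2) ^ j"
      using True unfolding cone_mono_def d(1,2) by (simp add: vmap_def algebra_simps)
    also have "\<dots> = (- 2) ^ e * 2 ^ j * bmono (2 * d) m z"
      unfolding bmono_def d(2) unfolding d(3) power_mult_distrib power_add power_mult by (simp add: mult_ac)
    finally show ?thesis .
  qed
  then show ?thesis
    by (intro that[of "(- 2) ^ e * 2 ^ j"]) (auto simp: fun_eq_iff fun_simps)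
next
  case False
  define e where "e = d - m"
  have d: "d - m = e" "2 * d - m = 2 * e + m"
    using False assms by (auto simp: e_def)
  have "cone_mono d m (vmap z) = 2 ^ e * 2 ^ m * bmono (2 * d) m z" for z
  proof -
    have "cone_mono d m (vmap z) = (2 * (z $ 1)\<^sup>2) ^ e * (2 * z $ 1 * z $ 2) ^ m"
      using False unfolding cone_mono_def d by (simp add: vmap_def algebra_simps)
    also have "\<dots> = 2 ^ e * 2 ^ m * bmono (2 * d) m z"
      unfolding bmono_def d power_mult_distrib power_add power_mult by (simp add: mult_ac)
    finally show ?thesis .
  qed
  then show ?thesis
    by (intro that[of "2 ^ e * 2 ^ m"]) (auto simp: fun_eq_iff fun_simps)
qed

lemma qf_comp_vmap: "qf \<circ> vmap = 0"
  by (auto simp: fun_eq_iff fun_simps qf_vmap)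

text \<open>q pulls back to 0 and the normal forms pull back to nonzero multiples of distinct
  monomials, so a polynomial vanishing on the cone has no normal form part.\<close>

lemma comp_vmap_kernel:
  assumes "P \<in> homog (int d)" "P \<circ> vmap = 0"
  obtains p where "p \<in> homog (int d - 2)" "P = qf * p"
proof -
  obtain p c where p: "p \<in> homog (int d - 2)" and P: "P = qf * p + (\<Sum>m\<le>2 * d. cscale (c m) (cone_mono d m))"
    using homog_cone_repr[OF assms(1)] unfolding cone_repr_def by blast
  have "\<forall>m. \<exists>e. m \<le> 2 * d \<longrightarrow> e \<noteq> 0 \<and> cone_mono d m \<circ> vmap = cscale e (bmono (2 * d) m)"
    using cone_mono_vmap by metis
  then obtain e where e: "\<And>m. m \<le> 2 * d \<Longrightarrow> e m \<noteq> 0"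
      "\<And>m. m \<le> 2 * d \<Longrightarrow> cone_mono d m \<circ> vmap = cscale (e m) (bmono (2 * d) m)"
    by metis
  have "0 = (\<Sum>m\<le>2 * d. cscale (c m) (cone_mono d m \<circ> vmap))"
    using assms(2) unfolding P comp_add comp_mult comp_sum comp_cscale qf_comp_vmap by simp
  also have "\<dots> = (\<Sum>m\<le>2 * d. cscale (c m * e m) (bmono (2 * d) m))"
    by (intro sum.cong refl) (simp add: e(2) cscale_cscale)
  finally have "bform (2 * d) (\<lambda>k. 0) = bform (2 * d) (\<lambda>m. c m * e m / of_nat ((2 * d) choose m))"
    by (simp only: bform_0 sum_bmono_eq_bform)
  then have "\<forall>m\<le>2 * d. c m = 0"
    unfolding bform_eq_iff using e(1) by auto
  then have "P = qf * p"
    unfolding P by simp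
  with p that show ?thesis
    by blast
qed

lemma harmonic_comp_vmap_eq_0:
  assumes "f \<in> harmC l" "f \<circ> vmap = 0"
  shows "f = 0"
proof -
  obtain p where "p \<in> homog (int l - 2)" "f = qf * p"
    using comp_vmap_kernel[OF harmC_homog[OF assms(1)] assms(2)] by blast
  then show ?thesis
    using harmonic_qf_zero[OF assms(1)] by blast
qed

section \<open>Psi as a linear isomorphism\<close>

lemma Psi_apply: "f \<in> harmC l \<Longrightarrow> Psi l f = f \<circ> vmap"
  by (simp add: Psi_def)

lemma Psi_harm_basis:
  assumes "k \<le> 2 * l"
  shows "harm_basis l k \<circ> vmap =
    cscale ((- 2) ^ l * of_nat ((2 * l) choose k) * (- 1) ^ k) (bmono (2 * l) (2 * l - k))"
  using harm_basis_vmap[OF assms] assms by (auto simp: fun_eq_iff fun_simps bmono_def mult_ac)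

text \<open>The harmonic polynomial that \<^const>\<open>Psi\<close> maps to \<open>bmono (2 * l) k\<close>.\<close>

definition harm_mono :: "nat \<Rightarrow> nat \<Rightarrow> complex ^ 3 \<Rightarrow> complex" where
  "harm_mono l k = cscale (1 / ((- 2) ^ l * of_nat ((2 * l) choose k) * (- 1) ^ k)) (harm_basis l (2 * l - k))"

lemma harm_mono_harmonic: "harm_mono l k \<in> harmC l"
  unfolding harm_mono_def by (intro harmC_cscale harm_basis_harmonic)

lemma harm_mono_vmap:
  assumes "k \<le> 2 * l"
  shows "harm_mono l k \<circ> vmap = bmono (2 * l) k"
proof -
  have "(- 1 :: complex) ^ (2 * l - k) = (- 1) ^ k"
    using assms by (simp add: uminus_power_if)
  then show ?thesis
    unfolding harm_mono_def comp_cscale Psi_harm_basis[OF diff_le_self] cscale_cscale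
    using assms by (simp add: binomial_symmetric[OF assms])
qed

lemma Psi_linear: "clinear_on (harmC l) (Sym (2 * l)) (Psi l)"
  unfolding clinear_on_def
  by (auto simp: Psi_apply homog_comp_vmap harmC_homog harmC_add harmC_cscale comp_add comp_cscale
    simp del: of_nat_mult)

lemma Psi_inj: "inj_on (Psi l) (harmC l)"
proof
  fix f g assume fg: "f \<in> harmC l" "g \<in> harmC l" "Psi l f = Psi l g"
  then have "(f - g) \<circ> vmap = 0"
    by (simp add: Psi_apply comp_diff)
  then have "f - g = 0"
    by (rule harmonic_comp_vmap_eq_0[OF harmC_diff[OF fg(1,2)]])
  then show "f = g"
    by simp
qed

text \<open>Both sides are harmonic and agree on the cone. The binomial turns the weighted
  coefficients of \<open>bform\<close> into plain monomial coefficients.\<close>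

lemma harm_expansion:
  assumes "f \<in> harmC l" "f \<circ> vmap = bform (2 * l) a"
  shows "f = (\<Sum>k\<le>2 * l. cscale (of_nat ((2 * l) choose k) * a k) (harm_mono l k))"
    (is "_ = ?g")
proof -
  have g: "?g \<in> harmC l"
    by (intro harmC_sum harmC_cscale harm_mono_harmonic)
  have "?g \<circ> vmap = bform (2 * l) a"
    unfolding comp_sum comp_cscale bform_eq_sum
    by (intro sum.cong refl) (simp add: harm_mono_vmap)
  then have "Psi l f = Psi l ?g"
    using assms g by (simp add: Psi_apply)
  then show ?thesis
    using Psi_inj assms(1) g by (auto dest: inj_onD)
qed

lemma Psi_surj: "Psi l ` harmC l = Sym (2 * l)"
proof
  show "Psi l ` harmC l \<subseteq> Sym (2 * l)"
    using homog_comp_vmap harmC_homog by (auto simp: Psi_apply)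
  show "Sym (2 * l) \<subseteq> Psi l ` harmC l"
  proof
    fix F assume "F \<in> Sym (2 * l)"
    then obtain a where F: "F = bform (2 * l) a"
      by (rule Sym_bform)
    let ?g = "\<Sum>k\<le>2 * l. cscale (of_nat ((2 * l) choose k) * a k) (harm_mono l k)"
    have g: "?g \<in> harmC l"
      by (intro harmC_sum harmC_cscale harm_mono_harmonic)
    have "?g \<circ> vmap = F"
      unfolding F comp_sum comp_cscale bform_eq_sum
      by (intro sum.cong refl) (simp add: harm_mono_vmap)
    then show "F \<in> Psi l ` harmC l"
      using g by (auto simp: Psi_apply intro!: image_eqI[of _ _ ?g])
  qed
qed

lemma Psi_iso: "clinear_iso (harmC l) (Sym (2 * l)) (Psi l)"
  unfolding clinear_iso_def bij_betw_def using Psi_linear Psi_inj Psi_surj by blast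

lemma comp_vmap_image: "(\<lambda>P. P \<circ> vmap) ` homog (int l) = Sym (2 * l)"
proof
  show "(\<lambda>P. P \<circ> vmap) ` homog (int l) \<subseteq> Sym (2 * l)"
    using homog_comp_vmap by blast
  have "Sym (2 * l) = (\<lambda>P. P \<circ> vmap) ` harmC l"
    unfolding Psi_surj[symmetric] by (rule image_cong) (auto simp: Psi_apply)
  then show "Sym (2 * l) \<subseteq> (\<lambda>P. P \<circ> vmap) ` homog (int l)"
    using harmC_homog by blast
qed

lemma comp_vmap_kernel_eq:
  "{P \<in> homog (int l). P \<circ> vmap = 0} = (\<lambda>p. qf * p) ` homog (int l - 2)"
proof safe
  fix P assume "P \<in> homog (int l)" "P \<circ> vmap = 0"
  then show "P \<in> (\<lambda>p. qf * p) ` homog (int l - 2)"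
    by (rule comp_vmap_kernel) blast
next
  fix p :: "complex ^ 3 \<Rightarrow> complex" assume p: "p \<in> homog (int l - 2)"
  show "qf * p \<in> homog (int l)"
    using homog_mult[OF qf_homog p] by simp
  show "qf * p \<circ> vmap = 0"
    by (simp add: comp_mult qf_comp_vmap)
qed

lemma is_harm_part_comp_vmap: "is_harm_part l P h \<Longrightarrow> h \<circ> vmap = P \<circ> vmap"
proof -
  assume "is_harm_part l P h"
  then obtain p where "P - h = qf * p"
    unfolding is_harm_part_def by blast
  then have "(P \<circ> vmap) - (h \<circ> vmap) = 0"
    by (simp add: comp_mult qf_comp_vmap flip: comp_diff)
  then show ?thesis
    by simp
qed

lemma harm_part_props:
  assumes "P \<in> homog (int l)"
  shows "\<exists>!h. is_harm_part l P h" "harm_part l P \<in> harmC l" "harm_part l P \<circ> vmap = P \<circ> vmap"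
    "inv_into (harmC l) (Psi l) (P \<circ> vmap) = harm_part l P"
proof -
  have h: "is_harm_part l P (harm_part l P)"
    unfolding harm_part_eq_harm_proj[OF assms] by (rule harm_proj_is_harm_part[OF assms])
  then show "\<exists>!h. is_harm_part l P h"
    using is_harm_part_unique by blast
  show H: "harm_part l P \<in> harmC l"
    using h by (simp add: is_harm_part_def)
  show v: "harm_part l P \<circ> vmap = P \<circ> vmap"
    by (rule is_harm_part_comp_vmap[OF h])
  show "inv_into (harmC l) (Psi l) (P \<circ> vmap) = harm_part l P"
    using inv_into_f_f[OF Psi_inj H] by (simp add: Psi_apply[OF H] v)
qed

text \<open>A polynomial and its harmonic part agree on the null cone, and composition with v is
  multiplicative.\<close>

lemma Psi_mult:
  assumes "f \<in> harmC l" "g \<in> harmC m"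
  shows "Psi (l + m) (harm_part (l + m) (f * g)) = Psi l f * Psi m g"
proof -
  have "f * g \<in> homog (int (l + m))"
    using homog_mult[OF harmC_homog[OF assms(1)] harmC_homog[OF assms(2)]] by simp
  from harm_part_props(2,3)[OF this] show ?thesis
    using assms by (simp add: Psi_apply comp_mult)
qed

section \<open>The homomorphism from SL(2) to SO(3)\<close>

text \<open>Obtained by expanding v(g z) and replacing z_0^2, z_1^2 and z_0 z_1 by (v_1 - i v_2) /
  2, -(v_1 + i v_2) / 2 and v_3 / 2.\<close>

definition rho_mat :: "complex ^ 2 ^ 2 \<Rightarrow> complex ^ 3 ^ 3" where
  "rho_mat g = (let a = g $ 1 $ 1; b = g $ 1 $ 2; c = g $ 2 $ 1; d = g $ 2 $ 2 in
    vector [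
      vector [(a\<^sup>2 - c\<^sup>2 - b\<^sup>2 + d\<^sup>2) / 2, - \<i> * (a\<^sup>2 - c\<^sup>2 + b\<^sup>2 - d\<^sup>2) / 2, a * b - c * d],
      vector [\<i> * (a\<^sup>2 + c\<^sup>2 - b\<^sup>2 - d\<^sup>2) / 2, (a\<^sup>2 + c\<^sup>2 + b\<^sup>2 + d\<^sup>2) / 2, \<i> * (a * b + c * d)],
      vector [a * c - b * d, - \<i> * (a * c + b * d), a * d + b * c]])"

lemma matvec_2: "((A :: complex ^ 2 ^ 2) *v x) $ i = A $ i $ 1 * x $ 1 + A $ i $ 2 * x $ 2"
  by (simp add: matrix_vector_mult_def sum_2)

lemma matvec_3:
  "((A :: complex ^ 3 ^ 3) *v x) $ i = A $ i $ 1 * x $ 1 + A $ i $ 2 * x $ 2 + A $ i $ 3 * x $ 3"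
  by (simp add: matrix_vector_mult_def sum_3)

lemma matmul_2: "((A :: complex ^ 2 ^ 2) ** B) $ i $ j = A $ i $ 1 * B $ 1 $ j + A $ i $ 2 * B $ 2 $ j"
  by (simp add: matrix_matrix_mult_def sum_2)

lemma vmap_nth: "vmap z $ 1 = (z $ 1)\<^sup>2 - (z $ 2)\<^sup>2" "vmap z $ 2 = \<i> * ((z $ 1)\<^sup>2 + (z $ 2)\<^sup>2)"
    "vmap z $ 3 = 2 * z $ 1 * z $ 2"
  by (simp_all add: vmap_def)

lemma is_rho_rho_mat: "is_rho g (rho_mat g)"
proof -
  have "\<i> * (\<i> * u) = - u" for u
    by (simp add: complex_eq_iff)
  then show ?thesis
    unfolding is_rho_def
    by (simp add: vec_eq_iff forall_3 matvec_3 matvec_2 vmap_nth rho_mat_def Let_def)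
      (simp add: power2_eq_square algebra_simps add_divide_distrib diff_divide_distrib)
qed

text \<open>The vectors v(1, 0), v(0, 1) and v(1, 1) form a basis. Uniqueness and multiplicativity
  of rho follow from this.\<close>

lemma vmap_spans:
  fixes A B :: "complex ^ 3 ^ 3"
  assumes "\<And>z. A *v vmap z = B *v vmap z"
  shows "A = B"
proof -
  have "A $ i $ j = B $ i $ j" for i j
  proof -
    have e: "(A *v vmap z) $ i = (B *v vmap z) $ i" for z
      using assms by simp
    have 1: "A $ i $ 1 + A $ i $ 2 * \<i> = B $ i $ 1 + B $ i $ 2 * \<i>"
      using e[of "vector [1, 0]"] by (simp add: matvec_3 vmap_nth)
    have 2: "- A $ i $ 1 + A $ i $ 2 * \<i> = - B $ i $ 1 + B $ i $ 2 * \<i>"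
      using e[of "vector [0, 1]"] by (simp add: matvec_3 vmap_nth)
    have 3: "A $ i $ 2 * (\<i> * 2) + A $ i $ 3 * 2 = B $ i $ 2 * (\<i> * 2) + B $ i $ 3 * 2"
      using e[of "vector [1, 1]"] by (simp add: matvec_3 vmap_nth)
    have "2 * (A $ i $ 1) = (A $ i $ 1 + A $ i $ 2 * \<i>) - (- A $ i $ 1 + A $ i $ 2 * \<i>)"
      by simp
    also have "\<dots> = 2 * (B $ i $ 1)"
      unfolding 1 2 by simp
    finally have a1: "A $ i $ 1 = B $ i $ 1"
      by simp
    then have a2: "A $ i $ 2 = B $ i $ 2"
      using 1 by simp
    then have "A $ i $ 3 = B $ i $ 3"
      using 3 by simp
    with a1 a2 show ?thesis
      using exhaust_3[of j] by auto
  qed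
  then show ?thesis
    by (simp add: vec_eq_iff)
qed

lemma is_rho_unique: "is_rho g A \<Longrightarrow> is_rho g B \<Longrightarrow> A = B"
  unfolding is_rho_def by (rule vmap_spans) simp

lemma rho_eq: "rho g = rho_mat g"
  unfolding rho_def using is_rho_rho_mat is_rho_unique by (blast intro: the_equality)

lemma vmap_matvec: "vmap (g *v z) = rho g *v vmap z"
  using is_rho_rho_mat[of g] by (simp add: is_rho_def rho_eq)

lemma rho_mult: "rho (g ** h) = rho g ** rho h"
  by (rule vmap_spans) (simp add: vmap_matvec[symmetric] matrix_vector_mul_assoc[symmetric])

lemma rho_one: "rho (mat 1) = mat 1"
  by (rule vmap_spans) (simp flip: vmap_matvec)

text \<open>Encode x as the symmetric matrix S with rows (p, x_3) and (x_3, -m). Then q(x) = - det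
  S, and rho(g) acts as S -> g S g^T, which multiplies the determinant by (det g)^2. The diagonal
  entries of g S g^T are 2 A and 2 C.\<close>

lemma qf_rho: "qf (rho g *v x) = (det g)\<^sup>2 * qf x"
proof -
  define a b c d where "a = g $ 1 $ 1" and "b = g $ 1 $ 2" and "c = g $ 2 $ 1" and "d = g $ 2 $ 2"
  define p m where "p = x $ 1 - \<i> * x $ 2" and "m = x $ 1 + \<i> * x $ 2"
  define A C where "A = (a\<^sup>2 * p + 2 * a * b * x $ 3 - b\<^sup>2 * m) / 2"
    and "C = (c\<^sup>2 * p + 2 * c * d * x $ 3 - d\<^sup>2 * m) / 2"
  note defs = a_def[symmetric] b_def[symmetric] c_def[symmetric] d_def[symmetric]
  have ii: "\<i> * (\<i> * u) = - u" for u
    by (simp add: complex_eq_iff)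
  have 1: "(rho g *v x) $ 1 = A - C"
    unfolding A_def C_def p_def m_def
    by (simp add: rho_eq rho_mat_def Let_def matvec_3 defs)
      (simp add: field_simps)
  have 2: "(rho g *v x) $ 2 = \<i> * (A + C)"
    unfolding A_def C_def p_def m_def
    by (simp add: rho_eq rho_mat_def Let_def matvec_3 defs)
      (simp add: field_simps ii)
  have 3: "(rho g *v x) $ 3 = a * c * p + (a * d + b * c) * x $ 3 - b * d * m"
    unfolding p_def m_def
    by (simp add: rho_eq rho_mat_def Let_def matvec_3 defs)
      (simp add: field_simps)
  have pm: "p * m = (x $ 1)\<^sup>2 + (x $ 2)\<^sup>2"
    unfolding p_def m_def by (simp add: power2_eq_square algebra_simps ii)
  have "qf (rho g *v x) = (a * c * p + (a * d + b * c) * x $ 3 - b * d * m)\<^sup>2 - (2 * A) * (2 * C)"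
    unfolding qf_def 1 2 3 by (simp add: power_mult_distrib) (simp add: power2_eq_square algebra_simps)
  also have "2 * A = a\<^sup>2 * p + 2 * a * b * x $ 3 - b\<^sup>2 * m"
    by (simp add: A_def)
  also have "2 * C = c\<^sup>2 * p + 2 * c * d * x $ 3 - d\<^sup>2 * m"
    by (simp add: C_def)
  also have "(a * c * p + (a * d + b * c) * x $ 3 - b * d * m)\<^sup>2 -
      (a\<^sup>2 * p + 2 * a * b * x $ 3 - b\<^sup>2 * m) * (c\<^sup>2 * p + 2 * c * d * x $ 3 - d\<^sup>2 * m) =
      (a * d - b * c)\<^sup>2 * (p * m + (x $ 3)\<^sup>2)"
    by (simp add: power2_eq_square field_simps)
  also have "\<dots> = (det g)\<^sup>2 * qf x"
    unfolding pm by (simp add: det_2 qf_def defs)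
  finally show ?thesis .
qed

lemma det_rho: "det (rho g) = det g ^ 3"
proof -
  define a b c d where "a = g $ 1 $ 1" and "b = g $ 1 $ 2" and "c = g $ 2 $ 1" and "d = g $ 2 $ 2"
  note defs = a_def[symmetric] b_def[symmetric] c_def[symmetric] d_def[symmetric]
  \<comment> \<open>The entries are kept as variables while the halves and the factors i are
    cleared; what remains is a polynomial identity in a, b, c, d.\<close>
  have det: "x1 / 2 * (x2 / 2) * x3 + (- \<i> * y1 / 2) * (\<i> * y2) * y3 + z1 * (\<i> * z2 / 2) * (- \<i> * z3)
      - x1 / 2 * (\<i> * y2) * (- \<i> * z3) - (- \<i> * y1 / 2) * (\<i> * z2 / 2) * x3 - z1 * (x2 / 2) * y3
      = (x1 * x2 * x3 + 2 * y1 * y2 * y3 + 2 * z1 * z2 * z3 - 2 * x1 * y2 * z3 - y1 * z2 * x3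
        - 2 * z1 * x2 * y3) / 4"
    for x1 x2 x3 y1 y2 y3 z1 z2 z3 :: complex
  proof -
    have ii: "\<i> * (\<i> * u) = - u" for u
      by (simp add: complex_eq_iff)
    show ?thesis
      by (simp add: field_simps ii)
  qed
  have "det (rho g) = ((a\<^sup>2 - c\<^sup>2 - b\<^sup>2 + d\<^sup>2) * (a\<^sup>2 + c\<^sup>2 + b\<^sup>2 + d\<^sup>2) * (a * d + b * c)
      + 2 * (a\<^sup>2 - c\<^sup>2 + b\<^sup>2 - d\<^sup>2) * (a * b + c * d) * (a * c - b * d)
      + 2 * (a * b - c * d) * (a\<^sup>2 + c\<^sup>2 - b\<^sup>2 - d\<^sup>2) * (a * c + b * d)
      - 2 * (a\<^sup>2 - c\<^sup>2 - b\<^sup>2 + d\<^sup>2) * (a * b + c * d) * (a * c + b * d)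
      - (a\<^sup>2 - c\<^sup>2 + b\<^sup>2 - d\<^sup>2) * (a\<^sup>2 + c\<^sup>2 - b\<^sup>2 - d\<^sup>2) * (a * d + b * c)
      - 2 * (a * b - c * d) * (a\<^sup>2 + c\<^sup>2 + b\<^sup>2 + d\<^sup>2) * (a * c - b * d)) / 4"
    unfolding det_3 rho_eq rho_mat_def Let_def vector_3 defs by (rule det)
  also have "\<dots> = 4 * ((a * d - b * c) * (a * d - b * c) * (a * d - b * c)) / 4"
    by (rule arg_cong[where f = "\<lambda>t. t / 4"]) (simp add: power2_eq_square field_simps)
  also have "\<dots> = det g ^ 3"
    by (simp add: det_2 defs power3_eq_cube)
  finally show ?thesis .
qed

lemma SL2_iff: "g \<in> SL2 \<longleftrightarrow> g $ 1 $ 1 * g $ 2 $ 2 - g $ 1 $ 2 * g $ 2 $ 1 = 1"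
  by (simp add: SL2_def det_2)

lemma rho_SO3C: "g \<in> SL2 \<Longrightarrow> rho g \<in> SO3C"
  by (simp add: SO3C_def SL2_def det_rho qf_rho)

text \<open>The first two entries give both squares, hence each coordinate up to its own sign; the
  product in the third entry ties the two signs together.\<close>

lemma vmap_eq_imp:
  assumes "vmap z = vmap w"
  shows "z = w \<or> z = - w"
proof -
  have 1: "(z $ 1)\<^sup>2 - (z $ 2)\<^sup>2 = (w $ 1)\<^sup>2 - (w $ 2)\<^sup>2"
    and 2: "(z $ 1)\<^sup>2 + (z $ 2)\<^sup>2 = (w $ 1)\<^sup>2 + (w $ 2)\<^sup>2"
    and 3: "z $ 1 * z $ 2 = w $ 1 * w $ 2"
    using arg_cong[OF assms, of "\<lambda>x. x $ 1"] arg_cong[OF assms, of "\<lambda>x. x $ 2"]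
      arg_cong[OF assms, of "\<lambda>x. x $ 3"] by (simp_all add: vmap_nth)
  have "2 * (z $ 1)\<^sup>2 = ((z $ 1)\<^sup>2 + (z $ 2)\<^sup>2) + ((z $ 1)\<^sup>2 - (z $ 2)\<^sup>2)"
    by simp
  also have "\<dots> = 2 * (w $ 1)\<^sup>2"
    unfolding 1 2 by simp
  finally have "(z $ 1)\<^sup>2 = (w $ 1)\<^sup>2"
    by simp
  moreover from this have "(z $ 2)\<^sup>2 = (w $ 2)\<^sup>2"
    using 2 by simp
  ultimately have 4: "z $ 1 = w $ 1 \<or> z $ 1 = - w $ 1" "z $ 2 = w $ 2 \<or> z $ 2 = - w $ 2"
    by (simp_all add: power2_eq_iff)
  then have "(z $ 1 = w $ 1 \<and> z $ 2 = w $ 2) \<or> (z $ 1 = - w $ 1 \<and> z $ 2 = - w $ 2)"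
    using 3 by (auto simp: eq_neg_iff_add_eq_0)
  then show ?thesis
    by (auto simp: vec_eq_iff forall_2)
qed

definition adj2 :: "complex ^ 2 ^ 2 \<Rightarrow> complex ^ 2 ^ 2" where
  "adj2 g = vector [vector [g $ 2 $ 2, - g $ 1 $ 2], vector [- g $ 2 $ 1, g $ 1 $ 1]]"

lemma adj2_SL2: "g \<in> SL2 \<Longrightarrow> adj2 g \<in> SL2"
  by (simp add: SL2_iff adj2_def algebra_simps)

lemma mat_2: "(mat 1 :: complex ^ 2 ^ 2) $ i $ j = (if i = j then 1 else 0)"
  by (simp add: mat_def)

lemma adj2_mult:
  assumes "g \<in> SL2"
  shows "g ** adj2 g = mat 1" "adj2 g ** g = mat 1"
  using assms
  by (simp_all add: vec_eq_iff forall_2 matmul_2 mat_2 adj2_def SL2_iff algebra_simps)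

lemma matrix_inv_unique_eq:
  fixes A :: "'a :: field ^ 'n ^ 'n"
  assumes "A ** B = mat 1"
  shows "matrix_inv A = B"
proof -
  have "B ** A = mat 1"
    using assms matrix_left_right_inverse by blast
  then have "matrix_inv A ** A = mat 1"
    unfolding matrix_inv_def
    using someI[of "\<lambda>C. A ** C = mat 1 \<and> C ** A = mat 1" B] assms by simp
  then have "matrix_inv A ** (A ** B) = B"
    by (simp add: matrix_mul_assoc)
  then show ?thesis
    by (simp add: assms)
qed

lemma matrix_inv_SL2: "g \<in> SL2 \<Longrightarrow> matrix_inv g = adj2 g"
  by (rule matrix_inv_unique_eq) (rule adj2_mult)

lemma matrix_inv_rho: "g \<in> SL2 \<Longrightarrow> matrix_inv (rho g) = rho (adj2 g)"
  by (rule matrix_inv_unique_eq) (simp add: adj2_mult rho_one flip: rho_mult)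

text \<open>Each standard basis vector is fixed up to a sign, because its image under v does not
  change; the determinant makes the two signs equal.\<close>

lemma rho_kernel:
  assumes "g \<in> SL2" "rho g = mat 1"
  shows "g = mat 1 \<or> g = - mat 1"
proof -
  have v: "vmap (g *v z) = vmap z" for z
    by (simp add: vmap_matvec assms)
  have 1: "g *v vector [1, 0] = vector [1, 0] \<or> g *v vector [1, 0] = - vector [1, 0]"
    and 2: "g *v vector [0, 1] = vector [0, 1] \<or> g *v vector [0, 1] = - vector [0, 1]"
    by (rule vmap_eq_imp[OF v])+
  have "(g $ 1 $ 1 = 1 \<or> g $ 1 $ 1 = - 1) \<and> g $ 2 $ 1 = 0"
    using 1 by (auto simp: vec_eq_iff forall_2 matvec_2)
  moreover have "(g $ 2 $ 2 = 1 \<or> g $ 2 $ 2 = - 1) \<and> g $ 1 $ 2 = 0"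
    using 2 by (auto simp: vec_eq_iff forall_2 matvec_2)
  ultimately show ?thesis
    using assms(1) by (auto simp: SL2_iff vec_eq_iff forall_2 mat_2)
qed

lemma vmap_uminus: "vmap (- z) = vmap z"
  by (simp add: vmap_def)

lemma rho_uminus: "rho (- g) = rho g"
proof (rule vmap_spans)
  fix z
  have "(- g) *v z = - (g *v z)"
    by (simp add: vec_eq_iff matvec_2)
  then show "rho (- g) *v vmap z = rho g *v vmap z"
    by (simp add: vmap_uminus flip: vmap_matvec)
qed

lemma SL2_mult: "g \<in> SL2 \<Longrightarrow> h \<in> SL2 \<Longrightarrow> g ** h \<in> SL2"
  by (simp add: SL2_def det_mul)

lemma rho_eq_imp:
  assumes "g \<in> SL2" "h \<in> SL2" "rho g = rho h"
  shows "g = h \<or> g = - h"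
proof -
  have "rho (g ** adj2 h) = mat 1"
    by (simp add: rho_mult assms rho_one adj2_mult flip: rho_mult[of h])
  then have "g ** adj2 h = mat 1 \<or> g ** adj2 h = - mat 1"
    using rho_kernel SL2_mult adj2_SL2 assms by blast
  then have "g ** adj2 h ** h = h \<or> g ** adj2 h ** h = - h"
    by (auto simp: matrix_mul_assoc matrix_matrix_mult_def vec_eq_iff sum_2 mat_2 forall_2)
  then show ?thesis
    by (simp add: adj2_mult assms flip: matrix_mul_assoc)
qed

section \<open>Complex orthogonal matrices\<close>

lemma qf_add: "qf (x + y) = qf x + qf y + 2 * lin_form x y"
  by (simp add: qf_def lin_form_apply power2_eq_square algebra_simps)

lemma qf_lin_form: "qf x = lin_form x x"
  by (simp add: qf_def lin_form_apply power2_eq_square)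

text \<open>Polarisation: \<open>lin_form\<close> is the bilinear form belonging to q.\<close>

lemma SO3C_lin_form:
  assumes "A \<in> SO3C"
  shows "lin_form (A *v x) (A *v y) = lin_form x y"
proof -
  have q: "qf (A *v u) = qf u" for u
    using assms by (simp add: SO3C_def)
  have "qf (A *v x + A *v y) = qf (x + y)"
    unfolding matrix_vector_right_distrib[symmetric] by (rule q)
  then show ?thesis
    by (simp add: qf_add q)
qed

lemma lin_form_transpose: "lin_form (A *v x) y = lin_form x (transpose A *v y)"
  by (simp add: lin_form_apply matvec_3 transpose_def algebra_simps)

lemma lin_form_axis: "lin_form (axis i 1) y = y $ i"
  using exhaust_3[of i] by (auto simp: lin_form_apply axis_def)

lemma SO3C_iff: "A \<in> SO3C \<longleftrightarrow> det A = 1 \<and> transpose A ** A = mat 1"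
proof safe
  assume A: "A \<in> SO3C"
  then show "det A = 1"
    by (simp add: SO3C_def)
  have "(transpose A *v (A *v y)) $ i = y $ i" for y i
    using SO3C_lin_form[OF A, of "axis i 1" y] unfolding lin_form_transpose lin_form_axis .
  then have "(transpose A ** A) *v y = mat 1 *v y" for y
    by (simp add: vec_eq_iff flip: matrix_vector_mul_assoc)
  then show "transpose A ** A = mat 1"
    by (simp add: matrix_eq)
next
  assume A: "det A = 1" "transpose A ** A = mat 1"
  then show "A \<in> SO3C"
    by (simp add: SO3C_def qf_lin_form lin_form_transpose matrix_vector_mul_assoc)
qed

lemma SO3C_transpose: "A \<in> SO3C \<Longrightarrow> transpose A \<in> SO3C"
  unfolding SO3C_iff using matrix_left_right_inverse[of "transpose A" A] by simp

lemma SO3C_inverse: "A \<in> SO3C \<Longrightarrow> A ** transpose A = mat 1"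
  unfolding SO3C_iff using matrix_left_right_inverse[of "transpose A" A] by simp

lemma SO3C_matrix_inv: "A \<in> SO3C \<Longrightarrow> matrix_inv A = transpose A"
  by (rule matrix_inv_unique_eq) (rule SO3C_inverse)

lemma SO3C_mult: "A \<in> SO3C \<Longrightarrow> B \<in> SO3C \<Longrightarrow> A ** B \<in> SO3C"
  by (simp add: SO3C_def det_mul flip: matrix_vector_mul_assoc)

text \<open>Take for z_0 and z_1 square roots of (x_1 - i x_2) / 2 and -(x_1 + i x_2) / 2. Being
  null says that their product is x_3 / 2 up to sign, and the sign of one root can be
  adjusted.\<close>

lemma null_vector_vmap:
  assumes "qf x = 0"
  obtains z where "x = vmap z"
proof -
  define u where "u = csqrt ((x $ 1 - \<i> * x $ 2) / 2)"
  define w where "w = csqrt (- (x $ 1 + \<i> * x $ 2) / 2)"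
  have u: "u\<^sup>2 = (x $ 1 - \<i> * x $ 2) / 2" and w: "w\<^sup>2 = - (x $ 1 + \<i> * x $ 2) / 2"
    by (simp_all add: u_def w_def)
  have f: "(x $ 1 + \<i> * x $ 2) * (x $ 1 - \<i> * x $ 2) = - (x $ 3)\<^sup>2"
    unfolding qf_factor assms by simp
  have "(u * w)\<^sup>2 = - ((x $ 1 + \<i> * x $ 2) * (x $ 1 - \<i> * x $ 2)) / 4"
    unfolding power_mult_distrib u w by (simp add: field_simps)
  then have "(u * w)\<^sup>2 = (x $ 3 / 2)\<^sup>2"
    unfolding f by (simp add: power_divide)
  then consider "u * w = x $ 3 / 2" | "u * w = - (x $ 3 / 2)"
    by (auto simp: power2_eq_iff)
  then obtain w' where w': "w'\<^sup>2 = w\<^sup>2" "u * w' = x $ 3 / 2"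
  proof cases
    case 1
    then show ?thesis using that[of w] by simp
  next
    case 2
    then show ?thesis using that[of "- w"] by simp
  qed
  have ii: "\<i> * (\<i> * y) = - y" for y
    by (simp add: complex_eq_iff)
  have "u\<^sup>2 - w'\<^sup>2 = x $ 1" "\<i> * (u\<^sup>2 + w'\<^sup>2) = x $ 2" "2 * u * w' = x $ 3"
    unfolding w'(1) u w using w'(2) by (simp_all add: field_simps ii)
  then have "x = vmap (vector [u, w'])"
    by (simp add: vec_eq_iff forall_3 vmap_nth)
  then show ?thesis
    using that by blast
qed

lemma SL2_transitive:
  assumes "p \<noteq> 0"
  obtains g where "g \<in> SL2" "g *v vector [1, 0] = p"
proof (cases "p $ 1 = 0")
  case True
  then have "p $ 2 \<noteq> 0"
    using assms by (auto simp: vec_eq_iff forall_2)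
  then show ?thesis
    using True by (intro that[of "vector [vector [0, - 1 / p $ 2], vector [p $ 2, 0]]"])
      (auto simp: SL2_iff vec_eq_iff forall_2 matvec_2)
next
  case False
  then show ?thesis
    by (intro that[of "vector [vector [p $ 1, 0], vector [p $ 2, 1 / p $ 1]]"])
      (auto simp: SL2_iff vec_eq_iff forall_2 matvec_2)
qed

text \<open>An element of \<open>SO3C\<close> fixing the null vectors \<open>v(1, 0)\<close> and \<open>v(0, 1)\<close> also fixes the
  orthogonal complement of their span, up to a sign that the determinant determines.\<close>

lemma SO3C_fixing_null_vectors:
  assumes "A \<in> SO3C" "A *v vmap (vector [1, 0]) = vmap (vector [1, 0])"
    "A *v vmap (vector [0, 1]) = vmap (vector [0, 1])"
  shows "A = mat 1"
proof -
  have c1: "A $ i $ 1 + A $ i $ 2 * \<i> = vmap (vector [1, 0]) $ i"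
    and c2: "- A $ i $ 1 + A $ i $ 2 * \<i> = vmap (vector [0, 1]) $ i" for i
    using arg_cong[OF assms(2), of "\<lambda>x. x $ i"] arg_cong[OF assms(3), of "\<lambda>x. x $ i"]
    by (simp_all add: matvec_3 vmap_nth)
  have e1: "A $ i $ 1 = (if i = 1 then 1 else 0)" and e2: "A $ i $ 2 = (if i = 2 then 1 else 0)" for i
  proof -
    have "2 * (A $ i $ 1) = vmap (vector [1, 0]) $ i - vmap (vector [0, 1]) $ i"
      unfolding c1[symmetric] c2[symmetric] by simp
    also have "\<dots> = 2 * (if i = 1 then 1 else 0)"
      using exhaust_3[of i] by (auto simp: vmap_nth)
    finally show 1: "A $ i $ 1 = (if i = 1 then 1 else 0)"
      by simp
    have "\<i> * (A $ i $ 2) = \<i> * (if i = 2 then 1 else 0)"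
      using exhaust_3[of i] c1[of i] unfolding 1 by (auto simp: vmap_nth mult.commute)
    then show "A $ i $ 2 = (if i = 2 then 1 else 0)"
      by (simp only: mult_cancel_left complex_i_not_zero) simp
  qed
  \<comment> \<open>The first two columns are already standard; orthogonality to them clears the
    third column above the diagonal.\<close>
  have "lin_form (A *v axis 1 1) (A *v axis 3 1) = 0" "lin_form (A *v axis 2 1) (A *v axis 3 1) = 0"
    unfolding SO3C_lin_form[OF assms(1)] lin_form_axis by (simp_all add: axis_def)
  then have z: "A $ 1 $ 3 = 0" "A $ 2 $ 3 = 0"
    by (simp_all add: lin_form_apply matvec_3 axis_def e1 e2)
  then have "A $ 3 $ 3 = 1"
    using assms(1) by (simp add: SO3C_def det_3 e1 e2)
  then show ?thesis
    using z by (auto simp: vec_eq_iff forall_3 mat_def e1 e2)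
qed

text \<open>A is multiplied from the left by images of rho until it fixes v(1, 0) and v(0, 1). Some
  g in SL2 takes (1, 0) to the required nonzero vector; a unipotent h, which fixes (1, 0), then
  takes care of the second null vector.\<close>

lemma rho_surj:
  assumes "A \<in> SO3C"
  obtains g where "g \<in> SL2" "rho g = A"
proof -
  let ?e = "vector [1, 0] :: complex ^ 2" and ?f = "vector [0, 1] :: complex ^ 2"
  have "qf (A *v vmap ?e) = 0"
    using assms by (simp add: SO3C_def qf_vmap)
  then obtain p where p: "A *v vmap ?e = vmap p"
    by (rule null_vector_vmap)
  \<comment> \<open>For p = 0 the vector v(p) would be orthogonal to everything, but A preserves the
    nonzero product of the two chosen null vectors.\<close>
  have "lin_form (vmap p) (A *v vmap ?f) \<noteq> 0"
    unfolding p[symmetric] SO3C_lin_form[OF assms] lin_form_vmap_vmap by simp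
  moreover have "lin_form (vmap 0) y = 0" for y
    by (simp add: lin_form_apply vmap_nth)
  ultimately have "p \<noteq> 0"
    by auto
  then obtain g where g: "g \<in> SL2" "g *v ?e = p"
    by (rule SL2_transitive)
  define B where "B = rho (adj2 g) ** A"
  have B: "B \<in> SO3C"
    unfolding B_def by (intro SO3C_mult rho_SO3C adj2_SL2 g assms)
  have Be: "B *v vmap ?e = vmap ?e"
    unfolding B_def matrix_vector_mul_assoc[symmetric] p g(2)[symmetric] vmap_matvec[symmetric]
    by (simp add: matrix_vector_mul_assoc adj2_mult[OF g(1)])
  have "qf (B *v vmap ?f) = 0"
    using B by (simp add: SO3C_def qf_vmap)
  then obtain r where r: "B *v vmap ?f = vmap r"
    by (rule null_vector_vmap)
  have "lin_form (vmap ?e) (vmap r) = lin_form (vmap ?e) (vmap ?f)"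
    using SO3C_lin_form[OF B, of "vmap ?e" "vmap ?f"] by (simp add: Be r)
  then have "(r $ 2)\<^sup>2 = 1"
    by (simp add: lin_form_vmap_vmap)
  \<comment> \<open>Since v(r) = v(-r), the sign of r is free and its second coordinate may be taken
    to be 1.\<close>
  then have "r $ 2 = 1 \<or> (- r) $ 2 = 1"
    by (auto simp: power2_eq_1_iff minus_equation_iff)
  then obtain s where s: "vmap s = vmap r" "s $ 2 = 1"
    using vmap_uminus by metis
  define h where "h = (vector [vector [1, s $ 1], vector [0, 1]] :: complex ^ 2 ^ 2)"
  have h: "h \<in> SL2" "h *v ?e = ?e" "h *v ?f = s"
    using s by (auto simp: h_def SL2_iff vec_eq_iff forall_2 matvec_2)
  define C where "C = rho (adj2 h) ** B"
  have inv: "rho (adj2 h) *v vmap (h *v z) = vmap z" for z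
    unfolding vmap_matvec[symmetric] by (simp add: matrix_vector_mul_assoc adj2_mult[OF h(1)])
  have "C = mat 1"
  proof (rule SO3C_fixing_null_vectors)
    show "C \<in> SO3C"
      unfolding C_def by (intro SO3C_mult rho_SO3C adj2_SL2 h B)
    show "C *v vmap ?e = vmap ?e"
      unfolding C_def matrix_vector_mul_assoc[symmetric] Be using inv[of ?e] by (simp add: h)
    show "C *v vmap ?f = vmap ?f"
      unfolding C_def matrix_vector_mul_assoc[symmetric] r s(1)[symmetric] using inv[of ?f] by (simp add: h)
  qed
  have "rho (g ** h) = rho (g ** h) ** C"
    unfolding \<open>C = mat 1\<close> by simp
  also have "\<dots> = rho (g ** (h ** adj2 h) ** adj2 g) ** A"
    unfolding C_def B_def by (simp add: rho_mult matrix_mul_assoc)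
  also have "\<dots> = A"
    by (simp add: adj2_mult g h rho_one)
  finally show ?thesis
    using that SL2_mult g h by blast
qed

section \<open>The matrix groups and their real forms\<close>

lemma matrix_group_simps [simp]:
  "carrier (matrix_group S) = S" "mult (matrix_group S) = (**)" "one (matrix_group S) = mat 1"
  by (simp_all add: matrix_group_def)

lemma group_matrix_group:
  assumes "mat 1 \<in> S" "\<And>A B. A \<in> S \<Longrightarrow> B \<in> S \<Longrightarrow> A ** B \<in> S"
    "\<And>A. A \<in> S \<Longrightarrow> \<exists>B\<in>S. B ** A = mat 1"
  shows "group (matrix_group S)"
  by (rule groupI) (use assms in \<open>auto simp: matrix_mul_assoc\<close>)

lemma group_SL2: "group (matrix_group SL2)"
  by (rule group_matrix_group) (use adj2_SL2 adj2_mult SL2_mult in \<open>auto simp: SL2_def\<close>)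

lemma group_SO3C: "group (matrix_group SO3C)"
proof (rule group_matrix_group)
  show "mat 1 \<in> SO3C"
    by (simp add: SO3C_def)
  fix A assume "A \<in> SO3C"
  then show "\<exists>B\<in>SO3C. B ** A = mat 1"
    using SO3C_transpose SO3C_iff by blast
qed (rule SO3C_mult)

definition star2 :: "complex ^ 2 ^ 2 \<Rightarrow> complex ^ 2 ^ 2" where
  "star2 g = (\<chi> i j. cnj (g $ j $ i))"

text \<open>Unitarity identifies the conjugate transpose with the inverse, which in determinant one
  is the adjugate; comparing entries gives the two conditions.\<close>

lemma SU2_iff: "g \<in> SU2 \<longleftrightarrow> g \<in> SL2 \<and> g $ 2 $ 2 = cnj (g $ 1 $ 1) \<and> g $ 2 $ 1 = - cnj (g $ 1 $ 2)"
proof safe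
  assume g: "g \<in> SU2"
  then show "g \<in> SL2"
    by (simp add: SU2_def)
  have "g ** star2 g = mat 1"
    using g by (simp add: SU2_def star2_def)
  then have "adj2 g ** (g ** star2 g) = adj2 g"
    by simp
  then have *: "star2 g = adj2 g"
    by (simp add: matrix_mul_assoc adj2_mult[OF \<open>g \<in> SL2\<close>])
  show "g $ 2 $ 2 = cnj (g $ 1 $ 1)" "g $ 2 $ 1 = - cnj (g $ 1 $ 2)"
    using arg_cong[OF *, of "\<lambda>m. m $ 1 $ 1"] arg_cong[OF *, of "\<lambda>m. m $ 2 $ 1"]
    by (simp_all add: star2_def adj2_def)
next
  assume g: "g \<in> SL2" "g $ 2 $ 2 = cnj (g $ 1 $ 1)" "g $ 2 $ 1 = - cnj (g $ 1 $ 2)"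
  then have "star2 g = adj2 g"
    by (simp add: star2_def adj2_def vec_eq_iff forall_2)
  then show "g \<in> SU2"
    using adj2_mult[OF g(1)] g(1) by (simp add: SU2_def star2_def)
qed

lemma group_SU2: "group (matrix_group SU2)"
proof (rule group_matrix_group)
  show "mat 1 \<in> SU2"
    by (simp add: SU2_iff SL2_iff mat_2)
  show "A ** B \<in> SU2" if "A \<in> SU2" "B \<in> SU2" for A B
    using that by (simp add: SU2_iff SL2_mult matmul_2 algebra_simps)
  fix A assume "A \<in> SU2"
  then show "\<exists>B\<in>SU2. B ** A = mat 1"
    by (intro bexI[of _ "adj2 A"]) (auto simp: SU2_iff adj2_mult adj2_SL2, simp_all add: adj2_def)
qed

definition cmat :: "real ^ 3 ^ 3 \<Rightarrow> complex ^ 3 ^ 3" where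
  "cmat A = (\<chi> i j. complex_of_real (A $ i $ j))"

lemma cmat_mult: "cmat (A ** B) = cmat A ** cmat B"
  by (simp add: cmat_def matrix_matrix_mult_def vec_eq_iff)

lemma cmat_transpose: "cmat (transpose A) = transpose (cmat A)"
  by (simp add: cmat_def transpose_def)

lemma cmat_one: "cmat (mat 1) = mat 1"
  by (simp add: cmat_def mat_def vec_eq_iff)

lemma cmat_inj: "cmat A = cmat B \<longleftrightarrow> A = B"
  by (simp add: cmat_def vec_eq_iff)

lemma det_cmat: "det (cmat A) = complex_of_real (det A)"
  by (simp add: cmat_def det_3)

lemma SO3R_eq: "SO3R = cmat ` {A. rotation_matrix A}"
  by (simp add: SO3R_def cmat_def[abs_def])

lemma cmat_SO3C_iff: "cmat A \<in> SO3C \<longleftrightarrow> rotation_matrix A"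
  by (simp add: SO3C_iff rotation_matrix_def orthogonal_matrix det_cmat cmat_inj
      flip: cmat_transpose cmat_mult cmat_one) auto

text \<open>Presents the rotations as the real points of the complex group, so that reality can be
  tested by conjugating entries.\<close>

lemma SO3R_iff: "M \<in> SO3R \<longleftrightarrow> M \<in> SO3C \<and> (\<forall>i j. cnj (M $ i $ j) = M $ i $ j)"
proof safe
  fix i j assume "M \<in> SO3R"
  then show "M \<in> SO3C" "cnj (M $ i $ j) = M $ i $ j"
    by (auto simp: SO3R_eq cmat_SO3C_iff) (simp add: cmat_def)
next
  assume M: "M \<in> SO3C" "\<forall>i j. cnj (M $ i $ j) = M $ i $ j"
  have "cmat (\<chi> i j. Re (M $ i $ j)) = M"
    using M(2) by (simp add: cmat_def vec_eq_iff complex_eq_iff)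
  then show "M \<in> SO3R"
    using M(1) cmat_SO3C_iff unfolding SO3R_eq by (metis image_eqI mem_Collect_eq)
qed

lemma group_SO3R: "group (matrix_group SO3R)"
proof (rule group_matrix_group)
  show "mat 1 \<in> SO3R"
    by (simp add: SO3R_iff SO3C_def) (simp add: mat_def)
  show "A ** B \<in> SO3R" if "A \<in> SO3R" "B \<in> SO3R" for A B
  proof -
    have "cnj ((A ** B) $ i $ j) = (A ** B) $ i $ j" for i j
      using that by (simp add: SO3R_iff matrix_matrix_mult_def)
    then show ?thesis
      using that SO3C_mult unfolding SO3R_iff by blast
  qed
  fix A assume A: "A \<in> SO3R"
  have "transpose A \<in> SO3R"
    using A SO3C_transpose unfolding SO3R_iff by (auto simp: transpose_def)
  moreover have "transpose A ** A = mat 1"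
    using A unfolding SO3R_iff SO3C_iff by blast
  ultimately show "\<exists>B\<in>SO3R. B ** A = mat 1"
    by blast
qed

lemma rho_nth:
  "rho g $ 1 $ 1 = ((g $ 1 $ 1)\<^sup>2 - (g $ 2 $ 1)\<^sup>2 - (g $ 1 $ 2)\<^sup>2 + (g $ 2 $ 2)\<^sup>2) / 2"
  "rho g $ 1 $ 2 = - \<i> * ((g $ 1 $ 1)\<^sup>2 - (g $ 2 $ 1)\<^sup>2 + (g $ 1 $ 2)\<^sup>2 - (g $ 2 $ 2)\<^sup>2) / 2"
  "rho g $ 1 $ 3 = g $ 1 $ 1 * g $ 1 $ 2 - g $ 2 $ 1 * g $ 2 $ 2"
  "rho g $ 2 $ 1 = \<i> * ((g $ 1 $ 1)\<^sup>2 + (g $ 2 $ 1)\<^sup>2 - (g $ 1 $ 2)\<^sup>2 - (g $ 2 $ 2)\<^sup>2) / 2"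
  "rho g $ 2 $ 2 = ((g $ 1 $ 1)\<^sup>2 + (g $ 2 $ 1)\<^sup>2 + (g $ 1 $ 2)\<^sup>2 + (g $ 2 $ 2)\<^sup>2) / 2"
  "rho g $ 2 $ 3 = \<i> * (g $ 1 $ 1 * g $ 1 $ 2 + g $ 2 $ 1 * g $ 2 $ 2)"
  "rho g $ 3 $ 1 = g $ 1 $ 1 * g $ 2 $ 1 - g $ 1 $ 2 * g $ 2 $ 2"
  "rho g $ 3 $ 2 = - \<i> * (g $ 1 $ 1 * g $ 2 $ 1 + g $ 1 $ 2 * g $ 2 $ 2)"
  "rho g $ 3 $ 3 = g $ 1 $ 1 * g $ 2 $ 2 + g $ 1 $ 2 * g $ 2 $ 1"
  by (simp_all add: rho_eq rho_mat_def Let_def)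

text \<open>The conjugate of \<open>g\<close> by the quaternionic structure \<^const>\<open>jmap\<close>.\<close>

definition quat_conj :: "complex ^ 2 ^ 2 \<Rightarrow> complex ^ 2 ^ 2" where
  "quat_conj g = vector [vector [cnj (g $ 2 $ 2), - cnj (g $ 2 $ 1)],
     vector [- cnj (g $ 1 $ 2), cnj (g $ 1 $ 1)]]"

text \<open>Since v(j z) is minus the conjugate of v(z), conjugating rho(g) corresponds to replacing
  g by j g j^-1.\<close>

lemma cnj_rho: "cnj (rho g $ i $ j) = rho (quat_conj g) $ i $ j"
  using exhaust_3[of i] exhaust_3[of j]
  by (elim disjE; simp add: rho_nth quat_conj_def; simp add: field_simps)

lemma quat_conj_SL2: "g \<in> SL2 \<Longrightarrow> quat_conj g \<in> SL2"
proof -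
  assume "g \<in> SL2"
  then have "cnj (g $ 1 $ 1 * g $ 2 $ 2 - g $ 1 $ 2 * g $ 2 $ 1) = 1"
    by (simp add: SL2_iff)
  then show ?thesis
    by (simp add: SL2_iff quat_conj_def algebra_simps)
qed

lemma SU2_quat_conj: "g \<in> SU2 \<Longrightarrow> quat_conj g = g"
  by (simp add: SU2_iff quat_conj_def vec_eq_iff forall_2)

lemma quat_conj_SU2: "g \<in> SL2 \<Longrightarrow> quat_conj g = g \<Longrightarrow> g \<in> SU2"
  by (simp add: SU2_iff quat_conj_def vec_eq_iff forall_2)

text \<open>Otherwise the determinant of g would be -(|a|^2 + |b|^2), with (a, b) the first row.
  This excludes one of the two signs left open by the kernel of rho.\<close>

lemma quat_conj_neq_uminus:
  assumes "g \<in> SL2"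
  shows "quat_conj g \<noteq> - g"
proof
  assume "quat_conj g = - g"
  then have g: "g $ 2 $ 2 = - cnj (g $ 1 $ 1)" "g $ 2 $ 1 = cnj (g $ 1 $ 2)"
    by (auto simp: quat_conj_def vec_eq_iff forall_2)
  have "- (g $ 1 $ 1 * cnj (g $ 1 $ 1)) - g $ 1 $ 2 * cnj (g $ 1 $ 2) = 1"
    using assms by (simp add: SL2_iff g)
  then have "Re (- (g $ 1 $ 1 * cnj (g $ 1 $ 1)) - g $ 1 $ 2 * cnj (g $ 1 $ 2)) = 1"
    by simp
  then have "- ((cmod (g $ 1 $ 1))\<^sup>2 + (cmod (g $ 1 $ 2))\<^sup>2) = 1"
    unfolding cmod_power2 by (simp add: power2_eq_square)
  moreover have "(cmod (g $ 1 $ 1))\<^sup>2 + (cmod (g $ 1 $ 2))\<^sup>2 \<ge> 0"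
    by simp
  ultimately show False
    by linarith
qed

text \<open>If rho(g) is real, then g and \<open>quat_conj g\<close> have the same image and differ
  at most by a sign; the sign -1 is impossible, and the fixed points of \<open>quat_conj\<close> in
  SL2 form SU2. Surjectivity onto the real rotations is then inherited from SL2.\<close>

lemma rho_SO3R_iff:
  assumes "g \<in> SL2"
  shows "rho g \<in> SO3R \<longleftrightarrow> g \<in> SU2"
proof
  assume "rho g \<in> SO3R"
  then have "rho (quat_conj g) = rho g"
    by (simp add: SO3R_iff vec_eq_iff cnj_rho)
  then have "quat_conj g = g \<or> quat_conj g = - g"
    by (rule rho_eq_imp[OF quat_conj_SL2[OF assms] assms])
  then show "g \<in> SU2"
    using quat_conj_neq_uminus quat_conj_SU2 assms by blast
next
  assume "g \<in> SU2"
  then show "rho g \<in> SO3R"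
    using rho_SO3C[OF assms] by (simp add: SO3R_iff cnj_rho SU2_quat_conj)
qed

lemma SU2_subset_SL2: "g \<in> SU2 \<Longrightarrow> g \<in> SL2"
  by (simp add: SU2_iff)

lemma SO3R_subset_SO3C: "A \<in> SO3R \<Longrightarrow> A \<in> SO3C"
  by (simp add: SO3R_iff)

lemma rho_group_hom_SL2: "group_hom (matrix_group SL2) (matrix_group SO3C) rho"
  unfolding group_hom_def group_hom_axioms_def hom_def
  using group_SL2 group_SO3C rho_SO3C rho_mult by auto

lemma rho_group_hom_SU2: "group_hom (matrix_group SU2) (matrix_group SO3R) rho"
  unfolding group_hom_def group_hom_axioms_def hom_def
  using group_SU2 group_SO3R rho_SO3R_iff SU2_subset_SL2 rho_mult by auto

lemma rho_epi_SL2: "rho \<in> epi (matrix_group SL2) (matrix_group SO3C)"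
proof -
  have "rho ` SL2 = SO3C"
    using rho_surj rho_SO3C by (metis image_eqI image_subsetI subsetI subset_antisym)
  then show ?thesis
    using group_hom.homh[OF rho_group_hom_SL2] by (simp add: epi_def)
qed

lemma rho_epi_SU2: "rho \<in> epi (matrix_group SU2) (matrix_group SO3R)"
proof -
  have "rho ` SU2 = SO3R"
  proof
    show "rho ` SU2 \<subseteq> SO3R"
      using rho_SO3R_iff SU2_subset_SL2 by auto
    show "SO3R \<subseteq> rho ` SU2"
    proof
      fix A assume A: "A \<in> SO3R"
      then obtain g where "g \<in> SL2" "rho g = A"
        using rho_surj SO3R_subset_SO3C by metis
      then show "A \<in> rho ` SU2"
        using rho_SO3R_iff A by blast
    qed
  qed
  then show ?thesis
    using group_hom.homh[OF rho_group_hom_SU2] by (simp add: epi_def)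
qed

lemma uminus_one_SU2: "- mat 1 \<in> SU2" and one_SU2: "mat 1 \<in> SU2"
  by (simp_all add: SU2_iff SL2_iff mat_2)

lemma rho_kernel_SL2: "kernel (matrix_group SL2) (matrix_group SO3C) rho = {mat 1, - mat 1}"
  using rho_kernel rho_one rho_uminus[of "mat 1"] uminus_one_SU2 one_SU2 SU2_subset_SL2
  by (auto simp: kernel_def)

lemma rho_kernel_SU2: "kernel (matrix_group SU2) (matrix_group SO3R) rho = {mat 1, - mat 1}"
  using rho_kernel rho_one rho_uminus[of "mat 1"] uminus_one_SU2 one_SU2 SU2_subset_SL2
  by (auto simp: kernel_def)

section \<open>Equivariance and equivariant maps\<close>

lemma homog_comp_linear:
  fixes B :: "complex ^ 'n ^ 'n"
  assumes "f \<in> homog (int d)"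
  shows "f \<circ> (\<lambda>x. B *v x) \<in> homog (int d)"
  using assms
proof (induction rule: homog_gen_induct)
  case one
  have "const_fun 1 \<circ> (\<lambda>x. B *v x) = const_fun 1"
    by (auto simp: fun_simps)
  then show "const_fun 1 \<circ> (\<lambda>x. B *v x) \<in> homog (int 0)"
    by (simp add: const_homog)
next
  case (add d f g)
  show "(f + g) \<circ> (\<lambda>x. B *v x) \<in> homog (int d)"
    unfolding comp_add by (rule homog_add[OF add(3,4)])
next
  case (cscale d c f)
  show "cscale c f \<circ> (\<lambda>x. B *v x) \<in> homog (int d)"
    unfolding comp_cscale by (rule homog_cscale[OF cscale(2)])
next
  case (step d i f)
  have c: "coord i \<circ> (\<lambda>x. B *v x) = (\<Sum>j\<in>UNIV. cscale (B $ i $ j) (coord j))"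
    by (auto simp: fun_eq_iff fun_simps matrix_vector_mult_def)
  have "coord i \<circ> (\<lambda>x. B *v x) \<in> homog 1"
    unfolding c by (intro homog_sum homog_cscale coord_homog)
  then have "(coord i \<circ> (\<lambda>x. B *v x)) * (f \<circ> (\<lambda>x. B *v x)) \<in> homog (1 + int d)"
    by (rule homog_mult[OF _ step(2)])
  then show "(coord i * f) \<circ> (\<lambda>x. B *v x) \<in> homog (int (Suc d))"
    unfolding comp_mult by simp
qed

text \<open>Composition with B turns the generating function into a power of the linear form of B^T
  w, and B^T w is again null.\<close>

lemma harm_basis_comp_SO3C:
  assumes "B \<in> SO3C"
  shows "harm_basis l k \<circ> (\<lambda>x. B *v x) \<in> harmC l"
proof (cases "k \<le> 2 * l")
  case True
  let ?h = "\<lambda>k. harm_basis l k \<circ> (\<lambda>x. B *v x)"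
  have hom: "?h k \<in> homog (int l)" for k
    by (rule homog_comp_linear[OF harm_basis_homog])
  have "laplacian (?h k) x = 0" for x
  proof (rule zero_polynom_imp_zero_coeffs[OF _ True])
    fix t :: complex
    let ?w = "vmap (vector [1, t])"
    have "lin_form (transpose B *v ?w) ^ l = (\<Sum>k\<le>2 * l. cscale (t ^ k) (?h k))"
    proof
      fix x
      have "(lin_form (transpose B *v ?w) ^ l) x = lin_form ?w (B *v x) ^ l"
        unfolding power_fun_apply lin_form_transpose by simp
      also have "\<dots> = (\<Sum>k\<le>2 * l. harm_basis l k (B *v x) * t ^ k)"
        by (rule harm_basis_sum[symmetric])
      also have "\<dots> = (\<Sum>k\<le>2 * l. cscale (t ^ k) (?h k)) x"
        by (simp add: fun_simps mult.commute)
      finally show "(lin_form (transpose B *v ?w) ^ l) x = (\<Sum>k\<le>2 * l. cscale (t ^ k) (?h k)) x" .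
    qed
    then have "laplacian (lin_form (transpose B *v ?w) ^ l) =
        (\<Sum>k\<le>2 * l. cscale (t ^ k) (laplacian (?h k)))"
      using homog_polys[OF hom] by (simp add: laplacian_sum polys_cscale laplacian_cscale)
    moreover have "qf (transpose B *v ?w) = 0"
      using SO3C_transpose[OF assms] by (simp add: SO3C_def qf_vmap)
    ultimately have "0 = (\<Sum>k\<le>2 * l. cscale (t ^ k) (laplacian (?h k))) x"
      using harmC_laplacian[OF lin_form_power_harmonic] by (simp add: fun_simps)
    then show "(\<Sum>k\<le>2 * l. laplacian (?h k) x * t ^ k) = 0"
      by (simp add: fun_simps mult.commute)
  qed
  then show ?thesis
    using hom by (auto simp: harmC_def fun_eq_iff fun_simps)
next
  case False
  then show ?thesis
    using harm_basis_eq_0[of l k] by (simp add: comp_0)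
qed

lemma harmC_expansion:
  assumes "f \<in> harmC l"
  obtains d where "f = (\<Sum>k\<le>2 * l. cscale (d k) (harm_mono l k))"
proof -
  have "f \<circ> vmap \<in> Sym (2 * l)"
    by (rule homog_comp_vmap[OF harmC_homog[OF assms]])
  then obtain a where "f \<circ> vmap = bform (2 * l) a"
    by (rule Sym_bform)
  then show ?thesis
    by (rule that[OF harm_expansion[OF assms]])
qed

lemma harmC_comp_SO3C:
  assumes "B \<in> SO3C" "f \<in> harmC l"
  shows "f \<circ> (\<lambda>x. B *v x) \<in> harmC l"
proof -
  obtain d where f: "f = (\<Sum>k\<le>2 * l. cscale (d k) (harm_mono l k))"
    using harmC_expansion[OF assms(2)] .
  show ?thesis
    unfolding f comp_sum comp_cscale harm_mono_def
    by (intro harmC_sum harmC_cscale harm_basis_comp_SO3C assms)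
qed

lemma act_SO3C: "A \<in> SO3C \<Longrightarrow> act A f = f \<circ> (\<lambda>x. transpose A *v x)"
  by (simp add: act_def SO3C_matrix_inv comp_def)

lemma act_harmC: "A \<in> SO3C \<Longrightarrow> f \<in> harmC l \<Longrightarrow> act A f \<in> harmC l"
  unfolding act_SO3C by (intro harmC_comp_SO3C SO3C_transpose)

lemma act_SL2: "g \<in> SL2 \<Longrightarrow> act g F = F \<circ> (\<lambda>z. adj2 g *v z)"
  by (simp add: act_def matrix_inv_SL2 comp_def)

lemma act_rho_comp_vmap: "g \<in> SL2 \<Longrightarrow> act (rho g) f \<circ> vmap = act g (f \<circ> vmap)"
  by (auto simp: fun_eq_iff act_def matrix_inv_rho matrix_inv_SL2 vmap_matvec)

lemma Psi_equivariant:
  assumes "g \<in> SL2" "f \<in> harmC l"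
  shows "Psi l (act (rho g) f) = act g (Psi l f)"
  using act_harmC[OF rho_SO3C[OF assms(1)] assms(2)] assms by (simp add: Psi_apply act_rho_comp_vmap)

text \<open>Carries an identity between forms back to harmonic polynomials by injectivity; it
  supplies the torus and shear relations on the source side of an arbitrary equivariant map.\<close>

lemma harm_mono_act:
  assumes "g \<in> SL2" "k \<le> 2 * l" "act g (bmono (2 * l) k) = (\<Sum>j\<le>2 * l. cscale (c j) (bmono (2 * l) j))"
  shows "act (rho g) (harm_mono l k) = (\<Sum>j\<le>2 * l. cscale (c j) (harm_mono l j))"
proof -
  let ?s = "\<Sum>j\<le>2 * l. cscale (c j) (harm_mono l j)"
  have h: "act (rho g) (harm_mono l k) \<in> harmC l" "?s \<in> harmC l"
    by (intro act_harmC rho_SO3C assms harm_mono_harmonic harmC_sum harmC_cscale)+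
  have "act (rho g) (harm_mono l k) \<circ> vmap = ?s \<circ> vmap"
    unfolding act_rho_comp_vmap[OF assms(1)] harm_mono_vmap[OF assms(2)] assms(3) comp_sum comp_cscale
    by (intro sum.cong refl) (simp add: harm_mono_vmap)
  then show ?thesis
    using inj_onD[OF Psi_inj _ h] h by (simp add: Psi_apply)
qed

lemma clinear_on_sum:
  assumes "clinear_on (harmC l) W T" "\<And>a. a \<in> A \<Longrightarrow> f a \<in> harmC l"
  shows "T (\<Sum>a\<in>A. cscale (c a) (f a)) = (\<Sum>a\<in>A. cscale (c a) (T (f a)))"
proof -
  have T0: "T 0 = 0"
    using assms(1) harmC_0[of l] unfolding clinear_on_def by (metis cscale_zero(2))
  show ?thesis
    using assms(2)
  proof (induction A rule: infinite_finite_induct)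
    case (insert x A)
    have "T (cscale (c x) (f x) + (\<Sum>a\<in>A. cscale (c a) (f a))) =
        T (cscale (c x) (f x)) + T (\<Sum>a\<in>A. cscale (c a) (f a))"
      using assms(1) insert.prems unfolding clinear_on_def by (blast intro: harmC_sum harmC_cscale)
    also have "T (cscale (c x) (f x)) = cscale (c x) (T (f x))"
      using assms(1) insert.prems unfolding clinear_on_def by blast
    finally show "T (\<Sum>a\<in>insert x A. cscale (c a) (f a)) = (\<Sum>a\<in>insert x A. cscale (c a) (T (f a)))"
      using insert by simp
  qed (simp_all add: T0)
qed

text \<open>One diagonal element is enough: its eigenvalues \<open>4 ^ k / 2 ^ n\<close> on the
  monomials are pairwise distinct.\<close>

definition torus :: "complex ^ 2 ^ 2" where
  "torus = vector [vector [2, 0], vector [0, 1 / 2]]"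

text \<open>The entry is -1 because the action uses the inverse: z_0^n is sent to (z_0 +
  z_1)^n.\<close>

definition shear :: "complex ^ 2 ^ 2" where
  "shear = vector [vector [1, - 1], vector [0, 1]]"

lemma torus_SL2: "torus \<in> SL2" and shear_SL2: "shear \<in> SL2"
  by (simp_all add: SL2_iff torus_def shear_def)

lemma act_torus:
  assumes "k \<le> n"
  shows "act torus (bmono n k) = cscale (4 ^ k / 2 ^ n) (bmono n k)"
proof
  fix z
  have "act torus (bmono n k) z = (z $ 1 / 2) ^ (n - k) * (2 * z $ 2) ^ k"
    by (simp add: act_SL2 torus_SL2 bmono_def matvec_2 adj2_def) (simp add: torus_def)
  also have "\<dots> = 2 ^ k / 2 ^ (n - k) * bmono n k z"
    by (simp add: power_mult_distrib power_divide bmono_def)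
  also have "(2 :: complex) ^ k / 2 ^ (n - k) = 4 ^ k / 2 ^ n"
    using assms by (simp add: power_diff power_mult_distrib[symmetric])
  finally show "act torus (bmono n k) z = cscale (4 ^ k / 2 ^ n) (bmono n k) z"
    by (simp add: fun_simps)
qed

lemma act_shear: "act shear (bmono n 0) = (\<Sum>k\<le>n. cscale (of_nat (n choose k)) (bmono n k))"
proof
  fix z
  have "act shear (bmono n 0) z = (z $ 2 + z $ 1) ^ n"
    by (simp add: act_SL2 shear_SL2 bmono_def matvec_2 adj2_def) (simp add: shear_def add.commute)
  also have "\<dots> = (\<Sum>k\<le>n. cscale (of_nat (n choose k)) (bmono n k)) z"
    unfolding binomial_ring by (simp add: fun_simps bmono_def mult_ac)
  finally show "act shear (bmono n 0) z = (\<Sum>k\<le>n. cscale (of_nat (n choose k)) (bmono n k)) z" .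
qed

lemma sum_bmono_eq_iff:
  "(\<Sum>k\<le>n. cscale (b k) (bmono n k)) = (\<Sum>k\<le>n. cscale (c k) (bmono n k)) \<longleftrightarrow> (\<forall>k\<le>n. b k = c k)"
  unfolding sum_bmono_eq_bform bform_eq_iff by simp

lemma act_cscale: "act A (cscale c f) = cscale c (act A f)"
  by (auto simp: act_def fun_simps)

lemma act_sum: "act A (\<Sum>a\<in>S. f a) = (\<Sum>a\<in>S. act A (f a))"
  by (auto simp: act_def fun_eq_iff fun_simps)

text \<open>Schur's lemma: the torus makes an equivariant map diagonal in the monomial basis, and the
  shear, which moves the highest weight vector to a sum of all monomials, equates the eigenvalues.\<close>

lemma equivariant_scalar:
  assumes T: "clinear_on (harmC l) (Sym (2 * l)) T"
    and eq: "\<And>g f. g \<in> SL2 \<Longrightarrow> f \<in> harmC l \<Longrightarrow> T (act (rho g) f) = act g (T f)"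
  shows "\<exists>c. \<forall>f\<in>harmC l. T f = cscale c (Psi l f)"
proof -
  let ?n = "2 * l"
  have "\<exists>c. T (harm_mono l k) = cscale c (bmono ?n k)" if k: "k \<le> ?n" for k
  proof -
    have "T (harm_mono l k) \<in> Sym ?n"
      using T harm_mono_harmonic unfolding clinear_on_def by blast
    then obtain a where a: "T (harm_mono l k) = bform ?n a"
      by (rule Sym_bform)
    define b where "b j = of_nat (?n choose j) * a j" for j
    have b: "T (harm_mono l k) = (\<Sum>j\<le>?n. cscale (b j) (bmono ?n j))"
      by (simp add: a bform_eq_sum b_def)
    have s: "act torus (bmono ?n k) = (\<Sum>j\<le>?n. cscale (if j = k then 4 ^ k / 2 ^ ?n else 0) (bmono ?n j))"
    proof -
      have "(\<Sum>j\<le>?n. cscale (if j = k then 4 ^ k / 2 ^ ?n else 0) (bmono ?n j)) =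
          (\<Sum>j\<le>?n. if j = k then cscale (4 ^ k / 2 ^ ?n) (bmono ?n k) else 0)"
        by (rule sum.cong) auto
      then show ?thesis
        using k by (simp add: act_torus)
    qed
    have "act (rho torus) (harm_mono l k) = (\<Sum>j\<le>?n. cscale (if j = k then 4 ^ k / 2 ^ ?n else 0) (harm_mono l j))"
      by (rule harm_mono_act[OF torus_SL2 k s])
    also have "\<dots> = (\<Sum>j\<le>?n. if j = k then cscale (4 ^ k / 2 ^ ?n) (harm_mono l k) else 0)"
      by (rule sum.cong) auto
    also have "\<dots> = cscale (4 ^ k / 2 ^ ?n) (harm_mono l k)"
      using k by simp
    finally have "T (cscale (4 ^ k / 2 ^ ?n) (harm_mono l k)) = act torus (T (harm_mono l k))"
      using eq[OF torus_SL2 harm_mono_harmonic, of k] by simp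
    moreover have "T (cscale (4 ^ k / 2 ^ ?n) (harm_mono l k)) = cscale (4 ^ k / 2 ^ ?n) (T (harm_mono l k))"
      using T harm_mono_harmonic unfolding clinear_on_def by blast
    ultimately have "(\<Sum>j\<le>?n. cscale (4 ^ k / 2 ^ ?n * b j) (bmono ?n j)) =
        (\<Sum>j\<le>?n. cscale (b j) (act torus (bmono ?n j)))"
      unfolding b act_sum act_cscale cscale_sum cscale_cscale by simp
    also have "\<dots> = (\<Sum>j\<le>?n. cscale (b j * (4 ^ j / 2 ^ ?n)) (bmono ?n j))"
      by (intro sum.cong refl) (simp add: act_torus cscale_cscale)
    finally have e: "\<forall>j\<le>?n. 4 ^ k / 2 ^ ?n * b j = b j * (4 ^ j / 2 ^ ?n)"
      unfolding sum_bmono_eq_iff .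
    \<comment> \<open>Distinct torus eigenvalues force the coefficient to vanish; taking norms moves
      the equation of powers to the reals, where the base exceeds 1.\<close>
    have z: "b j = 0" if "j \<le> ?n" "j \<noteq> k" for j
    proof (rule ccontr)
      assume "b j \<noteq> 0"
      then have "(4 :: complex) ^ k = 4 ^ j"
        using e[rule_format, OF that(1)] by simp
      from arg_cong[OF this, of norm] have "(4 :: real) ^ k = 4 ^ j"
        by (simp add: norm_power)
      then show False
        using that(2) by (simp add: power_inject_exp)
    qed
    have "T (harm_mono l k) = (\<Sum>j\<le>?n. if j = k then cscale (b k) (bmono ?n k) else 0)"
      unfolding b by (intro sum.cong refl) (auto simp: z)
    also have "\<dots> = cscale (b k) (bmono ?n k)"
      using k by simp
    finally show ?thesis
      by blast
  qed
  then obtain c where c: "\<And>k. k \<le> ?n \<Longrightarrow> T (harm_mono l k) = cscale (c k) (bmono ?n k)"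
    by metis
  \<comment> \<open>The image of one vector is computed twice: linearity brings in every
    \<open>c k\<close>, equivariance only \<open>c 0\<close>. All binomials involved are
    nonzero.\<close>
  have "T (act (rho shear) (harm_mono l 0)) = (\<Sum>k\<le>?n. cscale (of_nat (?n choose k)) (T (harm_mono l k)))"
    unfolding harm_mono_act[OF shear_SL2 le0 act_shear]
    by (rule clinear_on_sum[OF T harm_mono_harmonic])
  also have "\<dots> = (\<Sum>k\<le>?n. cscale (of_nat (?n choose k) * c k) (bmono ?n k))"
    by (intro sum.cong refl) (simp add: c cscale_cscale)
  also have "T (act (rho shear) (harm_mono l 0)) = cscale (c 0) (act shear (bmono ?n 0))"
    using eq[OF shear_SL2 harm_mono_harmonic] c[of 0] by (simp add: act_cscale)
  also have "\<dots> = (\<Sum>k\<le>?n. cscale (c 0 * of_nat (?n choose k)) (bmono ?n k))"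
    unfolding act_shear cscale_sum cscale_cscale ..
  finally have "\<forall>k\<le>?n. c 0 * of_nat (?n choose k) = of_nat (?n choose k) * c k"
    unfolding sum_bmono_eq_iff .
  then have c0: "c k = c 0" if "k \<le> ?n" for k
    using that by simp
  have c': "T (harm_mono l k) = cscale (c 0) (bmono ?n k)" if "k \<le> ?n" for k
    using c[OF that] c0[OF that] by metis
  have "T f = cscale (c 0) (Psi l f)" if f: "f \<in> harmC l" for f
  proof -
    obtain d where d: "f = (\<Sum>k\<le>?n. cscale (d k) (harm_mono l k))"
      using harmC_expansion[OF f] .
    have "T f = (\<Sum>k\<le>?n. cscale (d k) (T (harm_mono l k)))"
      unfolding d by (rule clinear_on_sum[OF T harm_mono_harmonic])
    also have "\<dots> = (\<Sum>k\<le>?n. cscale (d k) (cscale (c 0) (bmono ?n k)))"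
      by (intro sum.cong refl) (simp add: c')
    also have "\<dots> = cscale (c 0) (f \<circ> vmap)"
      unfolding d comp_sum comp_cscale cscale_sum cscale_cscale
      by (intro sum.cong refl) (simp add: harm_mono_vmap mult.commute)
    finally show ?thesis
      by (simp add: Psi_apply[OF f])
  qed
  then show ?thesis
    by blast
qed

section \<open>The real form\<close>

lemma poly_conj_apply: "poly_conj f x = cnj (f (\<chi> i. cnj (x $ i)))"
  by (simp add: poly_conj_def)

lemma poly_conj_add: "poly_conj (f + g) = poly_conj f + poly_conj g"
  by (auto simp: fun_eq_iff fun_simps poly_conj_apply)

lemma poly_conj_diff: "poly_conj (f - g) = poly_conj f - poly_conj g"
  by (auto simp: fun_eq_iff fun_simps poly_conj_apply)

lemma poly_conj_cscale: "poly_conj (cscale c f) = cscale (cnj c) (poly_conj f)"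
  by (auto simp: fun_eq_iff fun_simps poly_conj_apply)

lemma poly_conj_mult: "poly_conj (f * g) = poly_conj f * poly_conj g"
  by (auto simp: fun_eq_iff fun_simps poly_conj_apply)

lemma poly_conj_coord: "poly_conj (coord i) = coord i"
  by (auto simp: fun_eq_iff fun_simps poly_conj_apply)

lemma poly_conj_const: "poly_conj (const_fun c) = const_fun (cnj c)"
  by (auto simp: fun_eq_iff fun_simps poly_conj_apply)

lemma poly_conj_0 [simp]: "poly_conj 0 = 0"
  by (auto simp: fun_eq_iff fun_simps poly_conj_apply)

lemma poly_conj_sum: "poly_conj (\<Sum>a\<in>A. f a) = (\<Sum>a\<in>A. poly_conj (f a))"
  by (induction A rule: infinite_finite_induct) (simp_all add: poly_conj_add)

lemma poly_conj_poly_conj [simp]: "poly_conj (poly_conj f) = f"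
  by (auto simp: fun_eq_iff poly_conj_apply)

lemma poly_conj_monomial: "poly_conj (monomial_fun \<alpha>) = monomial_fun \<alpha>"
  by (auto simp: fun_eq_iff poly_conj_apply monomial_fun_def)

lemma poly_conj_homog: "f \<in> homog (int d) \<Longrightarrow> poly_conj f \<in> homog (int d)"
proof (induction rule: homog_gen_induct)
  case one
  show "poly_conj (const_fun 1) \<in> homog (int 0)"
    by (simp add: poly_conj_const const_homog)
next
  case (add d f g)
  show "poly_conj (f + g) \<in> homog (int d)"
    unfolding poly_conj_add by (rule homog_add[OF add(3,4)])
next
  case (cscale d c f)
  show "poly_conj (cscale c f) \<in> homog (int d)"
    unfolding poly_conj_cscale by (rule homog_cscale[OF cscale(2)])
next
  case (step d i f)
  show "poly_conj (coord i * f) \<in> homog (int (Suc d))"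
    unfolding poly_conj_mult poly_conj_coord by (rule coord_mult_homog[OF step(2)])
qed

lemma poly_conj_polys: "f \<in> polys \<Longrightarrow> poly_conj f \<in> polys"
proof (induction rule: polys_homog_induct)
  case (add f g)
  show "poly_conj (f + g) \<in> polys"
    unfolding poly_conj_add by (rule polys_add[OF add(3,4)])
next
  case (homog d f)
  then show "poly_conj f \<in> polys"
    by (rule homog_polys[OF poly_conj_homog])
qed

lemma partial_poly_conj: "f \<in> polys \<Longrightarrow> partial i (poly_conj f) = poly_conj (partial i f)"
proof (induction rule: polys_gen_induct)
  case one
  show "partial i (poly_conj (const_fun 1)) = poly_conj (partial i (const_fun 1))"
    by (simp add: poly_conj_const partial_const)
next
  case (add f g)
  show "partial i (poly_conj (f + g)) = poly_conj (partial i (f + g))"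
    using add(1,2) by (simp only: poly_conj_add partial_add poly_conj_polys add(3,4))
next
  case (cscale c f)
  show "partial i (poly_conj (cscale c f)) = poly_conj (partial i (cscale c f))"
    using cscale(1) by (simp only: poly_conj_cscale partial_cscale poly_conj_polys cscale(2))
next
  case (step k f)
  show "partial i (poly_conj (coord k * f)) = poly_conj (partial i (coord k * f))"
    using step(1)
    by (simp only: poly_conj_mult partial_mult coord_polys poly_conj_polys poly_conj_coord poly_conj_add
        partial_coord poly_conj_const step(2)) simp
qed

lemma laplacian_poly_conj: "f \<in> polys \<Longrightarrow> laplacian (poly_conj f) = poly_conj (laplacian f)"
  unfolding laplacian_def poly_conj_sum by (simp add: partial_poly_conj partial_polys)

lemma poly_conj_harmC: "f \<in> harmC l \<Longrightarrow> poly_conj f \<in> harmC l"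
  using laplacian_poly_conj[OF harmC_polys] by (simp add: harmC_def poly_conj_homog)

lemma real_polys_poly_conj: "f \<in> real_polys \<Longrightarrow> poly_conj f = f"
  unfolding real_polys_def by (auto simp: poly_conj_sum poly_conj_cscale poly_conj_monomial)

text \<open>Averaging f with its conjugate replaces each coefficient by its real part, in whichever
  representation of f is at hand.\<close>

lemma poly_conj_real_polys:
  assumes "f \<in> polys" "poly_conj f = f"
  shows "f \<in> real_polys"
proof -
  obtain S c where f: "f = (\<Sum>\<alpha>\<in>S. cscale (c \<alpha>) (monomial_fun \<alpha>))" "finite S"
    using assms(1) unfolding polys_def by blast
  have "f = cscale (1 / 2) (f + poly_conj f)"
    unfolding assms(2) by (auto simp: fun_eq_iff fun_simps)
  also have "\<dots> = (\<Sum>\<alpha>\<in>S. cscale ((c \<alpha> + cnj (c \<alpha>)) / 2) (monomial_fun \<alpha>))"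
    unfolding f(1) poly_conj_sum poly_conj_cscale poly_conj_monomial sum.distrib[symmetric] cscale_sum
    by (intro sum.cong refl) (auto simp: fun_eq_iff fun_simps field_simps)
  also have "\<dots> = (\<Sum>\<alpha>\<in>S. cscale (of_real (Re (c \<alpha>))) (monomial_fun \<alpha>))"
    by (simp add: complex_add_cnj)
  finally have e: "f = (\<Sum>\<alpha>\<in>S. cscale (of_real (Re (c \<alpha>))) (monomial_fun \<alpha>))" .
  show ?thesis
    unfolding real_polys_def mem_Collect_eq
    by (intro exI[of _ S] exI[of _ "\<lambda>\<alpha>. Re (c \<alpha>)"] conjI e f(2))
qed

lemma harmR_iff: "f \<in> harmR l \<longleftrightarrow> f \<in> harmC l \<and> poly_conj f = f"
  unfolding harmR_def using real_polys_poly_conj poly_conj_real_polys harmC_polys by blast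

text \<open>The quaternionic map j covers complex conjugation on the cone up to a minus sign; by
  homogeneity this sign becomes the factor (-1)^l in \<open>sigma_form\<close>.\<close>

lemma vmap_jmap: "vmap (jmap z) = - (\<chi> i. cnj (vmap z $ i))"
  by (simp add: vec_eq_iff forall_3 vmap_nth jmap_def algebra_simps)

lemma homog_uminus_arg: "f \<in> homog (int d) \<Longrightarrow> f (- x) = (- 1) ^ d * f x"
  unfolding vector_sneg_minus1[of x] by (rule homog_scale)

lemma poly_conj_comp_vmap:
  assumes "f \<in> harmC l"
  shows "poly_conj f \<circ> vmap = sigma_form l (f \<circ> vmap)"
proof
  fix z
  have "(\<chi> i. cnj (vmap z $ i)) = - vmap (jmap z)"
    by (simp add: vmap_jmap)
  then show "(poly_conj f \<circ> vmap) z = sigma_form l (f \<circ> vmap) z"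
    by (simp add: poly_conj_apply sigma_form_def homog_uminus_arg[OF harmC_homog[OF assms]])
qed

lemma Psi_poly_conj: "f \<in> harmC l \<Longrightarrow> Psi l (poly_conj f) = sigma_form l (Psi l f)"
  by (simp add: Psi_apply poly_conj_harmC poly_conj_comp_vmap)

lemma Psi_harmR: "Psi l ` harmR l = Fix_sigma l"
proof
  show "Psi l ` harmR l \<subseteq> Fix_sigma l"
  proof safe
    fix f assume "f \<in> harmR l"
    then have f: "f \<in> harmC l" "poly_conj f = f"
      by (simp_all add: harmR_iff)
    then have "sigma_form l (Psi l f) = Psi l f"
      using Psi_poly_conj[OF f(1)] by simp
    moreover have "Psi l f \<in> Sym (2 * l)"
      using Psi_surj f(1) by blast
    ultimately show "Psi l f \<in> Fix_sigma l"
      unfolding Fix_sigma_def by blast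
  qed
  show "Fix_sigma l \<subseteq> Psi l ` harmR l"
  proof
    fix F assume F: "F \<in> Fix_sigma l"
    then obtain f where f: "f \<in> harmC l" "F = Psi l f"
      using Psi_surj[of l] unfolding Fix_sigma_def by blast
    have "Psi l (poly_conj f) = Psi l f"
      using F unfolding Fix_sigma_def Psi_poly_conj[OF f(1)] f(2) by blast
    then have "poly_conj f = f"
      by (rule inj_onD[OF Psi_inj _ poly_conj_harmC[OF f(1)] f(1)])
    then show "F \<in> Psi l ` harmR l"
      unfolding f(2) using f(1) harmR_iff by blast
  qed
qed

lemma sigma_form_bform: "sigma_form l (bform (2 * l) a) = bform (2 * l) (\<lambda>k. (- 1) ^ (l + k) * cnj (a (2 * l - k)))"
proof
  fix z
  have "sigma_form l (bform (2 * l) a) z = (\<Sum>k\<le>2 * l. (- 1) ^ l *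
      (of_nat ((2 * l) choose k) * cnj (a k) * (- (z $ 2)) ^ (2 * l - k) * (z $ 1) ^ k))"
    by (simp add: sigma_form_def bform_def jmap_def sum_distrib_left)
  also have "\<dots> = (\<Sum>k\<le>2 * l. (- 1) ^ l *
      (of_nat ((2 * l) choose (2 * l - k)) * cnj (a (2 * l - k)) * (- (z $ 2)) ^ (2 * l - (2 * l - k)) * (z $ 1) ^ (2 * l - k)))"
    by (rule sum.reindex_bij_witness[of _ "\<lambda>k. 2 * l - k" "\<lambda>k. 2 * l - k"]) auto
  also have "\<dots> = bform (2 * l) (\<lambda>k. (- 1) ^ (l + k) * cnj (a (2 * l - k))) z"
    unfolding bform_def
    by (intro sum.cong refl) (simp add: binomial_symmetric[symmetric] power_minus[of "z $ 2"] power_add mult_ac)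
  finally show "sigma_form l (bform (2 * l) a) z = bform (2 * l) (\<lambda>k. (- 1) ^ (l + k) * cnj (a (2 * l - k))) z" .
qed

lemma neg_one_power_diff: "k \<le> 2 * l \<Longrightarrow> (- 1 :: complex) ^ (2 * l - k) = (- 1) ^ k"
  by (simp add: uminus_power_if)

lemma sigma_form_bform_fixed_iff:
  "sigma_form l (bform (2 * l) a) = bform (2 * l) a \<longleftrightarrow> (\<forall>k\<le>2 * l. a (2 * l - k) = (- 1) ^ (l + k) * cnj (a k))"
  unfolding sigma_form_bform bform_eq_iff
proof safe
  fix k assume *: "\<forall>k\<le>2 * l. (- 1) ^ (l + k) * cnj (a (2 * l - k)) = a k" and k: "k \<le> 2 * l"
  from *[rule_format, of "2 * l - k", OF diff_le_self] show "a (2 * l - k) = (- 1) ^ (l + k) * cnj (a k)"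
    unfolding power_add neg_one_power_diff[OF k] diff_diff_cancel[OF k] by simp
next
  fix k assume *: "\<forall>k\<le>2 * l. a (2 * l - k) = (- 1) ^ (l + k) * cnj (a k)" and k: "k \<le> 2 * l"
  from *[rule_format, of "2 * l - k", OF diff_le_self] show "(- 1) ^ (l + k) * cnj (a (2 * l - k)) = a k"
    unfolding power_add neg_one_power_diff[OF k] diff_diff_cancel[OF k] by simp
qed

lemma Fix_sigma_eq:
  "Fix_sigma l = {bform (2 * l) a | a. \<forall>k\<le>2 * l. a (2 * l - k) = (- 1) ^ (l + k) * cnj (a k)}"
proof safe
  fix F assume F: "F \<in> Fix_sigma l"
  then obtain a where a: "F = bform (2 * l) a"
    unfolding Fix_sigma_def using Sym_bform by blast
  then have "\<forall>k\<le>2 * l. a (2 * l - k) = (- 1) ^ (l + k) * cnj (a k)"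
    using F unfolding Fix_sigma_def by (simp add: sigma_form_bform_fixed_iff)
  then show "\<exists>a. F = bform (2 * l) a \<and> (\<forall>k\<le>2 * l. a (2 * l - k) = (- 1) ^ (l + k) * cnj (a k))"
    using a by blast
next
  fix a :: "nat \<Rightarrow> complex"
  assume "\<forall>k\<le>2 * l. a (2 * l - k) = (- 1) ^ (l + k) * cnj (a k)"
  then have "sigma_form l (bform (2 * l) a) = bform (2 * l) a"
    by (simp only: sigma_form_bform_fixed_iff)
  then show "bform (2 * l) a \<in> Fix_sigma l"
    using bform_homog unfolding Fix_sigma_def by blast
qed

text \<open>Both sides are harmonic, so it suffices to compare their forms, where conjugation is
  \<open>sigma_form\<close> and exchanges the two variables up to sign.\<close>

lemma poly_conj_harm_basis:
  assumes "k \<le> 2 * l"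
  shows "poly_conj (harm_basis l k) = cscale ((- 1) ^ (l + k)) (harm_basis l (2 * l - k))"
proof -
  have h: "poly_conj (harm_basis l k) \<in> harmC l" "cscale ((- 1) ^ (l + k)) (harm_basis l (2 * l - k)) \<in> harmC l"
    by (intro poly_conj_harmC harmC_cscale harm_basis_harmonic)+
  have "poly_conj (harm_basis l k) \<circ> vmap = cscale ((- 1) ^ (l + k)) (harm_basis l (2 * l - k)) \<circ> vmap"
  proof
    fix z
    have "(poly_conj (harm_basis l k) \<circ> vmap) z =
        (- 1) ^ l * ((- 2) ^ l * of_nat ((2 * l) choose k) * (- 1) ^ k * (- (z $ 2)) ^ k * (z $ 1) ^ (2 * l - k))"
      unfolding poly_conj_comp_vmap[OF harm_basis_harmonic]
      by (simp add: sigma_form_def harm_basis_vmap[OF assms]) (simp add: jmap_def)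
    also have "\<dots> = (- 1) ^ l * ((- 2) ^ l * of_nat ((2 * l) choose k) * (z $ 2) ^ k * (z $ 1) ^ (2 * l - k))"
      by (simp add: power_minus[of "z $ 2"] mult_ac)
    also have "\<dots> = (cscale ((- 1) ^ (l + k)) (harm_basis l (2 * l - k)) \<circ> vmap) z"
      unfolding o_apply cscale_apply harm_basis_vmap[OF diff_le_self] binomial_symmetric[OF assms, symmetric]
        diff_diff_cancel[OF assms] neg_one_power_diff[OF assms] power_add
      by (cases "even k") (simp_all add: mult_ac)
    finally show "(poly_conj (harm_basis l k) \<circ> vmap) z =
        (cscale ((- 1) ^ (l + k)) (harm_basis l (2 * l - k)) \<circ> vmap) z" .
  qed
  then show ?thesis
    using inj_onD[OF Psi_inj _ h] h by (simp add: Psi_apply)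
qed

section \<open>Restriction to the real sphere\<close>

lemma cvec_nth [simp]: "cvec x $ i = complex_of_real (x $ i)"
  by (simp add: cvec_def)

lemma poly_conj_cvec: "poly_conj f (cvec x) = cnj (f (cvec x))"
proof -
  have "(\<chi> i. cnj (cvec x $ i)) = cvec x"
    by (simp add: vec_eq_iff)
  then show ?thesis
    by (simp only: poly_conj_apply)
qed

lemma polys_one_variable:
  assumes "f \<in> polys"
  shows "\<exists>p. \<forall>t. f (upd x i t) = poly p t"
  using assms
proof (induction rule: polys_gen_induct)
  case one
  show "\<exists>p. \<forall>t. const_fun 1 (upd x i t) = poly p t"
    by (intro exI[of _ "[:1:]"]) (simp add: fun_simps)
next
  case (add f g)
  then obtain p r where "\<forall>t. f (upd x i t) = poly p t" "\<forall>t. g (upd x i t) = poly r t"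
    by blast
  then show "\<exists>p. \<forall>t. (f + g) (upd x i t) = poly p t"
    by (intro exI[of _ "p + r"]) (simp add: fun_simps)
next
  case (cscale c f)
  then obtain p where "\<forall>t. f (upd x i t) = poly p t"
    by blast
  then show "\<exists>p. \<forall>t. (cscale c f) (upd x i t) = poly p t"
    by (intro exI[of _ "Polynomial.smult c p"]) (simp add: fun_simps)
next
  case (step k f)
  then obtain p where p: "\<forall>t. f (upd x i t) = poly p t"
    by blast
  show "\<exists>p. \<forall>t. (coord k * f) (upd x i t) = poly p t"
    using p by (intro exI[of _ "(if k = i then [:0, 1:] else [:x $ k:]) * p"]) (simp add: fun_simps upd_nth)
qed

lemma infinite_of_real: "infinite (range complex_of_real)"
  using infinite_UNIV_char_0[where 'a = real] by (simp add: finite_image_iff inj_on_def)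

lemma polys_vanish_one_variable:
  assumes "f \<in> polys" "\<And>t. f (upd x i (of_real t)) = 0"
  shows "f (upd x i t) = 0"
proof -
  obtain p where p: "\<And>t. f (upd x i t) = poly p t"
    using polys_one_variable[OF assms(1)] by blast
  have "range complex_of_real \<subseteq> {t. poly p t = 0}"
    using assms(2) p by auto
  then have "infinite {t. poly p t = 0}"
    using infinite_of_real finite_subset by blast
  then have "p = 0"
    using poly_roots_finite by blast
  then show ?thesis
    by (simp add: p)
qed

text \<open>The coordinates are freed one after another: in a single variable, a polynomial with all
  real numbers as roots is 0.\<close>

lemma polys_vanish_real:
  assumes "f \<in> polys" "\<And>x. f (cvec x) = 0"
  shows "f = 0"
proof -
  have v: "upd (vector [a, b, c] :: complex ^ 3) 1 t = vector [t, b, c]" "upd (vector [a, b, c] :: complex ^ 3) 2 t = vector [a, t, c]"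
    "upd (vector [a, b, c] :: complex ^ 3) 3 t = vector [a, b, t]" for a b c t :: complex
    by (simp_all add: vec_eq_iff forall_3 upd_nth)
  have 0: "f (vector [of_real a, of_real b, of_real c]) = 0" for a b c
  proof -
    have "cvec (vector [a, b, c]) = vector [of_real a, of_real b, of_real c]"
      by (simp add: vec_eq_iff forall_3)
    then show ?thesis
      using assms(2) by metis
  qed
  have 1: "f (vector [a, of_real b, of_real c]) = 0" for a b c
    using polys_vanish_one_variable[OF assms(1), of "vector [0, of_real b, of_real c]" 1 a] 0 by (simp add: v)
  have 2: "f (vector [a, b, of_real c]) = 0" for a b c
    using polys_vanish_one_variable[OF assms(1), of "vector [a, 0, of_real c]" 2 b] 1 by (simp add: v)
  have 3: "f (vector [a, b, c]) = 0" for a b c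
    using polys_vanish_one_variable[OF assms(1), of "vector [a, b, 0]" 3 c] 2 by (simp add: v)
  show ?thesis
  proof
    fix x :: "complex ^ 3"
    have "x = vector [x $ 1, x $ 2, x $ 3]"
      by (simp add: vec_eq_iff forall_3)
    then show "f x = 0 x"
      using 3 by (metis zero_fun_apply)
  qed
qed

lemma sph_nth [simp]: "sph \<theta> \<phi> $ 1 = sin \<theta> * cos \<phi>" "sph \<theta> \<phi> $ 2 = sin \<theta> * sin \<phi>" "sph \<theta> \<phi> $ 3 = cos \<theta>"
  by (simp_all add: sph_def)

lemma norm_vec3: "norm (x :: real ^ 3) = 1 \<longleftrightarrow> (x $ 1)\<^sup>2 + (x $ 2)\<^sup>2 + (x $ 3)\<^sup>2 = 1"
proof -
  have "norm x = 1 \<longleftrightarrow> (norm x)\<^sup>2 = 1"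
    by (simp add: power2_eq_1_iff) (metis norm_ge_zero neg_0_le_iff_le not_one_le_zero)
  then show ?thesis
    unfolding power2_norm_eq_inner inner_vec_def sum_3 by (simp add: power2_eq_square)
qed

lemma sphere_sph:
  assumes "norm (x :: real ^ 3) = 1"
  obtains \<theta> \<phi> where "\<theta> \<in> {0..pi}" "x = sph \<theta> \<phi>"
proof -
  have n: "(x $ 1)\<^sup>2 + (x $ 2)\<^sup>2 + (x $ 3)\<^sup>2 = 1"
    using assms by (simp add: norm_vec3)
  have "(x $ 3)\<^sup>2 \<le> 1"
    using n sum_power2_ge_zero[of "x $ 1" "x $ 2"] by linarith
  then have x3: "- 1 \<le> x $ 3" "x $ 3 \<le> 1"
    by (simp_all add: abs_square_le_1 abs_le_iff)
  define \<theta> where "\<theta> = arccos (x $ 3)"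
  have t: "\<theta> \<in> {0..pi}" "cos \<theta> = x $ 3"
    using x3 arccos_lbound arccos_ubound by (auto simp: \<theta>_def)
  have s: "(sin \<theta>)\<^sup>2 = (x $ 1)\<^sup>2 + (x $ 2)\<^sup>2"
    using n by (simp add: sin_squared_eq t(2))
  show ?thesis
  proof (cases "sin \<theta> = 0")
    \<comment> \<open>At a pole the azimuth is arbitrary; 0 is chosen.\<close>
    case True
    then have "x $ 1 = 0 \<and> x $ 2 = 0"
      using s by (simp add: sum_power2_eq_zero_iff)
    then have "x = sph \<theta> 0"
      using True t by (simp add: vec_eq_iff forall_3)
    then show ?thesis
      using that t(1) by blast
  next
    case False
    then have "(x $ 1 / sin \<theta>)\<^sup>2 + (x $ 2 / sin \<theta>)\<^sup>2 = 1"
      unfolding power_divide add_divide_distrib[symmetric] s[symmetric] by simp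
    then obtain \<phi> where "x $ 1 / sin \<theta> = cos \<phi>" "x $ 2 / sin \<theta> = sin \<phi>"
      using sincos_total_2pi by metis
    then have "x = sph \<theta> \<phi>"
      using False t by (simp add: vec_eq_iff forall_3 field_simps)
    then show ?thesis
      using that t(1) by blast
  qed
qed

text \<open>Homogeneity extends the zeros from the sphere to real space. This is what makes
  \<open>Y\<close> well defined by its values on the sphere.\<close>

lemma homog_vanish_sphere:
  assumes "f \<in> homog (int d)" "\<And>\<theta> \<phi>. \<theta> \<in> {0..pi} \<Longrightarrow> f (cvec (sph \<theta> \<phi>)) = 0"
  shows "f = 0"
proof (rule polys_vanish_real[OF homog_polys[OF assms(1)]])
  fix x :: "real ^ 3"
  obtain u :: "real ^ 3" where u: "norm u = 1" "x = norm x *\<^sub>R u"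
  proof (cases "x = 0")
    case True
    then show ?thesis
      using that[of "axis 1 1"] by (simp add: norm_axis_1)
  next
    case False
    then show ?thesis
      using that[of "x /\<^sub>R norm x"] by simp
  qed
  obtain \<theta> \<phi> where "\<theta> \<in> {0..pi}" "u = sph \<theta> \<phi>"
    using sphere_sph[OF u(1)] .
  then have "f (cvec u) = 0"
    using assms(2) by simp
  moreover have "cvec x = of_real (norm x) *s cvec u"
    by (subst u(2)) (simp add: vec_eq_iff)
  ultimately show "f (cvec x) = 0"
    using homog_scale[OF assms(1)] by simp
qed

lemma is_Y_unique: "is_Y l m f \<Longrightarrow> is_Y l m g \<Longrightarrow> f = g"
proof -
  assume "is_Y l m f" "is_Y l m g"
  then have h: "f - g \<in> homog (int l)"
      "\<And>\<theta> \<phi>. \<theta> \<in> {0..pi} \<Longrightarrow> (f - g) (cvec (sph \<theta> \<phi>)) = 0"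
    by (auto simp: is_Y_def harmR_iff minus_apply intro: homog_diff harmC_homog)
  have "f - g = 0"
    by (rule homog_vanish_sphere[OF h])
  then show "f = g"
    by simp
qed

lemma Y_eq: "is_Y l m f \<Longrightarrow> Y l m = f"
  unfolding Y_def using is_Y_unique by (blast intro: the_equality)

section \<open>Spherical harmonics\<close>

lemma coeff_quadratic_power_Suc:
  fixes a b c :: "'a :: comm_ring_1"
  shows "poly.coeff ([:a, b, c:] ^ Suc l) k = a * poly.coeff ([:a, b, c:] ^ l) k +
    (case k of 0 \<Rightarrow> 0 | Suc m \<Rightarrow> b * poly.coeff ([:a, b, c:] ^ l) m +
      (case m of 0 \<Rightarrow> 0 | Suc n \<Rightarrow> c * poly.coeff ([:a, b, c:] ^ l) n))"
  by (auto simp: coeff_pCons split: nat.splits)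

lemma coeff_quadratic_of_real:
  "poly.coeff ([:complex_of_real a, complex_of_real b, complex_of_real c:] ^ l) k =
    complex_of_real (poly.coeff ([:a, b, c:] ^ l) k)"
proof (induction l arbitrary: k)
  case (Suc l)
  show ?case
    unfolding coeff_quadratic_power_Suc by (auto simp: Suc split: nat.splits)
qed (auto simp: coeff_pCons split: nat.splits)

text \<open>This is the substitution t = u s: since u w = 1, it turns a u + b t + c w t^2 into u (a
  + b s + c s^2), and the claim compares the coefficients of s^k.\<close>

lemma coeff_quadratic_twist:
  fixes a b c u w :: complex
  assumes "u * w = 1"
  shows "poly.coeff ([:a * u, b, c * w:] ^ l) k * u ^ k = u ^ l * poly.coeff ([:a, b, c:] ^ l) k"
proof (induction l arbitrary: k)
  case 0
  show ?case
    by (cases k) auto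
next
  case (Suc l)
  let ?q = "poly.coeff ([:a * u, b, c * w:] ^ l)" and ?p = "poly.coeff ([:a, b, c:] ^ l)"
  consider "k = 0" | "k = Suc 0" | n where "k = Suc (Suc n)"
    by (metis not0_implies_Suc)
  then show ?case
  proof cases
    case 1
    then show ?thesis
      unfolding coeff_quadratic_power_Suc using Suc[of 0] by (simp add: mult_ac)
  next
    case 2
    have "(a * u * ?q 1 + b * ?q 0) * u = a * u * (?q 1 * u ^ 1) + b * u * (?q 0 * u ^ 0)"
      by (simp add: algebra_simps)
    also have "\<dots> = u ^ Suc l * (a * ?p 1 + b * ?p 0)"
      unfolding Suc by (simp add: algebra_simps)
    finally show ?thesis
      unfolding 2 coeff_quadratic_power_Suc by simp
  next
    case (3 n)
    have "(a * u * ?q k + (b * ?q (Suc n) + c * w * ?q n)) * u ^ k =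
        a * u * (?q k * u ^ k) + b * u * (?q (Suc n) * u ^ Suc n) + c * (u * w) * u * (?q n * u ^ n)"
      unfolding 3 by (simp add: algebra_simps)
    also have "\<dots> = u ^ Suc l * (a * ?p k + (b * ?p (Suc n) + c * ?p n))"
      unfolding Suc assms by (simp add: algebra_simps)
    finally show ?thesis
      unfolding 3 coeff_quadratic_power_Suc by simp
  qed
qed

text \<open>On the sphere x_1 + i x_2 = sin \<theta> e^(i \<phi>), so the azimuth enters
  \<open>null_poly\<close> exactly as the twist above, and a real polynomial depending on \<theta>
  alone remains.\<close>

lemma harm_basis_sph:
  "harm_basis l k (cvec (sph \<theta> \<phi>)) * cis \<phi> ^ k =
    cis \<phi> ^ l * complex_of_real (poly.coeff ([:sin \<theta>, 2 * cos \<theta>, - sin \<theta>:] ^ l) k)"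
proof -
  have "null_poly (cvec (sph \<theta> \<phi>)) =
      [:of_real (sin \<theta>) * cis \<phi>, of_real (2 * cos \<theta>), of_real (- sin \<theta>) * cis (- \<phi>):]"
    by (simp add: null_poly_def complex_eq_iff)
  then show ?thesis
    using coeff_quadratic_twist[of "cis \<phi>" "cis (- \<phi>)" "of_real (sin \<theta>)" "of_real (2 * cos \<theta>)" "of_real (- sin \<theta>)" l k]
    unfolding harm_basis_def coeff_quadratic_of_real by (simp add: cis_mult)
qed

lemma higher_pderiv_pcompose_linear:
  fixes p :: "real poly"
  shows "(pderiv ^^ k) (pcompose p [:c, d:]) = Polynomial.smult (d ^ k) (pcompose ((pderiv ^^ k) p) [:c, d:])"
proof (induction k)
  case (Suc k)
  then show ?case
    by (simp add: pderiv_smult pderiv_pcompose pderiv_pCons mult.commute)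
qed simp

lemma taylor_coeff:
  fixes p :: "real poly"
  shows "fact k * poly.coeff (pcompose p [:c, d:]) k = d ^ k * poly ((pderiv ^^ k) p) c"
proof -
  have "fact k * poly.coeff (pcompose p [:c, d:]) k = poly.coeff ((pderiv ^^ k) (pcompose p [:c, d:])) 0"
    by (simp add: coeff_higher_pderiv pochhammer_fact)
  also have "\<dots> = poly ((pderiv ^^ k) (pcompose p [:c, d:])) 0"
    by (simp add: poly_0_coeff_0)
  also have "\<dots> = d ^ k * poly ((pderiv ^^ k) p) c"
    by (simp add: higher_pderiv_pcompose_linear poly_pcompose)
  finally show ?thesis .
qed

lemma pcompose_power_eq: "pcompose (p ^ n) q = pcompose p q ^ n" for p q :: "real poly"
  by (induction n) (auto simp: pcompose_mult pcompose_1)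

lemma rodrigues:
  "(pderiv ^^ (l + m)) ([:- 1, 0, 1:] ^ l) = Polynomial.smult (2 ^ l * fact l) ((pderiv ^^ m) (legendre l))"
  by (simp add: legendre_def higher_pderiv_smult add.commute[of l] funpow_add)

text \<open>By (c - s t)^2 - 1 = -s (s + 2 c t - s t^2), the l-th power of the quadratic is, up to
  (-s)^l, the Taylor expansion of (x^2 - 1)^l at c with increment -s t; Rodrigues' formula
  identifies the derivatives.\<close>

lemma zonal_coeff:
  fixes s c :: real
  assumes "s\<^sup>2 + c\<^sup>2 = 1"
  shows "fact (l + m) * poly.coeff ([:s, 2 * c, - s:] ^ l) (l + m) =
    2 ^ l * fact l * ((- s) ^ m * poly ((pderiv ^^ m) (legendre l)) c)"
proof -
  have taylor: "fact (l + m) * poly.coeff (pcompose [:- 1, 0, 1:] [:c, d:] ^ l) (l + m) =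
      d ^ (l + m) * (2 ^ l * fact l * poly ((pderiv ^^ m) (legendre l)) c)" for d
    using taylor_coeff[of "l + m" "[:- 1, 0, 1:] ^ l" c d]
    unfolding rodrigues by (simp add: pcompose_power_eq)
  have comp: "pcompose [:- 1, 0, 1:] [:c, d:] = [:c\<^sup>2 - 1, 2 * c * d, d\<^sup>2:]" for d
    by (simp add: pcompose_pCons power2_eq_square)
  show ?thesis
  proof (cases "s = 0")
    case False
    have "[:c\<^sup>2 - 1, 2 * c * (- s), (- s)\<^sup>2:] = Polynomial.smult (- s) [:s, 2 * c, - s:]"
      using assms by (simp add: power2_eq_square algebra_simps)
    then have "(- s) ^ l * (fact (l + m) * poly.coeff ([:s, 2 * c, - s:] ^ l) (l + m)) =
        (- s) ^ l * (2 ^ l * fact l * ((- s) ^ m * poly ((pderiv ^^ m) (legendre l)) c))"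
      using taylor[of "- s"] unfolding comp by (simp only: smult_power coeff_smult power_add mult_ac)
    then show ?thesis
      using False by simp
  next
    \<comment> \<open>At s = 0 the factor (-s)^l cannot be cancelled in general. The quadratic
      degenerates to 2 c t with c^2 = 1, and for m = 0 the Legendre value comes from the increment t
      instead: (c + t)^2 - 1 = t (2 c + t).\<close>
    case True
    have "[:s, 2 * c, - s:] = Polynomial.smult (2 * c) [:0, 1:]"
      by (simp add: True)
    then have e1: "[:s, 2 * c, - s:] ^ l = Polynomial.monom ((2 * c) ^ l) l"
      by (simp only: smult_power monom_altdef)
    show ?thesis
    proof (cases "m = 0")
      case False
      then show ?thesis
        unfolding e1 by (simp add: True)
    next
      case m: True
      have "[:c\<^sup>2 - 1, 2 * c * 1, 1\<^sup>2:] = [:0, 1:] * [:2 * c, 1:]"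
        using assms True by simp
      then have "poly.coeff (pcompose [:- 1, 0, 1:] [:c, 1:] ^ l) l = poly.coeff ([:0, 1:] ^ l * [:2 * c, 1:] ^ l) l"
        unfolding comp by (simp only: power_mult_distrib)
      also have "\<dots> = poly.coeff ([:2 * c, 1:] ^ l) 0"
        using coeff_monom_mult[of 1 l "[:2 * c, 1:] ^ l" l] by (simp add: monom_altdef)
      also have "\<dots> = (2 * c) ^ l"
        by (simp add: coeff_0_power)
      finally show ?thesis
        using taylor[of 1] unfolding m e1 by simp
    qed
  qed
qed

text \<open>The harmonic polynomial with values \<open>P\<^sub>l\<^sup>m(cos \<theta>) e\<^sup>- \<^sup>i \<^sup>m \<^sup>\<phi>\<close> on the sphere.\<close>

definition Ybase :: "nat \<Rightarrow> nat \<Rightarrow> complex ^ 3 \<Rightarrow> complex" where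
  "Ybase l m = cscale (of_real ((- 1) ^ m * fact (l + m) / (2 ^ l * fact l))) (harm_basis l (l + m))"

lemma Ybase_harmC: "Ybase l m \<in> harmC l"
  unfolding Ybase_def by (intro harmC_cscale harm_basis_harmonic)

lemma Ybase_sph:
  assumes "\<theta> \<in> {0..pi}"
  shows "Ybase l m (cvec (sph \<theta> \<phi>)) = of_real (assoc_legendre l m (cos \<theta>)) * cis (- (real m * \<phi>))"
proof -
  let ?e = "poly.coeff ([:sin \<theta>, 2 * cos \<theta>, - sin \<theta>:] ^ l) (l + m)"
  \<comment> \<open>Here the range of \<theta> enters: the sine is nonnegative.\<close>
  have "sqrt (1 - (cos \<theta>)\<^sup>2) = sin \<theta>"
    using assms by (simp add: sin_squared_eq[symmetric] sin_ge_zero)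
  then have P: "assoc_legendre l m (cos \<theta>) = sin \<theta> ^ m * poly ((pderiv ^^ m) (legendre l)) (cos \<theta>)"
    by (simp add: assoc_legendre_def)
  have "fact (l + m) * ?e = 2 ^ l * fact l * ((- 1) ^ m * assoc_legendre l m (cos \<theta>))"
    unfolding P using zonal_coeff[of "sin \<theta>" "cos \<theta>" l m] by (simp add: power_minus[of "sin \<theta>"] mult_ac)
  then have "(- 1) ^ m * (fact (l + m) * ?e) / (2 ^ l * fact l) =
      ((- 1) ^ m * (- 1) ^ m) * assoc_legendre l m (cos \<theta>)"
    by simp
  then have e: "(- 1) ^ m * fact (l + m) / (2 ^ l * fact l) * ?e = assoc_legendre l m (cos \<theta>)"
    unfolding power_add[symmetric] by simp
  \<comment> \<open>\<open>harm_basis_sph\<close> gives the value only together with a power of e^(i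
    \<phi>), so that power is introduced along with its inverse.\<close>
  have "harm_basis l (l + m) (cvec (sph \<theta> \<phi>)) =
      harm_basis l (l + m) (cvec (sph \<theta> \<phi>)) * cis \<phi> ^ (l + m) * cis (- (real (l + m) * \<phi>))"
  proof -
    have "cis \<phi> ^ (l + m) * cis (- (real (l + m) * \<phi>)) = 1"
      by (simp only: Complex.DeMoivre cis_mult add.right_inverse cis_zero)
    then show ?thesis
      unfolding mult.assoc by (simp only: mult_1_right)
  qed
  also have "\<dots> = of_real ?e * (cis \<phi> ^ l * cis (- (real (l + m) * \<phi>)))"
    unfolding harm_basis_sph by simp
  also have "cis \<phi> ^ l * cis (- (real (l + m) * \<phi>)) = cis (- (real m * \<phi>))"
    unfolding Complex.DeMoivre cis_mult by (simp add: algebra_simps)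
  finally have "Ybase l m (cvec (sph \<theta> \<phi>)) =
      of_real ((- 1) ^ m * fact (l + m) / (2 ^ l * fact l) * ?e) * cis (- (real m * \<phi>))"
    unfolding Ybase_def cscale_apply by simp
  then show ?thesis
    unfolding e .
qed

lemma poly_conj_Ybase:
  assumes "m \<le> l"
  shows "poly_conj (Ybase l m) = cscale (of_real (fact (l + m) / (2 ^ l * fact l))) (harm_basis l (l - m))"
proof -
  have k: "l + m \<le> 2 * l" "2 * l - (l + m) = l - m"
    using assms by auto
  have "(- 1 :: complex) ^ m * (- 1) ^ (l + (l + m)) = 1"
    by (simp add: uminus_power_if)
  then have c: "complex_of_real ((- 1) ^ m * fact (l + m) / (2 ^ l * fact l)) * (- 1) ^ (l + (l + m)) =
      of_real (fact (l + m) / (2 ^ l * fact l))"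
    by (simp add: mult_ac)
  show ?thesis
    unfolding Ybase_def poly_conj_cscale poly_conj_harm_basis[OF k(1)] cscale_cscale k(2)
      complex_cnj_complex_of_real c ..
qed

lemma poly_conj_Ybase_0: "poly_conj (Ybase l 0) = Ybase l 0"
  using poly_conj_Ybase[of 0 l] by (simp add: Ybase_def)

lemma is_Y_0: "is_Y l 0 (cscale (of_real (sqrt (2 * real l + 1))) (Ybase l 0))"
  unfolding is_Y_def harmR_iff
  by (auto simp: harmC_cscale Ybase_harmC poly_conj_cscale poly_conj_Ybase_0 cscale_apply Ybase_sph Yang_def
      assoc_legendre_def)

text \<open>\<open>Ybase\<close> carries e^(-i m \<phi>): adding its conjugate yields a multiple of
  2 cos(m \<phi>), and the conjugate minus \<open>Ybase\<close> in the next lemma yields a multiple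
  of 2 i sin(m \<phi>).\<close>

lemma is_Y_pos:
  assumes "1 \<le> m" "m \<le> l"
  shows "is_Y l (int m) (cscale (of_real (Ynorm l m / 2)) (Ybase l m + poly_conj (Ybase l m)))"
  unfolding is_Y_def harmR_iff
proof (intro conjI ballI allI)
  show "cscale (of_real (Ynorm l m / 2)) (Ybase l m + poly_conj (Ybase l m)) \<in> harmC l"
    by (intro harmC_cscale harmC_add poly_conj_harmC Ybase_harmC)
  show "poly_conj (cscale (of_real (Ynorm l m / 2)) (Ybase l m + poly_conj (Ybase l m))) =
      cscale (of_real (Ynorm l m / 2)) (Ybase l m + poly_conj (Ybase l m))"
    by (simp add: poly_conj_cscale poly_conj_add add.commute)
  fix \<theta> \<phi> :: real assume t: "\<theta> \<in> {0..pi}"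
  show "cscale (of_real (Ynorm l m / 2)) (Ybase l m + poly_conj (Ybase l m)) (cvec (sph \<theta> \<phi>)) =
      of_real (Yang l (int m) \<theta> \<phi>)"
    using assms by (simp add: fun_simps poly_conj_cvec Ybase_sph[OF t] Yang_def complex_eq_iff)
qed

lemma is_Y_neg:
  assumes "1 \<le> m" "m \<le> l"
  shows "is_Y l (- int m) (cscale (- \<i> * of_real (Ynorm l m / 2)) (poly_conj (Ybase l m) - Ybase l m))"
  unfolding is_Y_def harmR_iff
proof (intro conjI ballI allI)
  show "cscale (- \<i> * of_real (Ynorm l m / 2)) (poly_conj (Ybase l m) - Ybase l m) \<in> harmC l"
    by (intro harmC_cscale harmC_diff poly_conj_harmC Ybase_harmC)
  show "poly_conj (cscale (- \<i> * of_real (Ynorm l m / 2)) (poly_conj (Ybase l m) - Ybase l m)) =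
      cscale (- \<i> * of_real (Ynorm l m / 2)) (poly_conj (Ybase l m) - Ybase l m)"
    by (simp add: poly_conj_cscale poly_conj_diff) (simp add: fun_eq_iff fun_simps algebra_simps)
  fix \<theta> \<phi> :: real assume t: "\<theta> \<in> {0..pi}"
  show "cscale (- \<i> * of_real (Ynorm l m / 2)) (poly_conj (Ybase l m) - Ybase l m) (cvec (sph \<theta> \<phi>)) =
      of_real (Yang l (- int m) \<theta> \<phi>)"
    using assms by (simp add: fun_simps poly_conj_cvec Ybase_sph[OF t] Yang_def complex_eq_iff)
qed

lemmas Y_0 = Y_eq[OF is_Y_0] and Y_pos = Y_eq[OF is_Y_pos] and Y_neg = Y_eq[OF is_Y_neg]

lemma int_index_cases:
  assumes "m \<in> {- int l..int l}"
  obtains "m = 0" | p where "1 \<le> p" "p \<le> l" "m = int p" | p where "1 \<le> p" "p \<le> l" "m = - int p"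
proof -
  consider "m = 0" | "m > 0" | "m < 0"
    by linarith
  then show thesis
  proof cases
    case 1
    then show ?thesis using that(1) by blast
  next
    case 2
    then show ?thesis using that(2)[of "nat m"] assms by auto
  next
    case 3
    then show ?thesis using that(3)[of "nat (- m)"] assms by auto
  qed
qed

lemma ex1_is_Y: "m \<in> {- int l..int l} \<Longrightarrow> \<exists>!f. is_Y l m f"
  by (erule int_index_cases) (use is_Y_0 is_Y_pos is_Y_neg is_Y_unique in blast)+

lemma is_Y_Y: "m \<in> {- int l..int l} \<Longrightarrow> is_Y l m (Y l m)"
  using ex1_is_Y Y_eq by metis

lemma Y_harmR: "m \<in> {- int l..int l} \<Longrightarrow> Y l m \<in> harmR l"
  using is_Y_Y unfolding is_Y_def by blast

lemma Y_harmC: "m \<in> {- int l..int l} \<Longrightarrow> Y l m \<in> harmC l"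
  using Y_harmR harmR_iff by blast

section \<open>The complex basis and its forms\<close>

lemma calY_0: "calY l 0 = cscale (of_real (sqrt (2 * real l + 1))) (Ybase l 0)"
  by (simp add: calY_def Y_0)

text \<open>The combination with i merges cosine and sine into one exponential, so that a single
  \<open>harm_basis\<close>, hence a single monomial, remains.\<close>

lemma calY_pos:
  assumes "1 \<le> m" "m \<le> l"
  shows "calY l (int m) = cscale ((- 1) ^ m * of_real (Ynorm l m / sqrt 2)) (poly_conj (Ybase l m))"
  using assms by (simp add: calY_def Y_pos Y_neg) (auto simp: fun_eq_iff fun_simps field_simps)

lemma calY_neg:
  assumes "1 \<le> m" "m \<le> l"
  shows "calY l (- int m) = cscale (of_real (Ynorm l m / sqrt 2)) (Ybase l m)"
  using assms by (simp add: calY_def Y_pos Y_neg) (auto simp: fun_eq_iff fun_simps field_simps)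

text \<open>Pulling (l - m)! out of the root cancels it against the binomial, leaving an expression
  symmetric in m and -m.\<close>

lemma Ynorm_Kconst:
  assumes "m \<le> l"
  shows "Ynorm l m / sqrt 2 * (fact (l + m) / fact l * real ((2 * l) choose (l - m))) = Kconst l (int m)"
proof -
  have b: "real ((2 * l) choose (l - m)) = fact (2 * l) / (fact (l - m) * fact (l + m))"
    using binomial_fact[of "l - m" "2 * l", where 'a = real] assms by (simp add: mult_2 algebra_simps)
  have "Ynorm l m / sqrt 2 = sqrt ((2 * real l + 1) * fact (l - m) / fact (l + m))"
  proof -
    have "2 * (2 * real l + 1) * fact (l - m) / fact (l + m) = 2 * ((2 * real l + 1) * fact (l - m) / fact (l + m))"
      by simp
    then show ?thesis
      unfolding Ynorm_def by (simp only: real_sqrt_mult) simp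
  qed
  also have "\<dots> = sqrt ((fact (l - m))\<^sup>2 * ((2 * real l + 1) / (fact (l - m) * fact (l + m))))"
    by (simp add: power2_eq_square)
  also have "\<dots> = fact (l - m) * sqrt ((2 * real l + 1) / (fact (l - m) * fact (l + m)))"
    unfolding real_sqrt_mult by simp
  finally have n: "Ynorm l m / sqrt 2 = fact (l - m) * sqrt ((2 * real l + 1) / (fact (l - m) * fact (l + m)))" .
  have "nat (int l - int m) = l - m" "nat (int l + int m) = l + m"
    using assms by auto
  then show ?thesis
    unfolding n b Kconst_def by simp
qed

lemma Kconst_uminus: "Kconst l (- m) = Kconst l m"
  by (simp add: Kconst_def mult.commute)

lemma Kconst_0: "Kconst l 0 = sqrt (2 * real l + 1) * real ((2 * l) choose l)"
proof -
  have b: "real ((2 * l) choose l) = fact (2 * l) / (fact l * fact l)"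
    using binomial_fact[of l "2 * l", where 'a = real] by (simp add: mult_2)
  show ?thesis
    unfolding b by (simp add: Kconst_def real_sqrt_divide)
qed

lemma harm_basis_scaled_vmap:
  assumes "k \<le> 2 * l"
  shows "cscale (of_real (c / 2 ^ l)) (harm_basis l k) \<circ> vmap =
    cscale ((- 1) ^ (l + k) * of_real (c * real ((2 * l) choose k))) (bmono (2 * l) (2 * l - k))"
proof -
  have "complex_of_real (c / 2 ^ l) * ((- 2) ^ l * of_nat ((2 * l) choose k) * (- 1) ^ k) =
      (- 1) ^ (l + k) * of_real (c * real ((2 * l) choose k))"
    by (simp add: power_add power_minus[of 2])
  then show ?thesis
    unfolding comp_cscale Psi_harm_basis[OF assms] cscale_cscale by simp
qed

lemma Ybase_vmap:
  assumes "m \<le> l"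
  shows "Ybase l m \<circ> vmap = cscale (of_real (fact (l + m) / fact l * real ((2 * l) choose (l - m)))) (bmono (2 * l) (l - m))"
proof -
  have k: "l + m \<le> 2 * l" "2 * l - (l + m) = l - m"
    using assms by auto
  have c: "(2 * l) choose (l + m) = (2 * l) choose (l - m)"
    using binomial_symmetric[OF k(1)] unfolding k(2) .
  have s: "(- 1 :: complex) ^ (l + (l + m)) * (- 1) ^ m = 1"
    by (simp add: uminus_power_if)
  have "(- 1) ^ m * fact (l + m) / (2 ^ l * fact l) = (- 1) ^ m * fact (l + m) / fact l / (2 ^ l :: real)"
    by simp
  then have "Ybase l m \<circ> vmap = cscale ((- 1) ^ (l + (l + m)) *
      of_real ((- 1) ^ m * fact (l + m) / fact l * real ((2 * l) choose (l - m)))) (bmono (2 * l) (l - m))"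
    unfolding Ybase_def using harm_basis_scaled_vmap[OF k(1), of "(- 1) ^ m * fact (l + m) / fact l"]
    unfolding k(2) c by (simp add: mult.commute)
  also have "(- 1) ^ (l + (l + m)) * complex_of_real ((- 1) ^ m * fact (l + m) / fact l * real ((2 * l) choose (l - m))) =
      ((- 1) ^ (l + (l + m)) * (- 1) ^ m) * of_real (fact (l + m) / fact l * real ((2 * l) choose (l - m)))"
    by simp
  finally show ?thesis
    unfolding s mult_1 .
qed

lemma poly_conj_Ybase_vmap:
  assumes "m \<le> l"
  shows "poly_conj (Ybase l m) \<circ> vmap =
    cscale ((- 1) ^ m * of_real (fact (l + m) / fact l * real ((2 * l) choose (l - m)))) (bmono (2 * l) (l + m))"
proof -
  have k: "l - m \<le> 2 * l" "2 * l - (l - m) = l + m"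
    using assms by auto
  have s: "(- 1 :: complex) ^ (l + (l - m)) = (- 1) ^ m"
    using assms by (simp add: uminus_power_if)
  have e: "fact (l + m) / (2 ^ l * fact l) = fact (l + m) / fact l / (2 ^ l :: real)"
    by simp
  show ?thesis
    unfolding poly_conj_Ybase[OF assms] e harm_basis_scaled_vmap[OF k(1)] k(2) s ..
qed

lemma calY_harmC: "m \<in> {- int l..int l} \<Longrightarrow> calY l m \<in> harmC l"
  by (auto simp: calY_def intro!: harmC_cscale harmC_add harmC_diff Y_harmC)

lemma calY_vmap:
  assumes "m \<in> {- int l..int l}"
  shows "calY l m \<circ> vmap = cscale (of_real (Kconst l m)) (bmono (2 * l) (nat (int l + m)))"
  using assms
proof (cases rule: int_index_cases)
  case 1
  then show ?thesis
    by (simp add: calY_0 comp_cscale Ybase_vmap cscale_cscale Kconst_0)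
next
  case (2 p)
  have "(- 1) ^ p * of_real (Ynorm l p / sqrt 2) *
      ((- 1) ^ p * of_real (fact (l + p) / fact l * real ((2 * l) choose (l - p)))) =
      ((- 1) ^ p * (- 1) ^ p) * complex_of_real (Ynorm l p / sqrt 2 * (fact (l + p) / fact l * real ((2 * l) choose (l - p))))"
    by simp
  also have "\<dots> = of_real (Kconst l (int p))"
    unfolding Ynorm_Kconst[OF 2(2)] by (simp flip: power_add)
  finally show ?thesis
    using 2 by (simp add: calY_pos comp_cscale poly_conj_Ybase_vmap cscale_cscale nat_add_distrib)
next
  case (3 p)
  have "nat (int l - int p) = l - p"
    using 3 by simp
  moreover have "complex_of_real (Ynorm l p / sqrt 2) * of_real (fact (l + p) / fact l * real ((2 * l) choose (l - p))) =
      of_real (Kconst l (int p))"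
    unfolding Ynorm_Kconst[OF 3(2), symmetric] by simp
  ultimately show ?thesis
    using 3 by (simp add: calY_neg comp_cscale Ybase_vmap cscale_cscale Kconst_uminus)
qed

lemma Psi_calY:
  assumes "m \<in> {- int l..int l}"
  shows "Psi l (calY l m) = (\<lambda>z. of_real (Kconst l m) * (z $ 1) ^ nat (int l - m) * (z $ 2) ^ nat (int l + m))"
proof -
  have "2 * l - nat (int l + m) = nat (int l - m)"
    using assms by auto
  then show ?thesis
    using assms by (simp add: Psi_apply calY_harmC calY_vmap) (simp add: fun_eq_iff cscale_apply bmono_def)
qed

lemma calY_expansion_coeff:
  assumes f: "f = (\<Sum>m = - int l..int l. cscale (\<eta> m) (calY l m))" "f \<circ> vmap = bform (2 * l) a"
    and m: "m \<in> {- int l..int l}"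
  shows "of_nat ((2 * l) choose nat (int l + m)) * a (nat (int l + m)) = \<eta> m * of_real (Kconst l m)"
proof -
  let ?n = "2 * l" and ?i = "\<lambda>k. int k - int l"
  have "f \<circ> vmap = (\<Sum>m = - int l..int l. cscale (\<eta> m * of_real (Kconst l m)) (bmono ?n (nat (int l + m))))"
    unfolding f(1) comp_sum comp_cscale by (intro sum.cong refl) (simp add: calY_vmap cscale_cscale)
  \<comment> \<open>The weight m corresponds to the exponent k = l + m of z_1.\<close>
  also have "\<dots> = (\<Sum>k\<le>?n. cscale (\<eta> (?i k) * of_real (Kconst l (?i k))) (bmono ?n k))"
    by (rule sum.reindex_bij_witness[of _ ?i "\<lambda>m. nat (int l + m)"]) auto
  finally have "(\<Sum>k\<le>?n. cscale (of_nat (?n choose k) * a k) (bmono ?n k)) =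
      (\<Sum>k\<le>?n. cscale (\<eta> (?i k) * of_real (Kconst l (?i k))) (bmono ?n k))"
    unfolding f(2) bform_eq_sum .
  then have "\<forall>k\<le>?n. of_nat (?n choose k) * a k = \<eta> (?i k) * of_real (Kconst l (?i k))"
    unfolding sum_bmono_eq_iff .
  from this[rule_format, of "nat (int l + m)"] show ?thesis
    using m by auto
qed

lemma Kconst_div_binomial:
  assumes "m \<in> {- int l..int l}"
  shows "Kconst l m / real ((2 * l) choose nat (int l + m)) =
    sqrt ((2 * real l + 1) * fact (nat (int l - m)) * fact (nat (int l + m))) / fact l"
proof -
  define i j where "i = nat (int l - m)" and "j = nat (int l + m)"
  have j: "j \<le> 2 * l" "2 * l - j = i"
    using assms by (auto simp: i_def j_def)
  have b: "real ((2 * l) choose j) = fact (2 * l) / (fact j * fact i)"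
    using binomial_fact[OF j(1), where 'a = real] unfolding j(2) .
  define r :: real where "r = fact i * fact j"
  have "r > 0"
    by (simp add: r_def)
  have "sqrt ((2 * real l + 1) / r) * r = sqrt ((2 * real l + 1) * r)"
  proof -
    have "sqrt ((2 * real l + 1) * r) = sqrt ((2 * real l + 1) / r * r\<^sup>2)"
      using \<open>r > 0\<close> by (simp add: power2_eq_square)
    also have "\<dots> = sqrt ((2 * real l + 1) / r) * r"
      unfolding real_sqrt_mult using \<open>r > 0\<close> by simp
    finally show ?thesis ..
  qed
  then have s: "sqrt ((2 * real l + 1) * r) = sqrt ((2 * real l + 1) / r) * r" ..
  have "Kconst l m / real ((2 * l) choose j) = sqrt ((2 * real l + 1) / r) * r / fact l"
    unfolding b Kconst_def i_def[symmetric] j_def[symmetric] r_def by (simp add: field_simps)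
  also have "\<dots> = sqrt ((2 * real l + 1) * fact i * fact j) / fact l"
    using s by (simp only: r_def mult.assoc)
  finally show ?thesis
    unfolding i_def j_def .
qed

lemma calY_expansion:
  assumes f: "f = (\<Sum>m = - int l..int l. cscale (\<eta> m) (calY l m))" "f \<circ> vmap = bform (2 * l) a"
    and m: "m \<in> {- int l..int l}"
  shows "a (nat (int l + m)) =
    \<eta> m * of_real (sqrt ((2 * real l + 1) * fact (nat (int l - m)) * fact (nat (int l + m))) / fact l)"
proof -
  have "nat (int l + m) \<le> 2 * l"
    using m by auto
  then have c: "((2 * l) choose nat (int l + m)) \<noteq> 0"
    by simp
  have "a (nat (int l + m)) = \<eta> m * of_real (Kconst l m / real ((2 * l) choose nat (int l + m)))"
    using calY_expansion_coeff[OF assms] c by (simp add: field_simps)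
  then show ?thesis
    unfolding Kconst_div_binomial[OF m] .
qed

lemma calY_coefficients:
  assumes "f = (\<Sum>m = - int l..int l. cscale (\<eta> m) (calY l m))" "f \<circ> vmap = bform (2 * l) a"
    "m \<in> {- int l..int l}"
  shows "\<eta> m = fact l * a (nat (int l + m)) /
    of_real (sqrt ((2 * real l + 1) * fact (nat (int l - m)) * fact (nat (int l + m))))"
proof -
  have "sqrt ((2 * real l + 1) * fact (nat (int l - m)) * fact (nat (int l + m))) \<noteq> 0"
    by simp
  then show ?thesis
    unfolding calY_expansion[OF assms] by (simp add: field_simps)
qed

section \<open>Coefficients in the real basis\<close>

lemma sum_symmetric_int:
  fixes f :: "int \<Rightarrow> 'a :: comm_monoid_add"
  shows "(\<Sum>m = - int l..int l. f m) = f 0 + (\<Sum>p = 1..l. f (int p) + f (- int p))"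
proof (induction l)
  case (Suc l)
  have "{- int (Suc l)..int (Suc l)} = insert (- int (Suc l)) (insert (int (Suc l)) {- int l..int l})"
    by auto
  then show ?case
    using Suc by (simp add: add_ac)
qed simp

text \<open>Inverts the definition of \<open>calY\<close>. With C_p for \<open>calY l p\<close> and
  p >= 1, the function with index p is ((-1)^p C_p + C_(-p)) / sqrt 2 and the one with index -p is i
  (C_(-p) - (-1)^p C_p) / sqrt 2; \<eta> collects the resulting coefficients.\<close>

lemma Y_combination:
  fixes c :: "int \<Rightarrow> real"
  defines "\<eta> \<equiv> (\<lambda>m. if m = 0 then of_real (c 0)
    else if m > 0 then (- 1) ^ nat m * (of_real (c m) - \<i> * of_real (c (- m))) / of_real (sqrt 2)
    else (of_real (c (- m)) + \<i> * of_real (c m)) / of_real (sqrt 2))"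
  shows "(\<Sum>m = - int l..int l. cscale (of_real (c m)) (Y l m)) =
    (\<Sum>m = - int l..int l. cscale (\<eta> m) (calY l m))"
  unfolding sum_symmetric_int
proof (rule arg_cong2[where f = "(+)"], goal_cases)
  case 1
  show "cscale (of_real (c 0)) (Y l 0) = cscale (\<eta> 0) (calY l 0)"
    by (simp add: \<eta>_def calY_def)
next
  case 2
  show ?case
  proof (rule sum.cong[OF refl])
    fix p assume "p \<in> {1..l}"
    then have p: "1 \<le> p"
      by simp
    have s: "complex_of_real (sqrt 2) * of_real (sqrt 2) = 2"
      by (simp flip: of_real_mult)
    have n: "(- 1 :: complex) ^ p * (- 1) ^ p = 1"
      by (simp flip: power_add)
    have "cscale (\<eta> (int p)) (calY l (int p)) + cscale (\<eta> (- int p)) (calY l (- int p)) =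
        cscale (((- 1) ^ p * (- 1) ^ p) * (of_real (c (int p)) - \<i> * of_real (c (- int p))) /
            (of_real (sqrt 2) * of_real (sqrt 2))) (Y l (int p) + cscale \<i> (Y l (- int p))) +
        cscale ((of_real (c (int p)) + \<i> * of_real (c (- int p))) /
            (of_real (sqrt 2) * of_real (sqrt 2))) (Y l (int p) - cscale \<i> (Y l (- int p)))"
      using p by (simp add: \<eta>_def calY_def cscale_cscale mult_ac)
    also have "\<dots> = cscale (of_real (c (int p))) (Y l (int p)) + cscale (of_real (c (- int p))) (Y l (- int p))"
    proof
      fix x
      have ii: "\<i> * (\<i> * u) = - u" for u
        by (simp add: complex_eq_iff)
      show "(cscale (((- 1) ^ p * (- 1) ^ p) * (of_real (c (int p)) - \<i> * of_real (c (- int p))) /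
            (of_real (sqrt 2) * of_real (sqrt 2))) (Y l (int p) + cscale \<i> (Y l (- int p))) +
        cscale ((of_real (c (int p)) + \<i> * of_real (c (- int p))) /
            (of_real (sqrt 2) * of_real (sqrt 2))) (Y l (int p) - cscale \<i> (Y l (- int p)))) x =
        (cscale (of_real (c (int p))) (Y l (int p)) + cscale (of_real (c (- int p))) (Y l (- int p))) x"
        unfolding s n fun_simps by (simp add: field_simps ii)
    qed
    finally show "cscale (of_real (c (int p))) (Y l (int p)) + cscale (of_real (c (- int p))) (Y l (- int p)) =
        cscale (\<eta> (int p)) (calY l (int p)) + cscale (\<eta> (- int p)) (calY l (- int p))" ..
  qed
qed

lemma nuconst_eq:
  "sqrt ((2 * real l + 1) * fact (l - p) * fact (l + p)) / fact l / sqrt 2 = nuconst l p"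
  by (simp add: nuconst_def real_sqrt_divide)

lemma nuconst_pos: "nuconst l p > 0"
  by (simp add: nuconst_def)

lemma Y_coefficients:
  fixes c :: "int \<Rightarrow> real"
  assumes f: "f = (\<Sum>m = - int l..int l. cscale (of_real (c m)) (Y l m))" "f \<circ> vmap = bform (2 * l) a"
  shows "a l = of_real (sqrt (2 * real l + 1) * c 0)"
    "\<And>p. p \<in> {1..l} \<Longrightarrow>
      a (l - p) = of_real (nuconst l p) * (of_real (c (int p)) + \<i> * of_real (c (- int p)))"
    "\<And>p. p \<in> {1..l} \<Longrightarrow>
      a (l + p) = (- 1) ^ p * of_real (nuconst l p) * (of_real (c (int p)) - \<i> * of_real (c (- int p)))"
proof -
  note e = calY_expansion[OF f(1)[unfolded Y_combination] f(2)]
  have "sqrt ((2 * real l + 1) * fact l * fact l) / fact l = sqrt (2 * real l + 1)"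
    unfolding mult.assoc power2_eq_square[symmetric] real_sqrt_mult by simp
  then show "a l = of_real (sqrt (2 * real l + 1) * c 0)"
    using e[of 0] by simp
  fix p assume "p \<in> {1..l}"
  then have p: "1 \<le> p" "p \<le> l" "int p \<in> {- int l..int l}" "- int p \<in> {- int l..int l}"
    "nat (int l + int p) = l + p" "nat (int l - int p) = l - p"
    by auto
  let ?s = "sqrt ((2 * real l + 1) * fact (l - p) * fact (l + p)) / fact l"
  have "a (l + p) = (- 1) ^ p * (of_real (c (int p)) - \<i> * of_real (c (- int p))) / of_real (sqrt 2) * of_real ?s"
    using e[OF p(3)] p by simp
  also have "\<dots> = (- 1) ^ p * of_real (?s / sqrt 2) * (of_real (c (int p)) - \<i> * of_real (c (- int p)))"
    by (simp add: mult_ac)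
  finally show "a (l + p) = (- 1) ^ p * of_real (nuconst l p) * (of_real (c (int p)) - \<i> * of_real (c (- int p)))"
    unfolding nuconst_eq .
  have "a (l - p) = (of_real (c (int p)) + \<i> * of_real (c (- int p))) / of_real (sqrt 2) * of_real ?s"
    using e[OF p(4)] p by (simp add: mult_ac)
  also have "\<dots> = of_real (?s / sqrt 2) * (of_real (c (int p)) + \<i> * of_real (c (- int p)))"
    by (simp add: mult_ac)
  finally show "a (l - p) = of_real (nuconst l p) * (of_real (c (int p)) + \<i> * of_real (c (- int p)))"
    unfolding nuconst_eq .
qed

section \<open>Transvectants and the Bombieri--Weyl form\<close>

lemma partial_coord_power: "partial i (coord i ^ Suc n) = cscale (of_nat (Suc n)) (coord i ^ n)"
proof (induction n)
  case 0
  show "partial i (coord i ^ Suc 0) = cscale (of_nat (Suc 0)) (coord i ^ 0)"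
    by (auto simp: partial_coord fun_eq_iff fun_simps)
next
  case (Suc n)
  have "partial i (coord i ^ Suc (Suc n)) = partial i (coord i * coord i ^ Suc n)"
    by simp
  also have "\<dots> = const_fun 1 * coord i ^ Suc n + coord i * cscale (of_nat (Suc n)) (coord i ^ n)"
    by (subst partial_mult[OF coord_polys polys_power[OF coord_polys]]) (simp only: partial_coord Suc if_True simp_thms)
  also have "\<dots> = cscale (of_nat (Suc (Suc n))) (coord i ^ Suc n)"
    by (auto simp: fun_eq_iff fun_simps algebra_simps)
  finally show "partial i (coord i ^ Suc (Suc n)) = cscale (of_nat (Suc (Suc n))) (coord i ^ Suc n)" .
qed

lemma partial_coord_power_other: "k \<noteq> i \<Longrightarrow> partial i (coord k ^ n) = 0"
proof (induction n)
  case 0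
  show "partial i (coord k ^ 0) = 0"
    using partial_const[of i 1] by (simp add: const_fun_def one_fun_def)
next
  case (Suc n)
  have z: "const_fun 0 = (0 :: complex ^ 'a \<Rightarrow> complex)"
    by (auto simp: fun_eq_iff fun_simps)
  have "partial i (coord k * coord k ^ n) = 0"
    by (subst partial_mult[OF coord_polys polys_power[OF coord_polys]])
      (simp add: partial_coord Suc z)
  then show "partial i (coord k ^ Suc n) = 0"
    by simp
qed

definition bmon :: "nat \<Rightarrow> nat \<Rightarrow> complex ^ 2 \<Rightarrow> complex" where
  "bmon a b = coord 1 ^ a * coord 2 ^ b"

lemma bmon_polys: "bmon a b \<in> polys"
  unfolding bmon_def by (intro polys_mult polys_power coord_polys)

lemma partial_bmon:
  "partial 1 (bmon a b) = cscale (of_nat a) (bmon (a - 1) b)"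
  "partial 2 (bmon a b) = cscale (of_nat b) (bmon a (b - 1))"
proof -
  note m = partial_mult[OF polys_power[OF coord_polys] polys_power[OF coord_polys]]
  have z: "partial 1 (coord 1 ^ 0 :: complex ^ 2 \<Rightarrow> complex) = 0" "partial 2 (coord 2 ^ 0 :: complex ^ 2 \<Rightarrow> complex) = 0"
    using partial_const[of _ 1] by (simp_all add: const_fun_def one_fun_def)
  show "partial 1 (bmon a b) = cscale (of_nat a) (bmon (a - 1) b)"
    unfolding bmon_def m
    by (cases a) (simp_all add: partial_coord_power partial_coord_power_other z cscale_mult_left del: power_Suc of_nat_Suc power_0)
  show "partial 2 (bmon a b) = cscale (of_nat b) (bmon a (b - 1))"
    unfolding bmon_def m
    by (cases b) (simp_all add: partial_coord_power partial_coord_power_other z cscale_mult_right del: power_Suc of_nat_Suc power_0)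
qed

text \<open>The falling factorial with truncated subtraction: for i > b the factor with k = b is 0,
  so differentiating too often gives 0 automatically.\<close>

definition falling :: "nat \<Rightarrow> nat \<Rightarrow> nat" where
  "falling b i = (\<Prod>k<i. b - k)"

lemma falling_eq_0: "b < i \<Longrightarrow> falling b i = 0"
  unfolding falling_def by (rule prod_zero) auto

lemma falling_self: "falling b b = fact b"
proof (induction b)
  case (Suc b)
  have "falling (Suc b) (Suc b) = (\<Prod>k<Suc b. Suc b - k)"
    by (simp add: falling_def)
  also have "\<dots> = Suc b * (\<Prod>k<b. b - k)"
    by (subst prod.lessThan_Suc_shift) simp
  finally show ?case
    using Suc by (simp add: falling_def)
qed (simp add: falling_def)

lemma partial_iter_bmon:
  "(partial 1 ^^ i) (cscale c (bmon a b)) = cscale (c * of_nat (falling a i)) (bmon (a - i) b)"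
  "(partial 2 ^^ i) (cscale c (bmon a b)) = cscale (c * of_nat (falling b i)) (bmon a (b - i))"
proof (induction i)
  case 0
  show "(partial 1 ^^ 0) (cscale c (bmon a b)) = cscale (c * of_nat (falling a 0)) (bmon (a - 0) b)"
    "(partial 2 ^^ 0) (cscale c (bmon a b)) = cscale (c * of_nat (falling b 0)) (bmon a (b - 0))"
    by (simp_all add: falling_def)
next
  case (Suc i)
  show "(partial 1 ^^ Suc i) (cscale c (bmon a b)) = cscale (c * of_nat (falling a (Suc i))) (bmon (a - Suc i) b)"
    unfolding funpow.simps o_apply Suc(1) partial_cscale[OF bmon_polys] partial_bmon cscale_cscale
    by (simp add: falling_def mult.assoc)
  show "(partial 2 ^^ Suc i) (cscale c (bmon a b)) = cscale (c * of_nat (falling b (Suc i))) (bmon a (b - Suc i))"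
    unfolding funpow.simps o_apply Suc(2) partial_cscale[OF bmon_polys] partial_bmon cscale_cscale
    by (simp add: falling_def mult.assoc)
qed

lemma partial_iter_polys: "f \<in> polys \<Longrightarrow> (partial i ^^ n) f \<in> polys"
proof (induction n)
  case (Suc n)
  then show "(partial i ^^ Suc n) f \<in> polys"
    by (simp add: partial_polys)
qed simp

lemma partial_iter_sum:
  "(\<And>a. a \<in> A \<Longrightarrow> f a \<in> polys) \<Longrightarrow> (partial i ^^ n) (\<Sum>a\<in>A. f a) = (\<Sum>a\<in>A. (partial i ^^ n) (f a))"
proof (induction n)
  case (Suc n)
  have "(partial i ^^ Suc n) (\<Sum>a\<in>A. f a) = partial i (\<Sum>a\<in>A. (partial i ^^ n) (f a))"
    using Suc by simp
  also have "\<dots> = (\<Sum>a\<in>A. (partial i ^^ Suc n) (f a))"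
    using Suc.prems by (subst partial_sum) (auto intro: partial_iter_polys)
  finally show "(partial i ^^ Suc n) (\<Sum>a\<in>A. f a) = (\<Sum>a\<in>A. (partial i ^^ Suc n) (f a))" .
qed simp

text \<open>n derivatives hit a form of degree n. The monomial of index k has too few factors z_1 if
  k < i and too few factors z_0 if k > i, so only k = i survives, where the binomial times i! (n -
  i)! is n!.\<close>

lemma partial_iter_bform:
  assumes "i \<le> n"
  shows "(partial 1 ^^ (n - i)) ((partial 2 ^^ i) (bform n a)) z = fact n * a i"
proof -
  let ?c = "\<lambda>k. of_nat (n choose k) * a k * of_nat (falling k i)"
  have b: "bform n a = (\<Sum>k\<le>n. cscale (of_nat (n choose k) * a k) (bmon (n - k) k))"
    by (simp add: bform_eq_sum bmono_eq bmon_def)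
  have "(partial 2 ^^ i) (bform n a) = (\<Sum>k\<le>n. cscale (?c k) (bmon (n - k) (k - i)))"
    unfolding b by (subst partial_iter_sum) (auto intro: polys_cscale bmon_polys simp: partial_iter_bmon)
  then have "(partial 1 ^^ (n - i)) ((partial 2 ^^ i) (bform n a)) =
      (\<Sum>k\<le>n. cscale (?c k * of_nat (falling (n - k) (n - i))) (bmon (n - k - (n - i)) (k - i)))"
    by (simp only:) (subst partial_iter_sum, auto intro: polys_cscale bmon_polys simp: partial_iter_bmon)
  also have "\<dots> = (\<Sum>k\<le>n. if k = i then const_fun (fact n * a i) else 0)"
  proof (rule sum.cong[OF refl])
    fix k assume "k \<in> {..n}"
    consider "k < i" | "k = i" | "i < k"
      by linarith
    then show "cscale (?c k * of_nat (falling (n - k) (n - i))) (bmon (n - k - (n - i)) (k - i)) =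
        (if k = i then const_fun (fact n * a i) else 0)"
    proof cases
      case 1
      then show ?thesis
        by (simp add: falling_eq_0)
    next
      case 2
      have "complex_of_nat (fact i * fact (n - i) * (n choose i)) = of_nat (fact n)"
        unfolding binomial_fact_lemma[OF assms] ..
      then have "of_nat (n choose i) * (fact i * fact (n - i)) = (fact n :: complex)"
        by (simp add: mult_ac)
      then show ?thesis
        using 2 by (auto simp: falling_self bmon_def fun_eq_iff fun_simps)
    next
      case 3
      then have "falling (n - k) (n - i) = 0"
        using \<open>k \<in> {..n}\<close> by (intro falling_eq_0) auto
      then show ?thesis
        using 3 by simp
    qed
  qed
  also have "\<dots> = const_fun (fact n * a i)"
    using assms by simp
  finally show ?thesis
    by (simp add: fun_simps)
qed

lemma transvectant_full_bform:
  "transvectant n n n (bform n a) (bform n b) z = (\<Sum>k\<le>n. (- 1) ^ k * of_nat (n choose k) * a k * b (n - k))"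
proof -
  have "(partial 1 ^^ i) ((partial 2 ^^ (n - i)) (bform n b)) z = fact n * b (n - i)" if "i \<le> n" for i
    using partial_iter_bform[of "n - i" n b z] that by simp
  then have "transvectant n n n (bform n a) (bform n b) z = 1 / (fact n * fact n) *
      (\<Sum>i\<le>n. (- 1) ^ i * of_nat (n choose i) * (fact n * a i) * (fact n * b (n - i)))"
    unfolding transvectant_def by (simp add: partial_iter_bform)
  also have "\<dots> = (\<Sum>k\<le>n. (- 1) ^ k * of_nat (n choose k) * a k * b (n - k))"
    unfolding sum_distrib_left by (intro sum.cong refl) simp
  finally show ?thesis .
qed

lemma BW_norm_bform: "(BW_norm n (bform n a))\<^sup>2 = (\<Sum>k\<le>n. real (n choose k) * (cmod (a k))\<^sup>2)"
proof -
  have "(BW_norm n (bform n a))\<^sup>2 = (\<Sum>k\<le>n. real (n choose k) * (cmod (bcoeff n (bform n a) k))\<^sup>2)"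
    unfolding BW_norm_def by (intro real_sqrt_pow2 sum_nonneg) simp
  then show ?thesis
    by (simp add: bcoeff_bform)
qed

text \<open>The reality condition turns each product \<open>a k * a (2 * l - k)\<close> into (-1)^(l
  + k) |a_k|^2, and this sign cancels the one in the transvectant times (-1)^l.\<close>

lemma BW_norm_transvectant:
  assumes "f \<in> harmR l"
  shows "of_real ((BW_norm (2 * l) (Psi l f))\<^sup>2) =
    (- 1) ^ l * transvectant (2 * l) (2 * l) (2 * l) (Psi l f) (Psi l f) z"
proof -
  have "Psi l f \<in> Fix_sigma l"
    using Psi_harmR assms by blast
  then obtain a where a: "Psi l f = bform (2 * l) a" "\<And>k. k \<le> 2 * l \<Longrightarrow> a (2 * l - k) = (- 1) ^ (l + k) * cnj (a k)"
    unfolding Fix_sigma_eq by blast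
  have *: "(- 1) ^ l * ((- 1) ^ k * of_nat ((2 * l) choose k) * a k * a (2 * l - k)) =
      of_real (real ((2 * l) choose k) * (cmod (a k))\<^sup>2)" if "k \<le> 2 * l" for k
  proof -
    have s: "(- 1 :: complex) ^ l * (- 1) ^ k * (- 1) ^ (l + k) = 1"
      by (simp add: uminus_power_if)
    have "(- 1) ^ l * ((- 1) ^ k * of_nat ((2 * l) choose k) * a k * a (2 * l - k)) =
        ((- 1) ^ l * (- 1) ^ k * (- 1) ^ (l + k)) * (of_nat ((2 * l) choose k) * (a k * cnj (a k)))"
      unfolding a(2)[OF that] by (simp only: mult_ac)
    also have "\<dots> = of_real (real ((2 * l) choose k) * (cmod (a k))\<^sup>2)"
      unfolding s complex_norm_square[symmetric] by simp
    finally show ?thesis .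
  qed
  show ?thesis
    unfolding a(1) BW_norm_bform transvectant_full_bform of_real_sum sum_distrib_left
    by (rule sum.cong[OF refl]) (simp only: atMost_iff *)
qed

lemma BW_inner_bform: "BW_inner n (bform n a) (bform n b) = (\<Sum>k\<le>n. of_nat (n choose k) * a k * cnj (b k))"
  by (simp add: BW_inner_def bcoeff_bform)

text \<open>The bilinear companion of \<^const>\<open>BW_inner\<close>: powers of linear forms reproduce point values.\<close>

definition BW_bilinear :: "nat \<Rightarrow> (complex ^ 2 \<Rightarrow> complex) \<Rightarrow> (complex ^ 2 \<Rightarrow> complex) \<Rightarrow> complex" where
  "BW_bilinear n F G = (\<Sum>k\<le>n. of_nat (n choose k) * bcoeff n F k * bcoeff n G k)"

lemma BW_bilinear_bform:
  "BW_bilinear n (bform n a) (bform n b) = (\<Sum>k\<le>n. of_nat (n choose k) * a k * b k)"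
  by (simp add: BW_bilinear_def bcoeff_bform)

lemma BW_bilinear_add:
  assumes "F \<in> Sym n" "G \<in> Sym n" "H \<in> Sym n"
  shows "BW_bilinear n F (G + H) = BW_bilinear n F G + BW_bilinear n F H"
proof -
  obtain a b c where "F = bform n a" "G = bform n b" "H = bform n c"
    using assms Sym_bform by metis
  then show ?thesis
    by (simp add: bform_add BW_bilinear_bform algebra_simps sum.distrib)
qed

lemma BW_bilinear_cscale:
  assumes "F \<in> Sym n" "G \<in> Sym n"
  shows "BW_bilinear n F (cscale c G) = c * BW_bilinear n F G"
proof -
  obtain a b where "F = bform n a" "G = bform n b"
    using assms Sym_bform by metis
  then show ?thesis
    by (simp add: bform_cscale BW_bilinear_bform sum_distrib_left mult_ac)
qed

lemma BW_bilinear_sum: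
  assumes "F \<in> Sym n" "\<And>k. k \<in> A \<Longrightarrow> G k \<in> Sym n"
  shows "BW_bilinear n F (\<Sum>k\<in>A. cscale (c k) (G k)) = (\<Sum>k\<in>A. c k * BW_bilinear n F (G k))"
  using assms(2)
proof (induction A rule: infinite_finite_induct)
  case (insert x A)
  have "BW_bilinear n F (cscale (c x) (G x) + (\<Sum>k\<in>A. cscale (c k) (G k))) =
      c x * BW_bilinear n F (G x) + (\<Sum>k\<in>A. c k * BW_bilinear n F (G k))"
    using insert assms(1)
    by (subst BW_bilinear_add) (auto intro!: homog_cscale homog_sum simp: BW_bilinear_cscale)
  then show ?case
    using insert by simp
qed (use BW_bilinear_cscale[OF assms(1) homog_0, of 0] in auto)

definition lin_power :: "nat \<Rightarrow> complex ^ 2 \<Rightarrow> complex ^ 2 \<Rightarrow> complex" where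
  "lin_power n w = (\<lambda>z. (w $ 1 * z $ 1 + w $ 2 * z $ 2) ^ n)"

lemma lin_power_bform: "lin_power n w = bform n (\<lambda>k. (w $ 1) ^ (n - k) * (w $ 2) ^ k)"
proof
  fix z
  have "lin_power n w z = (w $ 2 * z $ 2 + w $ 1 * z $ 1) ^ n"
    by (simp add: lin_power_def add.commute)
  also have "\<dots> = bform n (\<lambda>k. (w $ 1) ^ (n - k) * (w $ 2) ^ k) z"
    unfolding binomial_ring bform_def by (intro sum.cong refl) (simp add: power_mult_distrib mult_ac)
  finally show "lin_power n w z = bform n (\<lambda>k. (w $ 1) ^ (n - k) * (w $ 2) ^ k) z" .
qed

lemma BW_bilinear_lin_power: "F \<in> Sym n \<Longrightarrow> BW_bilinear n F (lin_power n w) = F w"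
proof -
  assume "F \<in> Sym n"
  then obtain a where "F = bform n a"
    by (rule Sym_bform)
  then show ?thesis
    by (simp add: lin_power_bform BW_bilinear_bform) (simp add: bform_def mult_ac)
qed

lemma lin_power_comp: "lin_power n w \<circ> (\<lambda>z. transpose r *v z) = lin_power n (r *v w)"
  by (auto simp: fun_eq_iff lin_power_def matvec_2 transpose_def algebra_simps)

text \<open>Against the power of the linear form of w, both sides equal F(r w) by the reproducing
  property. The powers for w = (1, t) reach every monomial, as the comparison of coefficients of t
  shows.\<close>

lemma BW_bilinear_adjoint:
  assumes F: "F \<in> Sym n" and G: "G \<in> Sym n"
  shows "BW_bilinear n (F \<circ> (\<lambda>z. r *v z)) G = BW_bilinear n F (G \<circ> (\<lambda>z. transpose r *v z))"
proof -
  note hom = homog_comp_linear[of _ n]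
  have mono: "BW_bilinear n (F \<circ> (\<lambda>z. r *v z)) (bmono n k) = BW_bilinear n F (bmono n k \<circ> (\<lambda>z. transpose r *v z))"
    if k: "k \<le> n" for k
  proof -
    let ?w = "\<lambda>t :: complex. (vector [1, t] :: complex ^ 2)"
    have L: "lin_power n (?w t) = (\<Sum>k\<le>n. cscale (of_nat (n choose k) * t ^ k) (bmono n k))" for t
      unfolding lin_power_bform bform_eq_sum by simp
    have "(\<Sum>k\<le>n. of_nat (n choose k) * BW_bilinear n (F \<circ> (\<lambda>z. r *v z)) (bmono n k) * t ^ k) =
        (\<Sum>k\<le>n. of_nat (n choose k) * BW_bilinear n F (bmono n k \<circ> (\<lambda>z. transpose r *v z)) * t ^ k)" for t
    proof -
      have "(\<Sum>k\<le>n. of_nat (n choose k) * t ^ k * BW_bilinear n (F \<circ> (\<lambda>z. r *v z)) (bmono n k)) =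
          BW_bilinear n (F \<circ> (\<lambda>z. r *v z)) (lin_power n (?w t))"
        unfolding L by (rule BW_bilinear_sum[symmetric]) (auto intro: hom F bmono_homog)
      also have "\<dots> = F (r *v ?w t)"
        by (subst BW_bilinear_lin_power) (auto intro: hom F)
      also have "\<dots> = BW_bilinear n F (lin_power n (?w t) \<circ> (\<lambda>z. transpose r *v z))"
        unfolding lin_power_comp by (rule BW_bilinear_lin_power[OF F, symmetric])
      also have "\<dots> = (\<Sum>k\<le>n. of_nat (n choose k) * t ^ k * BW_bilinear n F (bmono n k \<circ> (\<lambda>z. transpose r *v z)))"
        unfolding L comp_sum comp_cscale by (rule BW_bilinear_sum[OF F]) (intro hom bmono_homog, simp)
      finally show ?thesis
        by (simp add: mult_ac)
    qed
    from polyfun_coeffs_eqD[OF this k] k show ?thesis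
      by simp
  qed
  obtain b where "G = bform n b"
    using Sym_bform[OF G] .
  then have b: "G = (\<Sum>k\<le>n. cscale (of_nat (n choose k) * b k) (bmono n k))"
    by (simp add: bform_eq_sum)
  have "BW_bilinear n (F \<circ> (\<lambda>z. r *v z)) G =
      (\<Sum>k\<le>n. of_nat (n choose k) * b k * BW_bilinear n (F \<circ> (\<lambda>z. r *v z)) (bmono n k))"
    unfolding b by (rule BW_bilinear_sum) (auto intro: hom F bmono_homog)
  also have "\<dots> = (\<Sum>k\<le>n. of_nat (n choose k) * b k * BW_bilinear n F (bmono n k \<circ> (\<lambda>z. transpose r *v z)))"
    by (intro sum.cong refl) (simp add: mono)
  also have "\<dots> = BW_bilinear n F (G \<circ> (\<lambda>z. transpose r *v z))"
    unfolding b comp_sum comp_cscale by (rule BW_bilinear_sum[OF F, symmetric]) (intro hom bmono_homog, simp)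
  finally show ?thesis .
qed

text \<open>With half angles, sin \<theta> + 2 t cos \<theta> - t^2 sin \<theta> factors as 2 (c - s
  t)(s + c t), so its l-th power is the form 2^l z_0^l z_1^l after a rotation, evaluated at (1, t).
  Orthogonal substitutions preserve \<open>BW_bilinear\<close>, hence the sum does not depend on
  \<theta>.\<close>

lemma zonal_square_sum:
  "(\<Sum>k\<le>2 * l. (poly.coeff ([:sin \<theta>, 2 * cos \<theta>, - sin \<theta>:] ^ l) k)\<^sup>2 / real ((2 * l) choose k)) =
    4 ^ l / real ((2 * l) choose l)"
proof -
  let ?n = "2 * l" and ?e = "\<lambda>k. poly.coeff ([:sin \<theta>, 2 * cos \<theta>, - sin \<theta>:] ^ l) k"
  define s c :: complex where "s = of_real (sin (\<theta> / 2))" and "c = of_real (cos (\<theta> / 2))"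
  have "(sin (\<theta> / 2))\<^sup>2 + (cos (\<theta> / 2))\<^sup>2 = 1"
    by simp
  then have sc: "s * s + c * c = 1"
    unfolding s_def c_def by (simp flip: of_real_mult of_real_add add: power2_eq_square)
  have tr: "of_real (sin \<theta>) = 2 * s * c" "of_real (cos \<theta>) = c * c - s * s"
    unfolding s_def c_def using sin_double[of "\<theta> / 2"] cos_double[of "\<theta> / 2"]
    by (simp_all add: power2_eq_square)
  define r :: "complex ^ 2 ^ 2" where "r = vector [vector [c, - s], vector [s, c]]"
  define F where "F = cscale (2 ^ l) (bmono ?n l)"
  have F: "F \<in> Sym ?n"
    unfolding F_def by (intro homog_cscale bmono_homog) simp
  have Fr: "F \<circ> (\<lambda>z. r *v z) \<in> Sym ?n"
    by (rule homog_comp_linear[OF F])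
  obtain a where a: "F \<circ> (\<lambda>z. r *v z) = bform ?n a"
    using Sym_bform[OF Fr] .
  \<comment> \<open>The coefficients of the quadratic power are plain, those of \<open>bform\<close>
    carry binomial weights; this produces the division by the binomial in the claim.\<close>
  have ae: "of_nat (?n choose k) * a k = of_real (?e k)" if "k \<le> ?n" for k
  proof -
    have "(\<Sum>k\<le>?n. of_nat (?n choose k) * a k * t ^ k) = (\<Sum>k\<le>?n. of_real (?e k) * t ^ k)" for t :: complex
    proof -
      have "(\<Sum>k\<le>?n. of_nat (?n choose k) * a k * t ^ k) = (F \<circ> (\<lambda>z. r *v z)) (vector [1, t])"
        unfolding a bform_apply_1 ..
      also have "\<dots> = 2 ^ l * ((c - s * t) ^ (?n - l) * (s + c * t) ^ l)"
        by (simp add: F_def cscale_apply bmono_def matvec_2 r_def)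
      also have "\<dots> = (2 * ((c - s * t) * (s + c * t))) ^ l"
        by (simp add: power_mult_distrib)
      also have "2 * ((c - s * t) * (s + c * t)) = poly [:of_real (sin \<theta>), of_real (2 * cos \<theta>), of_real (- sin \<theta>):] t"
        by (simp add: tr algebra_simps)
      also have "\<dots> ^ l = poly ([:of_real (sin \<theta>), of_real (2 * cos \<theta>), of_real (- sin \<theta>):] ^ l) t"
        by simp
      also have "\<dots> = (\<Sum>k\<le>?n. of_real (?e k) * t ^ k)"
      proof (subst poly_eq_sum_coeff[of _ ?n])
        have "Polynomial.degree [:complex_of_real (sin \<theta>), of_real (2 * cos \<theta>), of_real (- sin \<theta>):] \<le> 2"
          by simp
        then show "Polynomial.degree ([:complex_of_real (sin \<theta>), of_real (2 * cos \<theta>), of_real (- sin \<theta>):] ^ l) \<le> ?n"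
          by (meson degree_power_le le_trans mult_le_mono1)
      qed (simp only: coeff_quadratic_of_real)
      finally show ?thesis .
    qed
    from polyfun_coeffs_eqD[OF this that] show ?thesis .
  qed
  have rr: "r ** transpose r = mat 1"
    using sc by (simp add: vec_eq_iff forall_2 matmul_2 transpose_def mat_2 r_def algebra_simps)
  have "BW_bilinear ?n (F \<circ> (\<lambda>z. r *v z)) (F \<circ> (\<lambda>z. r *v z)) =
      BW_bilinear ?n F (F \<circ> (\<lambda>z. r *v z) \<circ> (\<lambda>z. transpose r *v z))"
    by (rule BW_bilinear_adjoint[OF F Fr])
  also have "F \<circ> (\<lambda>z. r *v z) \<circ> (\<lambda>z. transpose r *v z) = F"
    unfolding fun_eq_iff o_apply matrix_vector_mul_assoc rr by simp
  finally have eq: "BW_bilinear ?n (F \<circ> (\<lambda>z. r *v z)) (F \<circ> (\<lambda>z. r *v z)) = BW_bilinear ?n F F" .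
  have Fb: "F = bform ?n (\<lambda>k. if k = l then 2 ^ l / of_nat (?n choose l) else 0)"
    unfolding F_def bmono_eq_bform[of l ?n, simplified] bform_cscale by (rule bform_cong) simp
  have "BW_bilinear ?n F F = (\<Sum>k\<le>?n. if k = l then 4 ^ l / of_nat (?n choose l) else 0)"
    unfolding Fb BW_bilinear_bform by (intro sum.cong refl) (simp add: power_mult_distrib[symmetric])
  also have "\<dots> = 4 ^ l / of_nat (?n choose l)"
    by simp
  finally have FF: "BW_bilinear ?n F F = 4 ^ l / of_nat (?n choose l)" .
  have "complex_of_real (\<Sum>k\<le>?n. (?e k)\<^sup>2 / real (?n choose k)) = (\<Sum>k\<le>?n. of_nat (?n choose k) * a k * a k)"
    unfolding of_real_sum
  proof (rule sum.cong[OF refl])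
    fix k assume "k \<in> {..?n}"
    then have k: "k \<le> ?n" "of_nat (?n choose k) \<noteq> (0 :: complex)"
      by auto
    have "complex_of_real ((?e k)\<^sup>2 / real (?n choose k)) = (of_nat (?n choose k) * a k)\<^sup>2 / of_nat (?n choose k)"
      unfolding ae[OF k(1)] by simp
    also have "\<dots> = of_nat (?n choose k) * a k * a k"
      using k(2) by (simp add: power2_eq_square)
    finally show "complex_of_real ((?e k)\<^sup>2 / real (?n choose k)) = of_nat (?n choose k) * a k * a k" .
  qed
  also have "\<dots> = complex_of_real (4 ^ l / real (?n choose l))"
    using eq unfolding a BW_bilinear_bform FF by simp
  finally show ?thesis
    unfolding of_real_eq_iff .
qed

section \<open>The invariant measure\<close>

lemma continuous_poly_cvec:
  assumes "f \<in> polys"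
  shows "continuous_on UNIV (\<lambda>x. f (cvec x))"
  using assms
proof (induction rule: polys_gen_induct)
  case one
  show "continuous_on UNIV (\<lambda>x. const_fun 1 (cvec x))"
    by (simp add: fun_simps)
next
  case (add f g)
  then show "continuous_on UNIV (\<lambda>x. (f + g) (cvec x))"
    by (simp add: fun_simps continuous_on_add)
next
  case (cscale c f)
  then show "continuous_on UNIV (\<lambda>x. cscale c f (cvec x))"
    by (simp add: fun_simps continuous_on_mult_left)
next
  case (step i f)
  have "continuous_on UNIV (\<lambda>x. complex_of_real (x $ i))"
    by (intro continuous_intros)
  then show "continuous_on UNIV (\<lambda>x. (coord i * f) (cvec x))"
    using step by (simp add: fun_simps continuous_on_mult)
qed

lemma cvec_matvec: "cvec (A *v x) = cmat A *v cvec x"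
  by (simp add: cvec_def cmat_def matrix_vector_mult_def vec_eq_iff)

lemma rotation_norm: "rotation_matrix A \<Longrightarrow> norm (A *v x) = norm x" for x :: "real ^ 3"
  unfolding rotation_matrix_def
  using orthogonal_transformation_matrix[of "\<lambda>x. A *v x"] orthogonal_transformation_norm[of "\<lambda>x. A *v x" x]
  by (simp add: matrix_of_matrix_vector_mul)

section \<open>Rotations about the third and the second axis\<close>

definition rot_z :: "real \<Rightarrow> real ^ 3 ^ 3" where
  "rot_z \<phi> = vector [vector [cos \<phi>, - sin \<phi>, 0], vector [sin \<phi>, cos \<phi>, 0], vector [0, 0, 1]]"

text \<open>Given by cosine and sine rather than by an angle, so that rational functions of t can be
  inserted.\<close>

definition rot_y :: "real \<Rightarrow> real \<Rightarrow> real ^ 3 ^ 3" where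
  "rot_y c s = vector [vector [c, 0, s], vector [0, 1, 0], vector [- s, 0, c]]"

lemma cos_sin_square: "cos \<phi> * cos \<phi> + sin \<phi> * sin \<phi> = (1 :: real)"
  using sin_cos_squared_add2[of \<phi>] by (simp add: power2_eq_square)

lemma rotation_rot_z: "rotation_matrix (rot_z \<phi>)"
  using cos_sin_square[of \<phi>]
  by (simp add: rotation_matrix_def orthogonal_matrix det_3 rot_z_def vec_eq_iff forall_3 matrix_matrix_mult_def
      transpose_def mat_def sum_3 algebra_simps)

lemma rotation_rot_y: "c * c + s * s = 1 \<Longrightarrow> rotation_matrix (rot_y c s)"
  by (simp add: rotation_matrix_def orthogonal_matrix det_3 rot_y_def vec_eq_iff forall_3 matrix_matrix_mult_def
      transpose_def mat_def sum_3 algebra_simps)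

text \<open>The rotation twists \<open>null_poly\<close> by e^(i \<phi>), which makes the
  coefficient of index k a weight vector of weight l - k.\<close>

lemma harm_basis_rot_z:
  "harm_basis l k \<circ> (\<lambda>x. cmat (rot_z \<phi>) *v x) = cscale (cis \<phi> ^ l * cis (- \<phi>) ^ k) (harm_basis l k)"
proof
  fix x :: "complex ^ 3"
  have "cis \<phi> * (x $ 1 + \<i> * x $ 2) = (of_real (cos \<phi>) + \<i> * of_real (sin \<phi>)) * (x $ 1 + \<i> * x $ 2)"
    "cis (- \<phi>) * (x $ 1 - \<i> * x $ 2) = (of_real (cos \<phi>) - \<i> * of_real (sin \<phi>)) * (x $ 1 - \<i> * x $ 2)"
    by (simp_all add: cis_conv_exp exp_Euler cos_of_real sin_of_real exp_minus_Euler mult.commute)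
  then have "null_poly (cmat (rot_z \<phi>) *v x) =
      [:(x $ 1 + \<i> * x $ 2) * cis \<phi>, 2 * x $ 3, - (x $ 1 - \<i> * x $ 2) * cis (- \<phi>):]"
    by (simp add: null_poly_def matvec_3 cmat_def rot_z_def algebra_simps)
  then have t: "harm_basis l k (cmat (rot_z \<phi>) *v x) * cis \<phi> ^ k = cis \<phi> ^ l * harm_basis l k x"
    using coeff_quadratic_twist[of "cis \<phi>" "cis (- \<phi>)" "x $ 1 + \<i> * x $ 2" "2 * x $ 3" "- (x $ 1 - \<i> * x $ 2)" l k]
    unfolding harm_basis_def by (simp add: cis_mult null_poly_def)
  have u: "cis \<phi> ^ k * cis (- \<phi>) ^ k = 1"
    by (simp add: cis_mult flip: power_mult_distrib)
  have "harm_basis l k (cmat (rot_z \<phi>) *v x) =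
      harm_basis l k (cmat (rot_z \<phi>) *v x) * cis \<phi> ^ k * cis (- \<phi>) ^ k"
    unfolding mult.assoc u by simp
  then show "(harm_basis l k \<circ> (\<lambda>x. cmat (rot_z \<phi>) *v x)) x =
      cscale (cis \<phi> ^ l * cis (- \<phi>) ^ k) (harm_basis l k) x"
    unfolding t by (simp add: cscale_apply mult_ac)
qed

text \<open>The norm identity for the generating function holds at real t and involves only t^2, so
  the coefficients have to be compared at nonnegative numbers.\<close>

lemma infinite_squares: "infinite (range (\<lambda>t. complex_of_real (t\<^sup>2)))"
proof
  assume "finite (range (\<lambda>t. complex_of_real (t\<^sup>2)))"
  moreover have "complex_of_real ` {0..} \<subseteq> range (\<lambda>t. complex_of_real (t\<^sup>2))"
  proof safe
    fix x :: real assume "0 \<le> x"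
    then show "complex_of_real x \<in> range (\<lambda>t. complex_of_real (t\<^sup>2))"
      by (intro image_eqI[of _ _ "sqrt x"]) (simp_all flip: of_real_power)
  qed
  ultimately have "finite (complex_of_real ` {0..})"
    using finite_subset by blast
  then have "finite {0 :: real..}"
    by (simp add: finite_image_iff inj_on_def)
  then show False
    using infinite_Ici by blast
qed

section \<open>Integration against an invariant probability measure\<close>

locale rotation_invariant =
  fixes \<omega> :: "(real ^ 3) measure"
  assumes inv: "rotation_invariant_prob \<omega>"
begin

sublocale prob_space \<omega>
  using inv by (simp add: rotation_invariant_prob_def)

lemma sets_omega: "sets \<omega> = sets (restrict_space borel (sphere 0 1))"
  using inv by (simp add: rotation_invariant_prob_def)

lemma space_omega: "space \<omega> = sphere 0 1"
  using sets_eq_imp_space_eq[OF sets_omega] by (simp add: space_restrict_space)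

lemma measurable_omega:
  assumes "h \<in> borel_measurable borel"
  shows "h \<in> borel_measurable \<omega>"
  using measurable_restrict_space1[OF assms, of "sphere 0 1"] measurable_cong_sets[OF sets_omega refl] by blast

lemma integrable_continuous:
  fixes h :: "real ^ 3 \<Rightarrow> complex"
  assumes "continuous_on UNIV h"
  shows "integrable \<omega> h"
proof -
  have "bounded (h ` sphere 0 1)"
    by (intro compact_imp_bounded compact_continuous_image continuous_on_subset[OF assms] compact_sphere subset_UNIV)
  then obtain B where B: "\<And>x. x \<in> sphere 0 1 \<Longrightarrow> norm (h x) \<le> B"
    unfolding bounded_iff by (metis image_eqI)
  show ?thesis
  proof (rule integrable_const_bound)
    show "AE x in \<omega>. norm (h x) \<le> B"
      using B by (intro AE_I2) (simp add: space_omega)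
    show "h \<in> borel_measurable \<omega>"
      by (rule measurable_omega[OF borel_measurable_continuous_onI[OF assms]])
  qed
qed

lemma integral_rotation:
  fixes h :: "real ^ 3 \<Rightarrow> complex"
  assumes "continuous_on UNIV h" "rotation_matrix A"
  shows "(LINT x|\<omega>. h (A *v x)) = (LINT x|\<omega>. h x)"
proof -
  have "(\<lambda>x. A *v x) \<in> borel_measurable borel"
    by (intro borel_measurable_continuous_onI linear_continuous_on matrix_vector_mul_bounded_linear)
  then have "(\<lambda>x. A *v x) \<in> restrict_space borel (sphere 0 1) \<rightarrow>\<^sub>M restrict_space borel (sphere 0 1)"
    by (rule measurable_restrict_space3) (simp add: rotation_norm[OF assms(2)])
  then have m: "(\<lambda>x. A *v x) \<in> \<omega> \<rightarrow>\<^sub>M \<omega>"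
    using measurable_cong_sets[OF sets_omega sets_omega] by blast
  have "(LINT x|\<omega>. h (A *v x)) = (LINT x|distr \<omega> \<omega> (\<lambda>x. A *v x). h x)"
    by (rule integral_distr[OF m measurable_omega[OF borel_measurable_continuous_onI[OF assms(1)]], symmetric])
  also have "distr \<omega> \<omega> (\<lambda>x. A *v x) = \<omega>"
    using inv assms(2) by (simp add: rotation_invariant_prob_def)
  finally show ?thesis .
qed

lemma continuous_inner: "f \<in> polys \<Longrightarrow> g \<in> polys \<Longrightarrow> continuous_on UNIV (\<lambda>x. f (cvec x) * cnj (g (cvec x)))"
  by (intro continuous_intros continuous_poly_cvec)

lemma integrable_inner: "f \<in> polys \<Longrightarrow> g \<in> polys \<Longrightarrow> integrable \<omega> (\<lambda>x. f (cvec x) * cnj (g (cvec x)))"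
  by (rule integrable_continuous[OF continuous_inner])

lemma L2_inner_cscale_left: "L2_inner \<omega> (cscale c f) g = c * L2_inner \<omega> f g"
  by (simp add: L2_inner_def fun_simps mult.assoc)

lemma L2_inner_cscale_right: "L2_inner \<omega> f (cscale c g) = cnj c * L2_inner \<omega> f g"
proof -
  have "(\<lambda>x. f (cvec x) * cnj (cscale c g (cvec x))) = (\<lambda>x. cnj c * (f (cvec x) * cnj (g (cvec x))))"
    by (simp add: fun_simps fun_eq_iff)
  then show ?thesis
    unfolding L2_inner_def by simp
qed

lemma L2_inner_sum_left:
  assumes "\<And>a. a \<in> S \<Longrightarrow> f a \<in> polys" "g \<in> polys"
  shows "L2_inner \<omega> (\<Sum>a\<in>S. f a) g = (\<Sum>a\<in>S. L2_inner \<omega> (f a) g)"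
proof -
  have "L2_inner \<omega> (\<Sum>a\<in>S. f a) g = (LINT x|\<omega>. (\<Sum>a\<in>S. f a (cvec x) * cnj (g (cvec x))))"
    unfolding L2_inner_def by (simp add: sum_fun_apply sum_distrib_right)
  also have "\<dots> = (\<Sum>a\<in>S. L2_inner \<omega> (f a) g)"
    unfolding L2_inner_def by (rule Bochner_Integration.integral_sum) (rule integrable_inner[OF assms])
  finally show ?thesis .
qed

lemma L2_inner_sum_right:
  assumes "\<And>a. a \<in> S \<Longrightarrow> g a \<in> polys" "f \<in> polys"
  shows "L2_inner \<omega> f (\<Sum>a\<in>S. g a) = (\<Sum>a\<in>S. L2_inner \<omega> f (g a))"
proof -
  have "L2_inner \<omega> f (\<Sum>a\<in>S. g a) = (LINT x|\<omega>. (\<Sum>a\<in>S. f (cvec x) * cnj (g a (cvec x))))"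
    unfolding L2_inner_def by (simp add: sum_fun_apply sum_distrib_left)
  also have "\<dots> = (\<Sum>a\<in>S. L2_inner \<omega> f (g a))"
    unfolding L2_inner_def by (rule Bochner_Integration.integral_sum) (rule integrable_inner[OF assms(2,1)])
  finally show ?thesis .
qed

lemma L2_inner_double_sum:
  assumes "\<And>a. a \<in> S \<Longrightarrow> f a \<in> polys"
  shows "L2_inner \<omega> (\<Sum>a\<in>S. cscale (c a) (f a)) (\<Sum>a\<in>S. cscale (d a) (f a)) =
    (\<Sum>a\<in>S. \<Sum>b\<in>S. c a * cnj (d b) * L2_inner \<omega> (f a) (f b))"
proof -
  have "L2_inner \<omega> (\<Sum>a\<in>S. cscale (c a) (f a)) (\<Sum>a\<in>S. cscale (d a) (f a)) =
      (\<Sum>a\<in>S. L2_inner \<omega> (cscale (c a) (f a)) (\<Sum>b\<in>S. cscale (d b) (f b)))"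
    by (rule L2_inner_sum_left) (auto intro!: polys_cscale polys_sum assms)
  also have "\<dots> = (\<Sum>a\<in>S. \<Sum>b\<in>S. L2_inner \<omega> (cscale (c a) (f a)) (cscale (d b) (f b)))"
    by (intro sum.cong refl L2_inner_sum_right) (auto intro!: polys_cscale assms)
  finally show ?thesis
    by (simp add: L2_inner_cscale_left L2_inner_cscale_right mult_ac)
qed

lemma L2_inner_rotation:
  assumes "f \<in> polys" "g \<in> polys" "rotation_matrix A"
  shows "L2_inner \<omega> (f \<circ> (\<lambda>x. cmat A *v x)) (g \<circ> (\<lambda>x. cmat A *v x)) = L2_inner \<omega> f g"
  using integral_rotation[OF continuous_inner[OF assms(1,2)] assms(3)]
  unfolding L2_inner_def o_apply cvec_matvec .

lemma harm_basis_orthogonal: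
  assumes "j \<noteq> k"
  shows "L2_inner \<omega> (harm_basis l j) (harm_basis l k) = 0"
proof -
  \<comment> \<open>The angle at which the two weights differ by a factor -1, so that the integral
    equals its negative.\<close>
  define \<phi> where "\<phi> = pi / (real k - real j)"
  have d: "(real k - real j) * \<phi> = pi"
    using assms by (simp add: \<phi>_def)
  let ?I = "L2_inner \<omega> (harm_basis l j) (harm_basis l k)"
  have u: "cis \<phi> ^ l * cis (- \<phi>) ^ l = 1"
    by (simp add: cis_mult flip: power_mult_distrib)
  have "?I = (cis \<phi> ^ l * cis (- \<phi>) ^ j) * cnj (cis \<phi> ^ l * cis (- \<phi>) ^ k) * ?I"
    using L2_inner_rotation[OF harm_basis_polys harm_basis_polys rotation_rot_z[of \<phi>], of l j l k]
    unfolding harm_basis_rot_z L2_inner_cscale_left L2_inner_cscale_right by (simp only: mult_ac)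
  also have "(cis \<phi> ^ l * cis (- \<phi>) ^ j) * cnj (cis \<phi> ^ l * cis (- \<phi>) ^ k) =
      (cis \<phi> ^ l * cis (- \<phi>) ^ l) * (cis (- \<phi>) ^ j * cis \<phi> ^ k)"
    by (simp add: cis_cnj mult_ac)
  also have "\<dots> = cis ((real k - real j) * \<phi>)"
    unfolding u Complex.DeMoivre cis_mult by (simp add: algebra_simps)
  also have "\<dots> = - 1"
    unfolding d by simp
  finally show ?thesis
    by simp
qed

text \<open>For real t, v(1, t) is 1 + t^2 times the image of v(1, 0) under a rotation about the
  second axis, the transpose of \<open>rot_y c s\<close>. Invariance leaves only the scale
  factor.\<close>

lemma coherent_norm:
  fixes t :: real and l :: nat
  defines "F \<equiv> \<lambda>t :: real. lin_form (vmap (vector [1, of_real t])) ^ l"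
  shows "L2_inner \<omega> (F t) (F t) = of_real ((1 + t\<^sup>2) ^ (2 * l)) * L2_inner \<omega> (F 0) (F 0)"
proof -
  \<comment> \<open>The rational parametrisation of the circle, read off from the first and third
    entries 1 - t^2 and 2 t of v(1, t).\<close>
  define c s where "c = (1 - t\<^sup>2) / (1 + t\<^sup>2)" and "s = 2 * t / (1 + t\<^sup>2)"
  have p: "1 + t\<^sup>2 \<noteq> 0"
    using zero_le_power2[of t] by linarith
  have cs: "(1 + t\<^sup>2) * c = 1 - t\<^sup>2" "(1 + t\<^sup>2) * s = 2 * t"
    using p by (simp_all add: c_def s_def)
  have "(1 + t\<^sup>2)\<^sup>2 * (c * c + s * s) = ((1 + t\<^sup>2) * c)\<^sup>2 + ((1 + t\<^sup>2) * s)\<^sup>2"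
    by (simp add: power2_eq_square algebra_simps)
  also have "\<dots> = (1 + t\<^sup>2)\<^sup>2 * 1"
    unfolding cs by (simp add: power2_eq_square algebra_simps)
  finally have n: "c * c + s * s = 1"
    using p by (subst (asm) mult_cancel_left) simp
  have v: "complex_of_real (1 + t\<^sup>2) * of_real c = 1 - (of_real t)\<^sup>2" "complex_of_real (1 + t\<^sup>2) * of_real s = 2 * of_real t"
    using arg_cong[OF cs(1), of complex_of_real] arg_cong[OF cs(2), of complex_of_real] by simp_all
  have "lin_form (vmap (vector [1, of_real t])) x =
      of_real (1 + t\<^sup>2) * lin_form (vmap (vector [1, of_real 0])) (cmat (rot_y c s) *v x)" for x
  proof -
    have "of_real (1 + t\<^sup>2) * lin_form (vmap (vector [1, of_real 0])) (cmat (rot_y c s) *v x) =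
        (of_real (1 + t\<^sup>2) * of_real c) * x $ 1 + \<i> * of_real (1 + t\<^sup>2) * x $ 2 + (of_real (1 + t\<^sup>2) * of_real s) * x $ 3"
      by (simp add: lin_form_apply matvec_3 vmap_nth cmat_def rot_y_def algebra_simps)
    also have "\<dots> = lin_form (vmap (vector [1, of_real t])) x"
      unfolding v by (simp add: lin_form_apply vmap_nth)
    finally show ?thesis ..
  qed
  then have "F t = cscale (of_real ((1 + t\<^sup>2) ^ l)) (F 0 \<circ> (\<lambda>x. cmat (rot_y c s) *v x))"
    unfolding F_def by (simp add: fun_eq_iff cscale_apply power_fun_apply power_mult_distrib)
  then have "L2_inner \<omega> (F t) (F t) = of_real ((1 + t\<^sup>2) ^ l) * (of_real ((1 + t\<^sup>2) ^ l) * L2_inner \<omega> (F 0) (F 0))"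
    using L2_inner_rotation[OF lin_form_power_polys lin_form_power_polys rotation_rot_y[OF n]]
    unfolding F_def by (simp add: L2_inner_cscale_left L2_inner_cscale_right)
  then show ?thesis
    by (simp only: mult_2 power_add of_real_mult mult.assoc)
qed

text \<open>Orthogonality reduces the squared norm of the generating function to a polynomial in t^2
  with the squared norms as coefficients; it is proportional to (1 + t^2)^(2 l), whose coefficients
  are binomials.\<close>

lemma harm_basis_norm_ratio:
  assumes "k \<le> 2 * l"
  shows "L2_inner \<omega> (harm_basis l k) (harm_basis l k) =
    of_nat ((2 * l) choose k) * L2_inner \<omega> (harm_basis l 0) (harm_basis l 0)"
proof -
  let ?n = "2 * l" and ?M = "\<lambda>k. L2_inner \<omega> (harm_basis l k) (harm_basis l k)"
  let ?F = "\<lambda>t :: real. lin_form (vmap (vector [1, of_real t])) ^ l"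
  have F: "L2_inner \<omega> (?F t) (?F t) = (\<Sum>k\<le>?n. ?M k * of_real (t\<^sup>2) ^ k)" for t
  proof -
    have "?F t = (\<Sum>k\<le>?n. cscale (of_real t ^ k) (harm_basis l k))"
      by (auto simp: fun_eq_iff fun_simps power_fun_apply mult.commute simp flip: harm_basis_sum)
    then have "L2_inner \<omega> (?F t) (?F t) =
        (\<Sum>j\<le>?n. \<Sum>k\<le>?n. of_real t ^ j * cnj (of_real t ^ k) * L2_inner \<omega> (harm_basis l j) (harm_basis l k))"
      by (simp only: L2_inner_double_sum[OF harm_basis_polys])
    also have "\<dots> = (\<Sum>j\<le>?n. \<Sum>k\<le>?n. if k = j then ?M j * of_real (t\<^sup>2) ^ j else 0)"
      by (intro sum.cong refl) (auto simp: harm_basis_orthogonal power2_eq_square power_mult_distrib)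
    also have "\<dots> = (\<Sum>j\<le>?n. ?M j * of_real (t\<^sup>2) ^ j)"
      by simp
    finally show ?thesis .
  qed
  have M0: "L2_inner \<omega> (?F 0) (?F 0) = ?M 0"
    unfolding F by (subst sum.atMost_shift) simp
  let ?d = "\<lambda>k. ?M k - of_nat (?n choose k) * ?M 0"
  have z: "(\<Sum>k\<le>?n. ?d k * of_real (t\<^sup>2) ^ k) = 0" for t
  proof -
    have "(\<Sum>k\<le>?n. of_nat (?n choose k) * ?M 0 * of_real (t\<^sup>2) ^ k) = (of_real (t\<^sup>2) + 1) ^ ?n * ?M 0"
      unfolding binomial_ring sum_distrib_right by (intro sum.cong refl) simp
    also have "\<dots> = L2_inner \<omega> (?F t) (?F t)"
      unfolding coherent_norm[of t l] M0 by (simp add: add.commute)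
    finally show ?thesis
      unfolding F left_diff_distrib sum_subtractf by simp
  qed
  have "range (\<lambda>t. complex_of_real (t\<^sup>2)) \<subseteq> {y. (\<Sum>k\<le>?n. ?d k * y ^ k) = 0}"
    using z by auto
  then have "infinite {y. (\<Sum>k\<le>?n. ?d k * y ^ k) = 0}"
    using infinite_squares finite_subset by blast
  then have "?d k = 0"
    using polyfun_finite_roots[of ?d ?n] assms by blast
  then show ?thesis
    by simp
qed

text \<open>The squared moduli divided by their binomials add up to a constant on the sphere. After
  integration each of the 2 l + 1 terms contributes the same amount, which is the source of the
  factor 2 l + 1.\<close>

lemma harm_basis_norm_0:
  "L2_inner \<omega> (harm_basis l 0) (harm_basis l 0) =
    of_real (4 ^ l / ((2 * real l + 1) * real ((2 * l) choose l)))"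
proof -
  let ?n = "2 * l" and ?M = "\<lambda>k. L2_inner \<omega> (harm_basis l k) (harm_basis l k)"
  let ?S = "\<lambda>x. \<Sum>k\<le>?n. harm_basis l k (cvec x) * cnj (harm_basis l k (cvec x)) / of_nat (?n choose k)"
  have S: "?S x = of_real (4 ^ l / real (?n choose l))" if x: "x \<in> space \<omega>" for x
  proof -
    have "norm x = 1"
      using x by (simp add: space_omega)
    then obtain \<theta> \<phi> where x: "x = sph \<theta> \<phi>"
      using sphere_sph by metis
    have "harm_basis l k (cvec x) * cnj (harm_basis l k (cvec x)) / of_nat (?n choose k) =
        of_real ((poly.coeff ([:sin \<theta>, 2 * cos \<theta>, - sin \<theta>:] ^ l) k)\<^sup>2 / real (?n choose k))" for k
    proof -
      \<comment> \<open>Only absolute values enter, so the phases depending on the azimuth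
        disappear.\<close>
      have "cmod (harm_basis l k (cvec x) * cis \<phi> ^ k) =
          cmod (cis \<phi> ^ l * complex_of_real (poly.coeff ([:sin \<theta>, 2 * cos \<theta>, - sin \<theta>:] ^ l) k))"
        unfolding x harm_basis_sph ..
      then have "cmod (harm_basis l k (cvec x)) = \<bar>poly.coeff ([:sin \<theta>, 2 * cos \<theta>, - sin \<theta>:] ^ l) k\<bar>"
        by (simp add: norm_mult norm_power)
      then show ?thesis
        unfolding complex_norm_square[symmetric] by simp
    qed
    then show ?thesis
      by (simp only: of_real_sum[symmetric] zonal_square_sum)
  qed
  have "(LINT x|\<omega>. ?S x) = (LINT x|\<omega>. complex_of_real (4 ^ l / real (?n choose l)))"
    by (rule Bochner_Integration.integral_cong[OF refl S])
  also have "\<dots> = of_real (4 ^ l / real (?n choose l))"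
    by (simp add: prob_space)
  also have "(LINT x|\<omega>. ?S x) = (\<Sum>k\<le>?n. ?M k / of_nat (?n choose k))"
    unfolding L2_inner_def
    by (subst Bochner_Integration.integral_sum) (auto intro!: integrable_divide integrable_inner harm_basis_polys)
  also have "\<dots> = (\<Sum>k\<le>?n. ?M 0)"
  proof (intro sum.cong refl)
    show "?M k / of_nat (?n choose k) = ?M 0" if "k \<in> {..?n}" for k
      using harm_basis_norm_ratio[of k l] that by simp
  qed
  also have "\<dots> = of_real (2 * real l + 1) * ?M 0"
    by (simp add: algebra_simps)
  finally have e: "of_real (2 * real l + 1) * ?M 0 = of_real (4 ^ l / real (?n choose l))" .
  have p: "complex_of_real (2 * real l + 1) \<noteq> 0"
    unfolding of_real_eq_0_iff by linarith
  have "?M 0 = of_real (4 ^ l / real (?n choose l)) / of_real (2 * real l + 1)"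
    unfolding nonzero_eq_divide_eq[OF p] using e by (simp only: mult.commute)
  then show ?thesis
    by (simp add: mult.commute)
qed

text \<open>\<open>harm_mono\<close> divides by the binomial, so squared norms proportional to it
  become inversely proportional. Up to a constant these are the squared Bombieri-Weyl norms of the
  monomials.\<close>

lemma L2_inner_harm_mono:
  assumes "j \<le> 2 * l" "k \<le> 2 * l"
  shows "L2_inner \<omega> (harm_mono l j) (harm_mono l k) =
    (if j = k then 1 / (of_nat ((2 * l) choose k) * of_real ((2 * real l + 1) * real ((2 * l) choose l))) else 0)"
proof (cases "j = k")
  case False
  then have "2 * l - j \<noteq> 2 * l - k"
    using assms by auto
  then show ?thesis
    using False by (simp add: harm_mono_def L2_inner_cscale_left L2_inner_cscale_right harm_basis_orthogonal)
next
  case True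
  define C where "C = complex_of_nat ((2 * l) choose k)"
  have C: "C \<noteq> 0" "cnj C = C" "of_nat ((2 * l) choose (2 * l - k)) = C"
    using assms by (auto simp: C_def binomial_symmetric[OF assms(2), symmetric])
  have s: "(- 2 :: complex) ^ l * (- 2) ^ l = 4 ^ l" "(- 1 :: complex) ^ k * (- 1) ^ k = 1"
    by (simp_all flip: power_mult_distrib)
  have "L2_inner \<omega> (harm_mono l k) (harm_mono l k) =
      (1 / ((- 2) ^ l * C * (- 1) ^ k)) * (1 / ((- 2) ^ l * C * (- 1) ^ k)) *
      (C * of_real (4 ^ l / ((2 * real l + 1) * real ((2 * l) choose l))))"
    unfolding harm_mono_def L2_inner_cscale_left L2_inner_cscale_right harm_basis_norm_ratio[OF diff_le_self]
      harm_basis_norm_0 C(3) C_def[symmetric] by (simp add: C)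
  also have "\<dots> = C * of_real (4 ^ l / ((2 * real l + 1) * real ((2 * l) choose l))) /
      (((- 2) ^ l * (- 2) ^ l) * ((- 1) ^ k * (- 1) ^ k) * (C * C))"
    by (simp add: mult_ac)
  also have "\<dots> = 1 / (C * of_real ((2 * real l + 1) * real ((2 * l) choose l)))"
    unfolding s using C by simp
  finally show ?thesis
    using True by (simp add: C_def)
qed

lemma L2_inner_Psi:
  assumes "f \<in> harmC l" "g \<in> harmC l"
  shows "L2_inner \<omega> f g = BW_inner (2 * l) (Psi l f) (Psi l g) / of_real ((2 * real l + 1) * real ((2 * l) choose l))"
proof -
  let ?n = "2 * l" and ?N = "complex_of_real ((2 * real l + 1) * real ((2 * l) choose l))"
  obtain a b where ab: "f \<circ> vmap = bform ?n a" "g \<circ> vmap = bform ?n b"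
    using Sym_bform homog_comp_vmap harmC_homog assms by metis
  have "L2_inner \<omega> f g = (\<Sum>j\<le>?n. \<Sum>k\<le>?n. (of_nat (?n choose j) * a j) * cnj (of_nat (?n choose k) * b k) *
      L2_inner \<omega> (harm_mono l j) (harm_mono l k))"
    by (subst harm_expansion[OF assms(1) ab(1)], subst harm_expansion[OF assms(2) ab(2)])
      (rule L2_inner_double_sum[OF harmC_polys[OF harm_mono_harmonic]])
  also have "\<dots> = (\<Sum>j\<le>?n. \<Sum>k\<le>?n. if k = j then of_nat (?n choose j) * a j * cnj (b j) / ?N else 0)"
    by (intro sum.cong refl) (auto simp: L2_inner_harm_mono)
  also have "\<dots> = (\<Sum>j\<le>?n. of_nat (?n choose j) * a j * cnj (b j)) / ?N"
    by (simp add: sum_divide_distrib)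
  finally show ?thesis
    using assms by (simp add: Psi_apply ab BW_inner_bform)
qed

lemma L2_norm_inner: "L2_inner \<omega> f f = of_real ((L2_norm \<omega> f)\<^sup>2)"
proof -
  have "(L2_norm \<omega> f)\<^sup>2 = (LINT x|\<omega>. (cmod (f (cvec x)))\<^sup>2)"
    unfolding L2_norm_def by (intro real_sqrt_pow2 integral_nonneg_AE) simp
  then show ?thesis
    unfolding L2_inner_def by (simp only: complex_norm_square[symmetric] integral_complex_of_real)
qed

lemma BW_norm_inner: "F \<in> Sym n \<Longrightarrow> BW_inner n F F = of_real ((BW_norm n F)\<^sup>2)"
proof -
  assume "F \<in> Sym n"
  then obtain a where a: "F = bform n a"
    by (rule Sym_bform)
  show ?thesis
    unfolding a BW_inner_bform BW_norm_bform of_real_sum of_real_mult complex_norm_square by (simp add: mult.assoc)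
qed

lemma BW_norm_Psi:
  assumes "f \<in> harmC l"
  shows "(BW_norm (2 * l) (Psi l f))\<^sup>2 = (2 * real l + 1) * real ((2 * l) choose l) * (L2_norm \<omega> f)\<^sup>2"
proof -
  have "Psi l f \<in> Sym (2 * l)"
    using Psi_surj assms by blast
  then have "complex_of_real ((L2_norm \<omega> f)\<^sup>2) =
      of_real ((BW_norm (2 * l) (Psi l f))\<^sup>2 / ((2 * real l + 1) * real ((2 * l) choose l)))"
    using L2_inner_Psi[OF assms assms] unfolding L2_norm_inner BW_norm_inner[OF \<open>Psi l f \<in> Sym (2 * l)\<close>]
    by (simp only: of_real_divide)
  then have "(L2_norm \<omega> f)\<^sup>2 = (BW_norm (2 * l) (Psi l f))\<^sup>2 / ((2 * real l + 1) * real ((2 * l) choose l))"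
    unfolding of_real_eq_iff .
  moreover have "(2 * real l + 1) * real ((2 * l) choose l) > 0"
    by simp
  ultimately show ?thesis
    by (simp only: nonzero_mult_div_cancel_left less_irrefl field_simps)
qed

lemma Psi_unitary:
  "unitary_on (harmC l) (L2_inner \<omega>) (Sym (2 * l)) (BW_inner (2 * l))
    (\<lambda>f. cscale (of_real (1 / sqrt ((2 * real l + 1) * real ((2 * l) choose l)))) (Psi l f))"
proof -
  define N where "N = (2 * real l + 1) * real ((2 * l) choose l)"
  define c where "c = complex_of_real (1 / sqrt N)"
  have "N > 0"
    by (simp add: N_def)
  then have c: "c \<noteq> 0" "c * cnj c = 1 / of_real N"
    by (auto simp: c_def simp flip: of_real_mult)
  have lin: "clinear_on (harmC l) (Sym (2 * l)) (\<lambda>f. cscale c (Psi l f))"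
    using Psi_linear[of l] unfolding clinear_on_def
    by (auto simp: cscale_add cscale_cscale mult.commute intro: homog_cscale)
  have "inj_on (\<lambda>f. cscale c (Psi l f)) (harmC l)"
  proof
    fix f g assume fg: "f \<in> harmC l" "g \<in> harmC l" "cscale c (Psi l f) = cscale c (Psi l g)"
    then have "cscale (1 / c) (cscale c (Psi l f)) = cscale (1 / c) (cscale c (Psi l g))"
      by simp
    then have "Psi l f = Psi l g"
      using c(1) by (simp add: cscale_cscale)
    then show "f = g"
      using Psi_inj fg by (auto dest: inj_onD)
  qed
  moreover have "(\<lambda>f. cscale c (Psi l f)) ` harmC l = Sym (2 * l)"
  proof
    show "(\<lambda>f. cscale c (Psi l f)) ` harmC l \<subseteq> Sym (2 * l)"
      using lin unfolding clinear_on_def by blast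
    show "Sym (2 * l) \<subseteq> (\<lambda>f. cscale c (Psi l f)) ` harmC l"
    proof
      fix F assume "F \<in> Sym (2 * l)"
      then have "cscale (1 / c) F \<in> Psi l ` harmC l"
        unfolding Psi_surj by (rule homog_cscale)
      then obtain f where f: "f \<in> harmC l" "cscale (1 / c) F = Psi l f"
        by blast
      have "F = cscale c (Psi l f)"
        unfolding f(2)[symmetric] using c(1) by (simp add: cscale_cscale)
      then show "F \<in> (\<lambda>f. cscale c (Psi l f)) ` harmC l"
        using f(1) by blast
    qed
  qed
  moreover have "BW_inner (2 * l) (cscale c (Psi l f)) (cscale c (Psi l g)) = L2_inner \<omega> f g"
    if "f \<in> harmC l" "g \<in> harmC l" for f g
  proof -
    have "h \<circ> vmap \<in> Sym (2 * l)" if h: "h \<in> harmC l" for h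
      unfolding Psi_apply[OF h, symmetric] Psi_surj[symmetric] by (rule imageI[OF h])
    from this[OF that(1)] this[OF that(2)] obtain a b where ab: "f \<circ> vmap = bform (2 * l) a" "g \<circ> vmap = bform (2 * l) b"
      by (elim Sym_bform)
    have "BW_inner (2 * l) (cscale c (Psi l f)) (cscale c (Psi l g)) = (c * cnj c) * BW_inner (2 * l) (Psi l f) (Psi l g)"
      unfolding Psi_apply[OF that(1)] Psi_apply[OF that(2)] ab bform_cscale BW_inner_bform sum_distrib_left
      by (intro sum.cong refl) (simp only: complex_cnj_mult mult_ac)
    then show ?thesis
      unfolding c(2) L2_inner_Psi[OF that] N_def by simp
  qed
  ultimately show ?thesis
    using lin unfolding unitary_on_def clinear_iso_def bij_betw_def c_def N_def by blast
qed

end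

section \<open>The graded algebra isomorphism\<close>

lemma fun_alg_simps [simp]:
  "carrier (fun_alg S) = S" "mult (fun_alg S) = (*)" "one (fun_alg S) = 1" "zero (fun_alg S) = 0"
  "add (fun_alg S) = (+)" "Module.smult (fun_alg S) = cscale"
  by (simp_all add: fun_alg_def)

lemma complex_ring_simps [simp]:
  "carrier complex_ring = UNIV" "mult complex_ring = (*)" "one complex_ring = 1" "zero complex_ring = 0"
  "add complex_ring = (+)"
  by (simp_all add: ring_of_type_algebra_def)

lemma fun_alg_algebra:
  assumes "0 \<in> S" "1 \<in> S" "\<And>f g. f \<in> S \<Longrightarrow> g \<in> S \<Longrightarrow> f + g \<in> S" "\<And>f g. f \<in> S \<Longrightarrow> g \<in> S \<Longrightarrow> f * g \<in> S"
    "\<And>c f. f \<in> S \<Longrightarrow> cscale c f \<in> S"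
  shows "Module.algebra complex_ring (fun_alg S)"
proof (rule algebraI)
  show "cring complex_ring"
    by (rule cring_from_type_algebra)
  show "cring (fun_alg S)"
  proof (rule cringI)
    show "abelian_group (fun_alg S)"
    proof (rule abelian_groupI)
      fix f assume "f \<in> carrier (fun_alg S)"
      then have "cscale (- 1) f \<in> carrier (fun_alg S)" "cscale (- 1) f \<oplus>\<^bsub>fun_alg S\<^esub> f = \<zero>\<^bsub>fun_alg S\<^esub>"
        using assms(5) by (auto simp: fun_eq_iff fun_simps)
      then show "\<exists>g\<in>carrier (fun_alg S). g \<oplus>\<^bsub>fun_alg S\<^esub> f = \<zero>\<^bsub>fun_alg S\<^esub>"
        by blast
    qed (use assms in \<open>auto simp: add_ac\<close>)
    show "Group.comm_monoid (fun_alg S)"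
      by (rule comm_monoidI) (use assms in \<open>auto simp: mult_ac\<close>)
  qed (auto simp: distrib_right)
qed (use assms in \<open>auto simp: cscale_add_left cscale_add cscale_cscale cscale_mult_left\<close>)

lemma poly_alg_algebra: "Module.algebra complex_ring poly_alg"
  by (rule fun_alg_algebra) (auto intro: one_polys polys_add polys_mult polys_cscale)

lemma fun_alg_minus:
  assumes "Module.algebra complex_ring (fun_alg S)" "f \<in> S" "cscale (- 1) f \<in> S"
  shows "\<ominus>\<^bsub>fun_alg S\<^esub> f = cscale (- 1) f"
proof -
  interpret Module.algebra complex_ring "fun_alg S"
    by (rule assms(1))
  show ?thesis
    by (rule M.minus_equality) (use assms in \<open>auto simp: fun_eq_iff fun_simps\<close>)
qed

lemma fun_alg_submodule:
  assumes "Module.algebra complex_ring (fun_alg S)" "V \<subseteq> S" "0 \<in> V" "\<And>f g. f \<in> V \<Longrightarrow> g \<in> V \<Longrightarrow> f + g \<in> V"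
    "\<And>c f. f \<in> V \<Longrightarrow> cscale c f \<in> V"
  shows "submodule V complex_ring (fun_alg S)"
proof -
  interpret Module.algebra complex_ring "fun_alg S"
    by (rule assms(1))
  show ?thesis
    by (rule submoduleI) (use assms in \<open>auto simp: fun_alg_minus[OF assms(1)] subset_iff\<close>)
qed

lemma fun_alg_finsum:
  assumes "Module.algebra complex_ring (fun_alg S)" "\<And>a. a \<in> A \<Longrightarrow> c a \<in> S"
  shows "finsum (fun_alg S) c A = (\<Sum>a\<in>A. c a)"
proof -
  interpret Module.algebra complex_ring "fun_alg S"
    by (rule assms(1))
  show ?thesis
    using assms(2)
  proof (induction A rule: infinite_finite_induct)
    case (infinite A)
    then show "finsum (fun_alg S) c A = (\<Sum>a\<in>A. c a)"
      by (simp add: M.finsum_infinite)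
  next
    case empty
    show "finsum (fun_alg S) c {} = (\<Sum>a\<in>{}. c a)"
      by simp
  next
    case (insert x A)
    then show "finsum (fun_alg S) c (insert x A) = (\<Sum>a\<in>insert x A. c a)"
      by (subst M.finsum_insert) auto
  qed
qed

text \<open>Evaluation at t x turns degrees into powers of t, and a polynomial in t that vanishes
  everywhere has zero coefficients.\<close>

lemma graded_independent:
  assumes "finite S" "\<And>d. d \<in> S \<Longrightarrow> G d \<in> homog (int d)" "(\<Sum>d\<in>S. G d) = 0" "d \<in> S"
  shows "G d = 0"
proof
  fix x
  obtain N where N: "S \<subseteq> {..N}"
    using finite_nat_iff_bounded_le assms(1) by blast
  have "(\<Sum>d\<le>N. (if d \<in> S then G d x else 0) * t ^ d) = (\<Sum>d\<le>N. 0 * t ^ d)" for t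
  proof -
    have "(\<Sum>d\<le>N. (if d \<in> S then G d x else 0) * t ^ d) = (\<Sum>d\<in>S. t ^ d * G d x)"
      using N by (intro sum.mono_neutral_cong_right) auto
    also have "\<dots> = (\<Sum>d\<in>S. G d (t *s x))"
      by (intro sum.cong refl) (simp add: homog_scale[OF assms(2)])
    also have "\<dots> = 0"
      using fun_cong[OF assms(3), of "t *s x"] by (simp add: fun_simps)
    finally show ?thesis
      by simp
  qed
  from polyfun_coeffs_eqD[OF this, of d] show "G d x = 0 x"
    using assms(4) N by (auto simp: fun_simps)
qed

lemma polys_graded:
  assumes "P \<in> polys"
  obtains G N where "\<And>d. G d \<in> homog (int d)" "P = (\<Sum>d\<le>N. G d)"
proof -
  \<comment> \<open>Strengthened by vanishing beyond N, so that two decompositions can be padded to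
    a common length.\<close>
  have "\<exists>G N. (\<forall>d. G d \<in> homog (int d)) \<and> (\<forall>d>N. G d = 0) \<and> P = (\<Sum>d\<le>N. G d)"
    using assms
  proof (induction rule: polys_homog_induct)
    case (homog d f)
    have "f = (\<Sum>e\<le>d. if e = d then f else 0)"
      by simp
    then show "\<exists>G N. (\<forall>d. G d \<in> homog (int d)) \<and> (\<forall>d>N. G d = 0) \<and> f = (\<Sum>d\<le>N. G d)"
      using homog by (intro exI[of _ "\<lambda>e. if e = d then f else 0"] exI[of _ d]) auto
  next
    case (add f g)
    then obtain G N H M where GH: "\<And>d. G d \<in> homog (int d)" "\<And>d. d > N \<Longrightarrow> G d = 0" "f = (\<Sum>d\<le>N. G d)"
      "\<And>d. H d \<in> homog (int d)" "\<And>d. d > M \<Longrightarrow> H d = 0" "g = (\<Sum>d\<le>M. H d)"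
      by blast
    have "f = (\<Sum>d\<le>max N M. G d)" "g = (\<Sum>d\<le>max N M. H d)"
      unfolding GH(3,6) by (rule sum.mono_neutral_left; use GH in auto)+
    then have "f + g = (\<Sum>d\<le>max N M. G d + H d)"
      by (simp add: sum.distrib)
    then show "\<exists>G N. (\<forall>d. G d \<in> homog (int d)) \<and> (\<forall>d>N. G d = 0) \<and> f + g = (\<Sum>d\<le>N. G d)"
      using GH by (intro exI[of _ "\<lambda>d. G d + H d"] exI[of _ "max N M"]) (auto intro: homog_add)
  qed
  then show ?thesis
    using that by blast
qed

section \<open>The algebra of forms of even degree\<close>

definition even_forms :: "(complex ^ 2 \<Rightarrow> complex) set" where
  "even_forms = {\<Sum>l\<in>S. G l | S G. finite S \<and> (\<forall>l\<in>S. G l \<in> Sym (2 * l))}"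

lemma even_alg_eq: "even_alg = fun_alg even_forms"
  by (simp add: even_alg_def even_forms_def)

text \<open>As the image of a linear and multiplicative map, the even forms inherit their closure
  properties from the polynomials in three variables.\<close>

lemma even_forms_eq: "even_forms = (\<lambda>P. P \<circ> vmap) ` polys"
proof
  show "even_forms \<subseteq> (\<lambda>P. P \<circ> vmap) ` polys"
  proof
    fix F assume "F \<in> even_forms"
    then obtain S G where S: "F = (\<Sum>l\<in>S. G l)" "finite S" "\<And>l. l \<in> S \<Longrightarrow> G l \<in> Sym (2 * l)"
      unfolding even_forms_def by blast
    have "\<forall>l. \<exists>P. l \<in> S \<longrightarrow> P \<in> homog (int l) \<and> G l = P \<circ> vmap"
      using S(3) comp_vmap_image by (metis (no_types, lifting) imageE)
    then obtain P where P: "\<And>l. l \<in> S \<Longrightarrow> P l \<in> homog (int l)" "\<And>l. l \<in> S \<Longrightarrow> G l = P l \<circ> vmap"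
      by metis
    have "F = (\<Sum>l\<in>S. P l) \<circ> vmap"
      unfolding S(1) comp_sum by (rule sum.cong) (auto simp: P(2))
    moreover have "(\<Sum>l\<in>S. P l) \<in> polys"
      using P(1) homog_polys by (blast intro: polys_sum)
    ultimately show "F \<in> (\<lambda>P. P \<circ> vmap) ` polys"
      by blast
  qed
  show "(\<lambda>P. P \<circ> vmap) ` polys \<subseteq> even_forms"
  proof safe
    fix P :: "complex ^ 3 \<Rightarrow> complex" assume "P \<in> polys"
    then obtain G N where G: "\<And>d. G d \<in> homog (int d)" "P = (\<Sum>d\<le>N. G d)"
      by (rule polys_graded) blast
    have e: "P \<circ> vmap = (\<Sum>d\<in>{..N}. G d \<circ> vmap)"
      unfolding G(2) comp_sum ..
    show "P \<circ> vmap \<in> even_forms"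
      unfolding even_forms_def mem_Collect_eq
      by (intro exI[of _ "{..N}"] exI[of _ "\<lambda>d. G d \<circ> vmap"] conjI e ballI homog_comp_vmap G) simp
  qed
qed

lemma even_alg_algebra: "Module.algebra complex_ring even_alg"
  unfolding even_alg_eq
proof (rule fun_alg_algebra)
  show "0 \<in> even_forms"
    unfolding even_forms_eq using comp_0 polys_0 by (metis image_eqI)
  have "1 = 1 \<circ> vmap"
    by (auto simp: fun_eq_iff fun_simps)
  then show "1 \<in> even_forms"
    unfolding even_forms_eq using one_polys by blast
qed (auto simp: even_forms_eq simp flip: comp_add comp_mult comp_cscale intro: polys_add polys_mult polys_cscale)

lemma Sym_subset_even_forms: "Sym (2 * l) \<subseteq> even_forms"
  unfolding even_forms_eq comp_vmap_image[symmetric] using homog_polys by blast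

lemma even_alg_graded: "graded_algebra even_alg (\<lambda>d. Sym (2 * d))"
  unfolding graded_algebra_def
proof (intro conjI allI ballI)
  note alg = even_alg_algebra[unfolded even_alg_eq]
  show "Module.algebra complex_ring even_alg"
    by (rule even_alg_algebra)
  show "submodule (Sym (2 * i)) complex_ring even_alg" for i
    unfolding even_alg_eq
    by (rule fun_alg_submodule[OF alg Sym_subset_even_forms]) (auto intro: homog_add homog_cscale)
  show "\<one>\<^bsub>even_alg\<^esub> \<in> Sym (2 * 0)"
    by (simp add: even_alg_eq one_homog)
  show "a \<otimes>\<^bsub>even_alg\<^esub> b \<in> Sym (2 * (i + j))" if "a \<in> Sym (2 * i)" "b \<in> Sym (2 * j)" for a b i j
    using homog_mult[OF that] by (simp add: even_alg_eq algebra_simps)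
  fix F assume "F \<in> carrier even_alg"
  then obtain S G where S: "F = (\<Sum>l\<in>S. G l)" "finite S" "\<And>l. l \<in> S \<Longrightarrow> G l \<in> Sym (2 * l)"
    unfolding even_alg_eq even_forms_def by auto
  have fs: "finsum even_alg c {i. c i \<noteq> \<zero>\<^bsub>even_alg\<^esub>} = (\<Sum>i | c i \<noteq> 0. c i)" if "\<And>i. c i \<in> Sym (2 * i)" for c
    unfolding even_alg_eq using that Sym_subset_even_forms by (subst fun_alg_finsum[OF alg]) auto
  show "\<exists>!c. (\<forall>i. c i \<in> Sym (2 * i)) \<and> finite {i. c i \<noteq> \<zero>\<^bsub>even_alg\<^esub>} \<and>
      F = finsum even_alg c {i. c i \<noteq> \<zero>\<^bsub>even_alg\<^esub>}"
  proof (rule ex1I)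
    let ?c = "\<lambda>i. if i \<in> S then G i else 0"
    have c: "\<And>i. ?c i \<in> Sym (2 * i)"
      using S(3) by simp
    have fin: "finite {i. ?c i \<noteq> 0}"
      by (rule finite_subset[OF _ S(2)]) auto
    have "F = (\<Sum>i | ?c i \<noteq> 0. ?c i)"
      unfolding S(1) by (rule sum.mono_neutral_cong_right[OF S(2)]) auto
    then show "(\<forall>i. ?c i \<in> Sym (2 * i)) \<and> finite {i. ?c i \<noteq> \<zero>\<^bsub>even_alg\<^esub>} \<and>
        F = finsum even_alg ?c {i. ?c i \<noteq> \<zero>\<^bsub>even_alg\<^esub>}"
      unfolding fs[OF c] using c fin by (simp add: even_alg_eq)
    fix e assume e: "(\<forall>i. e i \<in> Sym (2 * i)) \<and> finite {i. e i \<noteq> \<zero>\<^bsub>even_alg\<^esub>} \<and>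
        F = finsum even_alg e {i. e i \<noteq> \<zero>\<^bsub>even_alg\<^esub>}"
    then have e': "\<And>i. e i \<in> Sym (2 * i)" "finite {i. e i \<noteq> 0}" "F = (\<Sum>i | e i \<noteq> 0. e i)"
      using fs[of e] by (auto simp: even_alg_eq)
    \<comment> \<open>Two decompositions are compared on the union of their supports.\<close>
    let ?T = "S \<union> {i. e i \<noteq> 0}"
    have T: "finite ?T"
      using S(2) e'(2) by simp
    have "F = (\<Sum>i\<in>?T. ?c i)"
      unfolding S(1) by (rule sum.mono_neutral_cong_left[OF T]) auto
    moreover have "F = (\<Sum>i\<in>?T. e i)"
      unfolding e'(3) by (rule sum.mono_neutral_left[OF T]) auto
    ultimately have z: "(\<Sum>i\<in>?T. ?c i - e i) = 0"
      by (simp add: sum_subtractf)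
    \<comment> \<open>\<open>graded_independent\<close> is indexed by the true degree, so the
      component i is placed in degree 2 i and odd degrees get 0.\<close>
    let ?H = "\<lambda>d. if even d then ?c (d div 2) - e (d div 2) else 0"
    have on: "?c i = e i" if "i \<in> ?T" for i
    proof -
      have "(\<Sum>d\<in>(*) 2 ` ?T. ?H d) = 0"
        using z by (subst sum.reindex) (auto simp: inj_on_def cong: if_cong)
      moreover have "?H d \<in> homog (int d)" if d: "d \<in> (*) 2 ` ?T" for d
      proof -
        obtain j where "d = 2 * j"
          using d by blast
        then show ?thesis
          using homog_diff[OF c[of j] e'(1)[of j]] by (simp cong: if_cong)
      qed
      ultimately have "?H (2 * i) = 0"
        using that T by (intro graded_independent[of "(*) 2 ` ?T" ?H]) auto
      then show ?thesis
        by (simp cong: if_cong)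
    qed
    have off: "?c i = e i" if "i \<notin> ?T" for i
      using that by auto
    show "e = ?c"
    proof
      show "e i = ?c i" for i
        by (cases "i \<in> ?T") (rule on[symmetric] off[symmetric], assumption)+
    qed
  qed
qed

text \<open>The grading is pulled back through the injective h. The unique decomposition of
  \<open>h a\<close> lifts component by component, because h maps each component onto its
  counterpart.\<close>

lemma graded_algebra_transfer:
  fixes A :: "(complex, 'a) module" and B :: "(complex, 'b) module"
  assumes B: "graded_algebra B \<B>" and A: "Module.algebra complex_ring A" and h: "h \<in> ring_iso A B"
    and smult: "\<And>c x. x \<in> carrier A \<Longrightarrow> h (c \<odot>\<^bsub>A\<^esub> x) = c \<odot>\<^bsub>B\<^esub> h x"
    and sub: "\<And>i. \<A> i \<subseteq> carrier A" and im: "\<And>i. h ` \<A> i = \<B> i"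
  shows "graded_algebra A \<A>"
proof -
  interpret A: Module.algebra complex_ring A
    by (rule A)
  interpret B: Module.algebra complex_ring B
    using B by (simp add: graded_algebra_def)
  have hom: "h \<in> ring_hom A B" and bij: "bij_betw h (carrier A) (carrier B)"
    using h by (auto simp: ring_iso_def)
  interpret H: ring_hom_cring A B h
    by (intro ring_hom_cringI ring_hom_ringI2 cring.axioms(1)[OF A.M_cring] cring.axioms(1)[OF B.M_cring] hom A.M_cring B.M_cring)
  have inj: "inj_on h (carrier A)"
    using bij by (rule bij_betw_imp_inj_on)
  have mem: "x \<in> \<A> i \<longleftrightarrow> h x \<in> \<B> i" if "x \<in> carrier A" for x i
    using that sub[of i] im[of i] inj by (metis image_iff inj_on_image_mem_iff)
  have Bsub: "submodule (\<B> i) complex_ring B" for i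
    using B by (simp add: graded_algebra_def)
  note BE = B.submoduleE[OF Bsub]
  have Bzero: "\<zero>\<^bsub>B\<^esub> \<in> \<B> i" for i
    using subgroup.one_closed[OF submodule.axioms(1)[OF Bsub]] by simp
  show ?thesis
    unfolding graded_algebra_def
  proof (intro conjI allI ballI)
    show "Module.algebra complex_ring A"
      by (rule A)
    show "submodule (\<A> i) complex_ring A" for i
    proof (rule A.submoduleI)
      show "\<A> i \<subseteq> carrier A"
        by (rule sub)
      show "\<zero>\<^bsub>A\<^esub> \<in> \<A> i"
        using mem Bzero by simp
      show "\<ominus>\<^bsub>A\<^esub> a \<in> \<A> i" if "a \<in> \<A> i" for a
        using that subsetD[OF sub that] mem[of a i] mem[of "\<ominus>\<^bsub>A\<^esub> a" i] BE(3) by auto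
      show "a \<oplus>\<^bsub>A\<^esub> b \<in> \<A> i" if "a \<in> \<A> i" "b \<in> \<A> i" for a b
        using that subsetD[OF sub that(1)] subsetD[OF sub that(2)] mem[of a i] mem[of b i] mem[of "a \<oplus>\<^bsub>A\<^esub> b" i] BE(5)
        by auto
      show "c \<odot>\<^bsub>A\<^esub> a \<in> \<A> i" if "c \<in> carrier complex_ring" "a \<in> \<A> i" for c a
        using that subsetD[OF sub that(2)] mem[of a i] mem[of "c \<odot>\<^bsub>A\<^esub> a" i] BE(4)[of c "h a" i] smult[of a c]
          A.smult_closed[of c a] by auto
    qed
    show "\<one>\<^bsub>A\<^esub> \<in> \<A> 0"
      using B mem[of "\<one>\<^bsub>A\<^esub>" 0] by (simp add: graded_algebra_def)
    show "a \<otimes>\<^bsub>A\<^esub> b \<in> \<A> (i + j)" if "a \<in> \<A> i" "b \<in> \<A> j" for a b i j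
    proof -
      have c: "a \<in> carrier A" "b \<in> carrier A"
        using that sub by blast+
      have "h a \<otimes>\<^bsub>B\<^esub> h b \<in> \<B> (i + j)"
        using B that mem c by (simp add: graded_algebra_def)
      then show ?thesis
        using mem[of "a \<otimes>\<^bsub>A\<^esub> b"] c by simp
    qed
    fix a assume a: "a \<in> carrier A"
    have zero: "h x = \<zero>\<^bsub>B\<^esub> \<longleftrightarrow> x = \<zero>\<^bsub>A\<^esub>" if "x \<in> carrier A" for x
      using inj_on_eq_iff[OF inj that A.M.zero_closed] by simp
    let ?P = "\<lambda>c. (\<forall>i. c i \<in> \<A> i) \<and> finite {i. c i \<noteq> \<zero>\<^bsub>A\<^esub>} \<and> a = finsum A c {i. c i \<noteq> \<zero>\<^bsub>A\<^esub>}"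
    let ?Q = "\<lambda>c. (\<forall>i. c i \<in> \<B> i) \<and> finite {i. c i \<noteq> \<zero>\<^bsub>B\<^esub>} \<and> h a = finsum B c {i. c i \<noteq> \<zero>\<^bsub>B\<^esub>}"
    have PQ: "?P c \<longleftrightarrow> ?Q (h \<circ> c)" if c: "\<And>i. c i \<in> carrier A" for c
    proof -
      have s: "{i. (h \<circ> c) i \<noteq> \<zero>\<^bsub>B\<^esub>} = {i. c i \<noteq> \<zero>\<^bsub>A\<^esub>}"
        using zero c by simp
      have "h (finsum A c {i. c i \<noteq> \<zero>\<^bsub>A\<^esub>}) = finsum B (h \<circ> c) {i. c i \<noteq> \<zero>\<^bsub>A\<^esub>}"
        using c by (intro H.hom_finsum) auto
      moreover have "finsum A c {i. c i \<noteq> \<zero>\<^bsub>A\<^esub>} \<in> carrier A"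
        using c by (intro A.M.finsum_closed) auto
      ultimately have "a = finsum A c {i. c i \<noteq> \<zero>\<^bsub>A\<^esub>} \<longleftrightarrow> h a = finsum B (h \<circ> c) {i. c i \<noteq> \<zero>\<^bsub>A\<^esub>}"
        using inj_on_eq_iff[OF inj a] by metis
      then show ?thesis
        unfolding s using mem c by simp
    qed
    have "h a \<in> carrier B"
      using a by simp
    then have "\<exists>!c. ?Q c"
      using B unfolding graded_algebra_def by blast
    then obtain c where c: "?Q c" "\<And>c'. ?Q c' \<Longrightarrow> c' = c"
      by blast
    have "\<forall>i. \<exists>x. x \<in> \<A> i \<and> h x = c i"
      using c(1) im by (metis imageE)
    then obtain d where d: "\<And>i. d i \<in> \<A> i" "\<And>i. h (d i) = c i"
      by metis
    have dc: "h \<circ> d = c" "\<And>i. d i \<in> carrier A"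
      using d sub by (auto simp: fun_eq_iff)
    show "\<exists>!c. ?P c"
    proof (rule ex1I[of _ d])
      show "?P d"
        using c(1) PQ[of d] dc by simp
      fix e assume e: "?P e"
      then have ec: "\<And>i. e i \<in> carrier A"
        using sub by blast
      have "h \<circ> e = c"
        using c(2) PQ[of e] ec e by blast
      then have "h (e i) = h (d i)" for i
        unfolding dc(1)[symmetric] by (metis o_apply)
      then show "e = d"
        using inj ec dc(2) by (auto simp: inj_on_def)
    qed
  qed
qed

text \<open>The quotient is known to be a commutative ring, while its scalar multiplication is an
  additional field whose laws are verified after applying the injective h. The records A and R may
  have different types, so their agreement is expressed field by field.\<close>

lemma algebra_transfer:
  fixes A :: "(complex, 'a) module" and B :: "(complex, 'b) module"
  assumes B: "Module.algebra complex_ring B" and R: "cring R"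
    and AR: "carrier A = carrier R" "mult A = mult R" "one A = one R" "zero A = zero R" "add A = add R"
    and h: "h \<in> ring_iso R B"
    and closed: "\<And>c x. x \<in> carrier A \<Longrightarrow> c \<odot>\<^bsub>A\<^esub> x \<in> carrier A"
    and smult: "\<And>c x. x \<in> carrier A \<Longrightarrow> h (c \<odot>\<^bsub>A\<^esub> x) = c \<odot>\<^bsub>B\<^esub> h x"
  shows "Module.algebra complex_ring A" "h \<in> ring_iso A B"
proof -
  interpret R: cring R
    by (rule R)
  interpret B: Module.algebra complex_ring B
    by (rule B)
  have hom: "h \<in> ring_hom R B" and bij: "bij_betw h (carrier R) (carrier B)"
    using h by (auto simp: ring_iso_def)
  then show "h \<in> ring_iso A B"
    by (simp add: ring_iso_def ring_hom_def AR)
  have inj: "inj_on h (carrier R)"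
    using bij by (rule bij_betw_imp_inj_on)
  note eq = inj_on_eq_iff[OF inj]
  note hm = ring_hom_closed[OF hom] ring_hom_mult[OF hom] ring_hom_add[OF hom] ring_hom_one[OF hom]
  note cl = closed[unfolded AR] and sm = smult[unfolded AR]
  have A: "cring A"
  proof (rule cringI)
    show "abelian_group A"
    proof (rule abelian_groupI)
      fix x assume "x \<in> carrier A"
      then show "\<exists>y\<in>carrier A. y \<oplus>\<^bsub>A\<^esub> x = \<zero>\<^bsub>A\<^esub>"
        by (intro bexI[of _ "\<ominus>\<^bsub>R\<^esub> x"]) (auto simp: AR R.l_neg)
    qed (auto simp: AR R.a_ac)
    show "Group.comm_monoid A"
      by (rule comm_monoidI) (auto simp: AR R.m_ac)
  qed (auto simp: AR R.l_distr)
  show "Module.algebra complex_ring A"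
  proof (rule algebraI[OF cring_from_type_algebra A])
    show "a \<odot>\<^bsub>A\<^esub> x \<in> carrier A" if "x \<in> carrier A" for a x
      by (rule closed[OF that])
    show "(a \<oplus>\<^bsub>complex_ring\<^esub> b) \<odot>\<^bsub>A\<^esub> x = a \<odot>\<^bsub>A\<^esub> x \<oplus>\<^bsub>A\<^esub> b \<odot>\<^bsub>A\<^esub> x" if "x \<in> carrier A" for a b x
      using that unfolding AR
      by (subst eq[symmetric]) (auto simp: cl sm hm B.smult_l_distr[simplified])
    show "a \<odot>\<^bsub>A\<^esub> (x \<oplus>\<^bsub>A\<^esub> y) = a \<odot>\<^bsub>A\<^esub> x \<oplus>\<^bsub>A\<^esub> a \<odot>\<^bsub>A\<^esub> y" if "x \<in> carrier A" "y \<in> carrier A" for a x y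
      using that unfolding AR
      by (subst eq[symmetric]) (auto simp: cl sm hm B.smult_r_distr[simplified])
    show "(a \<otimes>\<^bsub>complex_ring\<^esub> b) \<odot>\<^bsub>A\<^esub> x = a \<odot>\<^bsub>A\<^esub> (b \<odot>\<^bsub>A\<^esub> x)" if "x \<in> carrier A" for a b x
      using that unfolding AR
      by (subst eq[symmetric]) (auto simp: cl sm hm B.smult_assoc1[simplified])
    show "\<one>\<^bsub>complex_ring\<^esub> \<odot>\<^bsub>A\<^esub> x = x" if "x \<in> carrier A" for x
      using that unfolding AR
      by (subst eq[symmetric]) (auto simp: cl sm hm B.smult_one[simplified])
    show "(a \<odot>\<^bsub>A\<^esub> x) \<otimes>\<^bsub>A\<^esub> y = a \<odot>\<^bsub>A\<^esub> (x \<otimes>\<^bsub>A\<^esub> y)" if "x \<in> carrier A" "y \<in> carrier A" for a x y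
      using that unfolding AR
      by (subst eq[symmetric]) (auto simp: cl sm hm B.smult_assoc2[simplified])
  qed
qed

text \<open>The pullbacks of the homogeneous parts of P live in distinct degrees 2 d, so each of
  them vanishes and each part is a multiple of q.\<close>

lemma principal_ideal_qf: "PIdl\<^bsub>poly_alg\<^esub> qf = {P \<in> polys. P \<circ> vmap = 0}"
proof
  show "PIdl\<^bsub>poly_alg\<^esub> qf \<subseteq> {P \<in> polys. P \<circ> vmap = 0}"
    by (auto simp: cgenideal_def polys_mult qf_polys comp_mult qf_comp_vmap)
  show "{P \<in> polys. P \<circ> vmap = 0} \<subseteq> PIdl\<^bsub>poly_alg\<^esub> qf"
  proof safe
    fix P :: "complex ^ 3 \<Rightarrow> complex" assume P: "P \<in> polys" "P \<circ> vmap = 0"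
    obtain G N where G: "\<And>d. G d \<in> homog (int d)" "P = (\<Sum>d\<le>N. G d)"
      using polys_graded[OF P(1)] by blast
    let ?H = "\<lambda>d. if even d then G (d div 2) \<circ> vmap else 0"
    have z: "(\<Sum>d\<in>(*) 2 ` {..N}. ?H d) = 0"
      using P(2) unfolding G(2) comp_sum by (subst sum.reindex) (auto simp: inj_on_def)
    have "\<exists>p. p \<in> polys \<and> G d = p * qf" if "d \<le> N" for d
    proof -
      have "?H (2 * d) = 0"
        by (rule graded_independent[OF _ _ z]) (use that G homog_comp_vmap in auto)
      then have "G d \<circ> vmap = 0"
        by simp
      then obtain p where "p \<in> homog (int d - 2)" "G d = qf * p"
        using comp_vmap_kernel[OF G(1)] by blast
      then show ?thesis
        using homog_polys by (metis mult.commute)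
    qed
    then obtain p where p: "\<And>d. d \<le> N \<Longrightarrow> p d \<in> polys \<and> G d = p d * qf"
      by metis
    have "P = (\<Sum>d\<le>N. p d) * qf"
      unfolding G(2) sum_distrib_right by (rule sum.cong) (auto simp: p)
    moreover have "(\<Sum>d\<le>N. p d) \<in> polys"
      using p by (intro polys_sum) auto
    ultimately show "P \<in> PIdl\<^bsub>poly_alg\<^esub> qf"
      by (auto simp: cgenideal_def)
  qed
qed

text \<open>The first isomorphism theorem for composition with v, whose kernel is the ideal of q.
  Composition with v is constant on a coset, which gives \<open>the_elem\<close> of the image its
  meaning.\<close>

lemma graded_iso_vmap:
  "graded_algebra_iso
    (quot_alg poly_alg (PIdl\<^bsub>poly_alg\<^esub> qf)) (\<lambda>d. (\<lambda>P. PIdl\<^bsub>poly_alg\<^esub> qf +>\<^bsub>poly_alg\<^esub> P) ` homog (int d))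
    even_alg (\<lambda>d. Sym (2 * d)) (\<lambda>U. the_elem ((\<lambda>P. P \<circ> vmap) ` U))"
proof -
  let ?h = "\<lambda>P :: complex ^ 3 \<Rightarrow> complex. P \<circ> vmap" and ?I = "PIdl\<^bsub>poly_alg\<^esub> qf"
  let ?A = "quot_alg poly_alg ?I" and ?e = "\<lambda>U. the_elem ((\<lambda>P. P \<circ> vmap) ` U)"
  have carE: "carrier even_alg = ?h ` polys"
    by (simp add: even_alg_eq even_forms_eq)
  have "?h 1 = 1"
    by (simp add: fun_eq_iff fun_simps)
  then have h: "?h \<in> ring_hom poly_alg even_alg"
    by (intro ring_hom_memI) (simp_all add: carE, simp_all add: even_alg_eq comp_mult comp_add)
  note P = algebra.M_cring[OF poly_alg_algebra] and E = algebra.M_cring[OF even_alg_algebra]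
  have H: "ring_hom_ring poly_alg even_alg ?h"
    by (rule ring_hom_ringI2[OF cring.axioms(1)[OF P] cring.axioms(1)[OF E] h])
  have ker: "a_kernel poly_alg even_alg ?h = ?I"
    by (simp add: a_kernel_def' principal_ideal_qf even_alg_eq)
  have iso: "?e \<in> ring_iso (poly_alg Quot ?I) even_alg"
    using ring_hom_ring.FactRing_iso_set[OF H] unfolding ker carE by simp
  have "ideal ?I poly_alg"
    by (rule cring.cgenideal_ideal[OF P]) (simp add: qf_polys)
  then have cr: "cring (poly_alg Quot ?I)"
    by (rule ideal.quotient_is_cring[OF _ P])
  have coset: "?I +>\<^bsub>poly_alg\<^esub> P = {P + i | i. i \<in> ?I}" for P
    by (auto simp: a_r_coset_def' add.commute)
  have carA: "carrier ?A = {?I +>\<^bsub>poly_alg\<^esub> P | P. P \<in> polys}"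
    by (auto simp: quot_alg_def FactRing_def A_RCOSETS_defs a_r_coset_def)
  have 0: "0 \<in> ?I"
    by (simp add: principal_ideal_qf comp_0)
  have img: "?h ` (?I +>\<^bsub>poly_alg\<^esub> P) = {?h P}" for P
  proof
    show "?h ` (?I +>\<^bsub>poly_alg\<^esub> P) \<subseteq> {?h P}"
      unfolding coset by (auto simp: principal_ideal_qf comp_add)
    show "{?h P} \<subseteq> ?h ` (?I +>\<^bsub>poly_alg\<^esub> P)"
      unfolding coset using 0 by (auto intro!: image_eqI[of _ _ P] exI[of _ 0])
  qed
  have coset_eq: "?I +>\<^bsub>poly_alg\<^esub> P = ?I +>\<^bsub>poly_alg\<^esub> Q" if "P \<in> polys" "Q \<in> polys" "?h P = ?h Q" for P Q
  proof -
    have d: "P - Q \<in> ?I" "Q - P \<in> ?I"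
      using that by (auto simp: principal_ideal_qf comp_diff polys_diff)
    have add: "i + j \<in> ?I" if "i \<in> ?I" "j \<in> ?I" for i j
      using that by (auto simp: principal_ideal_qf comp_add polys_add)
    show ?thesis
      unfolding coset
    proof safe
      fix i assume i: "i \<in> ?I"
      show "\<exists>j. P + i = Q + j \<and> j \<in> ?I"
        using add[OF d(1) i] by (intro exI[of _ "P - Q + i"]) simp
      show "\<exists>j. Q + i = P + j \<and> j \<in> ?I"
        using add[OF d(2) i] by (intro exI[of _ "Q - P + i"]) simp
    qed
  qed
  \<comment> \<open>Scalar multiplication in \<open>quot_alg\<close> is a union over all
    representatives; it is a single coset because every representative yields the same one.\<close>
  have sm: "c \<odot>\<^bsub>?A\<^esub> (?I +>\<^bsub>poly_alg\<^esub> P) = ?I +>\<^bsub>poly_alg\<^esub> (cscale c P)" if P: "P \<in> polys" for c P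
  proof -
    have eq: "?I +>\<^bsub>poly_alg\<^esub> (cscale c Q) = ?I +>\<^bsub>poly_alg\<^esub> (cscale c P)" if Q: "Q \<in> ?I +>\<^bsub>poly_alg\<^esub> P" for Q
    proof -
      obtain i where i: "i \<in> ?I" "Q = P + i"
        using Q unfolding coset by blast
      then have "Q \<in> polys" "?h Q = ?h P"
        using P by (auto simp: principal_ideal_qf polys_add comp_add)
      then show ?thesis
        using P by (intro coset_eq) (auto simp: polys_cscale comp_cscale)
    qed
    have "P \<in> ?I +>\<^bsub>poly_alg\<^esub> P"
      unfolding coset using 0 by force
    then have "(\<Union>Q\<in>?I +>\<^bsub>poly_alg\<^esub> P. ?I +>\<^bsub>poly_alg\<^esub> (cscale c Q)) = ?I +>\<^bsub>poly_alg\<^esub> (cscale c P)"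
      by (intro SUP_eq_const eq) auto
    then show ?thesis
      unfolding quot_alg_def by simp
  qed
  have smult: "?e (c \<odot>\<^bsub>?A\<^esub> U) = c \<odot>\<^bsub>even_alg\<^esub> ?e U" and closed: "c \<odot>\<^bsub>?A\<^esub> U \<in> carrier ?A" if U: "U \<in> carrier ?A" for c U
  proof -
    obtain P where P: "P \<in> polys" "U = ?I +>\<^bsub>poly_alg\<^esub> P"
      using U unfolding carA by blast
    show "?e (c \<odot>\<^bsub>?A\<^esub> U) = c \<odot>\<^bsub>even_alg\<^esub> ?e U"
      unfolding P(2) sm[OF P(1)] img by (simp add: even_alg_eq comp_cscale)
    show "c \<odot>\<^bsub>?A\<^esub> U \<in> carrier ?A"
      unfolding P(2) sm[OF P(1)] carA using polys_cscale[OF P(1)] by blast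
  qed
  have fields: "carrier ?A = carrier (poly_alg Quot ?I)" "mult ?A = mult (poly_alg Quot ?I)"
    "one ?A = one (poly_alg Quot ?I)" "zero ?A = zero (poly_alg Quot ?I)" "add ?A = add (poly_alg Quot ?I)"
    by (simp_all add: quot_alg_def)
  note tr = algebra_transfer[OF even_alg_algebra cr fields iso closed smult]
  have im: "?e ` ((\<lambda>P. ?I +>\<^bsub>poly_alg\<^esub> P) ` homog (int i)) = Sym (2 * i)" for i
    unfolding comp_vmap_image[symmetric] image_image img by simp
  have sub: "(\<lambda>P. ?I +>\<^bsub>poly_alg\<^esub> P) ` homog (int i) \<subseteq> carrier ?A" for i
    unfolding carA using homog_polys by blast
  have gr: "graded_algebra ?A (\<lambda>d. (\<lambda>P. ?I +>\<^bsub>poly_alg\<^esub> P) ` homog (int d))"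
    by (rule graded_algebra_transfer[OF even_alg_graded tr smult sub im])
  show ?thesis
    unfolding graded_algebra_iso_def using gr even_alg_graded tr(2) smult im by blast
qed

theorem theorem3p8:
  fixes l :: nat
  shows
    "(let I = PIdl\<^bsub>poly_alg\<^esub> qf in
        graded_algebra_iso
          (quot_alg poly_alg I) (\<lambda>d. (\<lambda>P. I +>\<^bsub>poly_alg\<^esub> P) ` homog (int d))
          even_alg (\<lambda>d. Sym (2 * d))
          (\<lambda>U. the_elem ((\<lambda>P. P \<circ> vmap) ` U))) \<and>
     (\<lambda>P. P \<circ> vmap) ` homog (int l) = Sym (2 * l) \<and>
     {P \<in> homog (int l). P \<circ> vmap = 0} = (\<lambda>p. qf * p) ` homog (int l - 2) \<and>
     clinear_iso (harmC l) (Sym (2 * l)) (Psi l) \<and>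
     (\<forall>P\<in>homog (int l). (\<exists>!h. is_harm_part l P h) \<and>
        (\<forall>F. P \<circ> vmap = F \<longrightarrow> inv_into (harmC l) (Psi l) F = harm_part l P) \<and>
        harm_part l P = (\<lambda>x. \<Sum>j = 0..l div 2.
          (- 1) ^ j * qf x ^ j * (laplacian ^^ j) P x /
          (2 ^ j * fact j * (\<Prod>i = 1..j. 2 * of_nat l - 2 * of_nat i + 1)))) \<and>
     (\<forall>m. \<forall>f\<in>harmC l. \<forall>g\<in>harmC m.
        Psi (l + m) (harm_part (l + m) (f * g)) = Psi l f * Psi m g)
     \<and>
     (\<forall>g\<in>SL2. \<exists>!A. is_rho g A) \<and>
     group_hom (matrix_group SL2) (matrix_group SO3C) rho \<and>
     rho \<in> epi (matrix_group SL2) (matrix_group SO3C) \<and>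
     kernel (matrix_group SL2) (matrix_group SO3C) rho = {mat 1, - mat 1} \<and>
     group_hom (matrix_group SU2) (matrix_group SO3R) rho \<and>
     rho \<in> epi (matrix_group SU2) (matrix_group SO3R) \<and>
     kernel (matrix_group SU2) (matrix_group SO3R) rho = {mat 1, - mat 1} \<and>
     (\<forall>g\<in>SL2. \<forall>f\<in>harmC l. Psi l (act (rho g) f) = act g (Psi l f)) \<and>
     (\<forall>T. clinear_on (harmC l) (Sym (2 * l)) T \<and>
          (\<forall>g\<in>SL2. \<forall>f\<in>harmC l. T (act (rho g) f) = act g (T f)) \<longrightarrow>
        (\<exists>c. \<forall>f\<in>harmC l. T f = cscale c (Psi l f)))
     \<and>
     (\<forall>m\<in>{- int l..int l}. (\<exists>!f. is_Y l m f) \<and>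
        Psi l (calY l m) =
          (\<lambda>z. of_real (Kconst l m) * (z $ 1) ^ nat (int l - m) * (z $ 2) ^ nat (int l + m))) \<and>
     (\<forall>\<eta> f a. f \<in> harmC l \<and> f = (\<Sum>m = - int l..int l. cscale (\<eta> m) (calY l m)) \<and>
          Psi l f = bform (2 * l) a \<longrightarrow>
        (\<forall>m\<in>{- int l..int l}. \<eta> m = fact l * a (nat (int l + m)) /
           of_real (sqrt ((2 * real l + 1) * fact (nat (int l - m)) * fact (nat (int l + m)))))) \<and>
     (\<forall>(c :: int \<Rightarrow> real) f a.
          f \<in> harmR l \<and> f = (\<Sum>m = - int l..int l. cscale (of_real (c m)) (Y l m)) \<and>
          Psi l f = bform (2 * l) a \<longrightarrow>
        a l = of_real (sqrt (2 * real l + 1) * c 0) \<and>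
        of_real (c 0) = a l / of_real (sqrt (2 * real l + 1)) \<and>
        (\<forall>p\<in>{1..l}.
           a (l - p) = of_real (nuconst l p) * (of_real (c (int p)) + \<i> * of_real (c (- int p))) \<and>
           a (l + p) = (- 1) ^ p * of_real (nuconst l p) *
             (of_real (c (int p)) - \<i> * of_real (c (- int p))) \<and>
           c (int p) = Re (a (l - p)) / nuconst l p \<and>
           c (- int p) = Im (a (l - p)) / nuconst l p))
     \<and>
     (\<forall>\<omega>. rotation_invariant_prob \<omega> \<longrightarrow>
        (\<forall>f\<in>harmC l. (BW_norm (2 * l) (Psi l f))\<^sup>2 =
           (2 * real l + 1) * real ((2 * l) choose l) * (L2_norm \<omega> f)\<^sup>2) \<and>
        unitary_on (harmC l) (L2_inner \<omega>) (Sym (2 * l)) (BW_inner (2 * l))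
          (\<lambda>f. cscale (of_real (1 / sqrt ((2 * real l + 1) * real ((2 * l) choose l)))) (Psi l f))) \<and>
     (\<forall>f\<in>harmR l. \<forall>z. of_real ((BW_norm (2 * l) (Psi l f))\<^sup>2) =
        (- 1) ^ l * transvectant (2 * l) (2 * l) (2 * l) (Psi l f) (Psi l f) z) \<and>
     (\<forall>a z. transvectant (2 * l) (2 * l) (2 * l) (bform (2 * l) a) (bform (2 * l) a) z =
        (\<Sum>k\<le>2 * l. (- 1) ^ k * of_nat ((2 * l) choose k) * a k * a (2 * l - k)))
     \<and>
     (\<forall>f\<in>harmC l. Psi l (poly_conj f) = sigma_form l (Psi l f)) \<and>
     Psi l ` harmR l = Fix_sigma l \<and>
     Fix_sigma l = {bform (2 * l) a | a. \<forall>k\<le>2 * l. a (2 * l - k) = (- 1) ^ (l + k) * cnj (a k)}"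
proof (unfold Let_def, intro conjI ballI allI impI)
  show "\<exists>!h. is_harm_part l P h" if "P \<in> homog (int l)" for P
    by (rule harm_part_props(1)[OF that])
  show "inv_into (harmC l) (Psi l) F = harm_part l P" if "P \<in> homog (int l)" "P \<circ> vmap = F" for P F
    using harm_part_props(4)[OF that(1)] that(2) by simp
  show "Psi (l + m) (harm_part (l + m) (f * g)) = Psi l f * Psi m g" if "f \<in> harmC l" "g \<in> harmC m" for m f g
    by (rule Psi_mult[OF that])
  show "\<exists>!A. is_rho g A" for g
    using is_rho_rho_mat is_rho_unique by blast
  show "Psi l (act (rho g) f) = act g (Psi l f)" if "g \<in> SL2" "f \<in> harmC l" for g f
    by (rule Psi_equivariant[OF that])
  show "\<exists>c. \<forall>f\<in>harmC l. T f = cscale c (Psi l f)"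
    if "clinear_on (harmC l) (Sym (2 * l)) T \<and> (\<forall>g\<in>SL2. \<forall>f\<in>harmC l. T (act (rho g) f) = act g (T f))" for T
    using that by (intro equivariant_scalar) auto
  show "\<eta> m = fact l * a (nat (int l + m)) /
      of_real (sqrt ((2 * real l + 1) * fact (nat (int l - m)) * fact (nat (int l + m))))"
    if "f \<in> harmC l \<and> f = (\<Sum>m = - int l..int l. cscale (\<eta> m) (calY l m)) \<and> Psi l f = bform (2 * l) a"
      "m \<in> {- int l..int l}" for \<eta> f a m
    by (rule calY_coefficients[of f \<eta> l a m, OF _ _ that(2)]) (use that(1) Psi_apply in metis)+
next
  fix c :: "int \<Rightarrow> real" and f a
  assume "f \<in> harmR l \<and> f = (\<Sum>m = - int l..int l. cscale (of_real (c m)) (Y l m)) \<and> Psi l f = bform (2 * l) a"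
  then have "f = (\<Sum>m = - int l..int l. cscale (of_real (c m)) (Y l m))" "f \<circ> vmap = bform (2 * l) a"
    by (auto simp: harmR_iff Psi_apply)
  note c = Y_coefficients[OF this]
  have "complex_of_real (sqrt (2 * real l + 1)) \<noteq> 0"
    unfolding of_real_eq_0_iff real_sqrt_eq_0_iff by linarith
  with c(1) show "a l = of_real (sqrt (2 * real l + 1) * c 0)" "of_real (c 0) = a l / of_real (sqrt (2 * real l + 1))"
    by simp_all
  fix p assume p: "p \<in> {1..l}"
  note cp = c(2,3)[OF p]
  show "a (l - p) = of_real (nuconst l p) * (of_real (c (int p)) + \<i> * of_real (c (- int p)))"
    "a (l + p) = (- 1) ^ p * of_real (nuconst l p) * (of_real (c (int p)) - \<i> * of_real (c (- int p)))"
    by (fact cp)+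
  show "c (int p) = Re (a (l - p)) / nuconst l p" "c (- int p) = Im (a (l - p)) / nuconst l p"
    unfolding cp(1) using nuconst_pos[of l p] by simp_all
next
  fix \<omega> assume "rotation_invariant_prob \<omega>"
  then interpret rotation_invariant \<omega>
    by unfold_locales
  show "(BW_norm (2 * l) (Psi l f))\<^sup>2 = (2 * real l + 1) * real ((2 * l) choose l) * (L2_norm \<omega> f)\<^sup>2"
    if "f \<in> harmC l" for f
    by (rule BW_norm_Psi[OF that])
  show "unitary_on (harmC l) (L2_inner \<omega>) (Sym (2 * l)) (BW_inner (2 * l))
      (\<lambda>f. cscale (of_real (1 / sqrt ((2 * real l + 1) * real ((2 * l) choose l)))) (Psi l f))"
    by (rule Psi_unitary)
next
  show "of_real ((BW_norm (2 * l) (Psi l f))\<^sup>2) =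
      (- 1) ^ l * transvectant (2 * l) (2 * l) (2 * l) (Psi l f) (Psi l f) z" if "f \<in> harmR l" for f z
    by (rule BW_norm_transvectant[OF that])
qed (fact graded_iso_vmap comp_vmap_image comp_vmap_kernel_eq Psi_iso rho_group_hom_SL2 rho_epi_SL2 rho_kernel_SL2
    rho_group_hom_SU2 rho_epi_SU2 rho_kernel_SU2 transvectant_full_bform Psi_harmR Fix_sigma_eq |
    erule harm_part_formula ex1_is_Y Psi_calY Psi_poly_conj)+

end
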